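(* Let $\eta>0$, let $\xi_1,\dots,\xi_m\in\mathbb R^n$ be unit vectors, and for every $i=1,\dots,m$ and $\omega\in\{-1,1\}$ let $\mathbf g_i^{\omega}:\mathbb R^n\to\mathbb R^n$ be a $C^\infty$ vector field. Assume that for every string $(\omega_1,\dots,\omega_m)\in\{-1,1\}^m$ the $m$ fields $\mathbf g_1^{\omega_1},\dots,\mathbf g_m^{\omega_m}$ satisfy the Chow hypothesis. Consider the switching system $$\dot{\mathbf z}=\sum_{i=1}^m \mathbf g_i^{w_i}(\mathbf z)\,u_i,$$ where each $w_i(t)\in\{-1,1\}$ is the output of the delayed relay with thresholds $(-\eta,\eta)$ applied to the input $\mathbf z(t)\cdot\xi_i$. Then the system is controllable: for every $A,B\in\mathbb R^n$ and every initial string $(w_1^0,\dots,w_m^0)\in\{-1,1\}^m$ compatible with $A$ (i.e. $A$ belongs to the sector of that string), there exist $T>0$ and piecewise constant controls $u_1,\dots,u_m:[0,T]\to\mathbb R$ which steer the system from $\mathbf z(0)=A$, with $w_i(0)=w_i^0$, to $\mathbf z(T)=B$.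
   Context: Chow hypothesis for smooth fields $\mathbf g_1,\dots,\mathbf g_m$ on $\mathbb R^n$: at every point of $\mathbb R^n$ the evaluations of all iterated Lie brackets (of any order, including the fields themselves) of $\mathbf g_1,\dots,\mathbf g_m$ span $\mathbb R^n$. Sectors. The sector of a string $\omega\in\{-1,1\}^m$ is the closed set of $\mathbf z\in\mathbb R^n$ such that, for each $i$, $\mathbf z\cdot\xi_i\ge-\eta$ if $\omega_i=1$, and $\mathbf z\cdot\xi_i\le\eta$ if $\omega_i=-1$. Sectors of different strings may overlap. Delayed relay with thresholds $(-\eta,\eta)$: if the output is $1$ it stays equal to $1$ as long as the input is $\ge-\eta$, and switches to $-1$ when the input would become $<-\eta$; if the output is $-1$ it stays equal to $-1$ as long as the input is $\le\eta$, and switches to $1$ when the input would become $>\eta$. Solutions. For given piecewise constant controls, initial point $A$ and compatible initial string, a solution is an absolutely continuous $\mathbf z(\cdot)$ together with a piecewise constant string $w(\cdot)=(w_1,\dots,w_m)(\cdot)$ such that $\mathbf z$ solves the ODE with the current string on each interval where $w$ is constant, and the component $w_i$ switches at a time $t$ precisely when, by continuing to move with the current string (mode), the solution would be forced to cross the corresponding threshold immediately after $t$ (i.e. $\mathbf z\cdot\xi_i$ would become $<-\eta$ if $w_i=1$, or $>\eta$ if $w_i=-1$). *)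

theory Defs
  imports "HOL-Analysis.Analysis"
begin

section \<open>Smooth vector fields and the Chow hypothesis\<close>

text \<open>A function is of class \<open>C\<^sup>k\<^sup>+\<^sup>1\<close> iff it is differentiable and all its directional derivatives
  are of class \<open>C\<^sup>k\<close>; in finite dimension this is the usual notion.\<close>

fun Ck :: "nat \<Rightarrow> ('a::euclidean_space \<Rightarrow> 'b::real_normed_vector) \<Rightarrow> bool" where
  "Ck 0 f \<longleftrightarrow> continuous_on UNIV f"
| "Ck (Suc k) f \<longleftrightarrow> (\<forall>x. f differentiable (at x)) \<and>
     (\<forall>v. Ck k (\<lambda>x. frechet_derivative f (at x) v))"

definition smooth :: "('a::euclidean_space \<Rightarrow> 'b::real_normed_vector) \<Rightarrow> bool" where
  "smooth f \<longleftrightarrow> (\<forall>k. Ck k f)"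

definition lie_bracket :: "('a::euclidean_space \<Rightarrow> 'a) \<Rightarrow> ('a \<Rightarrow> 'a) \<Rightarrow> 'a \<Rightarrow> 'a" where
  "lie_bracket f h x = frechet_derivative h (at x) (f x) - frechet_derivative f (at x) (h x)"

inductive_set iterated_brackets :: "('a::euclidean_space \<Rightarrow> 'a) set \<Rightarrow> ('a \<Rightarrow> 'a) set"
  for F :: "('a \<Rightarrow> 'a) set" where
  field: "f \<in> F \<Longrightarrow> f \<in> iterated_brackets F"
| bracket: "f \<in> iterated_brackets F \<Longrightarrow> h \<in> iterated_brackets F \<Longrightarrow>
    lie_bracket f h \<in> iterated_brackets F"

definition chow_hypothesis :: "('a::euclidean_space \<Rightarrow> 'a) set \<Rightarrow> bool" where
  "chow_hypothesis F \<longleftrightarrow> (\<forall>x. span {f x | f. f \<in> iterated_brackets F} = UNIV)"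

section \<open>Strings and sectors\<close>

definition strings :: "('m \<Rightarrow> int) set" where
  "strings = {\<omega>. \<forall>i. \<omega> i \<in> {-1, 1}}"

definition sector :: "real \<Rightarrow> ('m \<Rightarrow> real^'n) \<Rightarrow> ('m \<Rightarrow> int) \<Rightarrow> (real^'n) set" where
  "sector \<eta> \<xi> \<omega> =
    {z. \<forall>i. (\<omega> i = 1 \<longrightarrow> z \<bullet> \<xi> i \<ge> - \<eta>) \<and> (\<omega> i = -1 \<longrightarrow> z \<bullet> \<xi> i \<le> \<eta>)}"

section \<open>The switching system\<close>

definition piecewise_constant_on :: "real \<Rightarrow> real \<Rightarrow> (real \<Rightarrow> 'a) \<Rightarrow> bool" where
  "piecewise_constant_on a b f \<longleftrightarrow>
    (\<exists>P. finite P \<and> (\<forall>s t. {s<..<t} \<subseteq> {a..b} - P \<longrightarrow> f constant_on {s<..<t}))"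

definition absolutely_continuous_on :: "real \<Rightarrow> real \<Rightarrow> (real \<Rightarrow> 'a::real_normed_vector) \<Rightarrow> bool" where
  "absolutely_continuous_on a b f \<longleftrightarrow>
    (\<forall>\<epsilon>>0. \<exists>\<delta>>0. \<forall>(N::nat) s t.
      (\<forall>k<N. a \<le> s k \<and> s k \<le> t k \<and> t k \<le> b) \<longrightarrow>
      disjoint_family_on (\<lambda>k. {s k<..<t k}) {..<N} \<longrightarrow>
      (\<Sum>k<N. t k - s k) < \<delta> \<longrightarrow>
      (\<Sum>k<N. norm (f (t k) - f (s k))) < \<epsilon>)"

text \<open>The velocity at \<open>x\<close> in the mode \<open>\<omega>\<close> under the control value \<open>a\<close>.\<close>

definition velocity ::
  "('m::finite \<Rightarrow> int \<Rightarrow> real^'n \<Rightarrow> real^'n) \<Rightarrow> ('m \<Rightarrow> int) \<Rightarrow> ('m \<Rightarrow> real) \<Rightarrow> real^'n \<Rightarrow> real^'n" where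
  "velocity g \<omega> a x = (\<Sum>i\<in>UNIV. a i *\<^sub>R g i (\<omega> i) x)"

definition beyond_threshold :: "real \<Rightarrow> int \<Rightarrow> real \<Rightarrow> bool" where
  "beyond_threshold \<eta> \<sigma> s \<longleftrightarrow> (\<sigma> = 1 \<and> s < - \<eta>) \<or> (\<sigma> = -1 \<and> s > \<eta>)"

text \<open>Starting at \<open>x\<close> and continuing with the string \<open>\<omega>\<close> (whether or not a relay would have to
  switch), under the control value \<open>a\<close>, the \<open>i\<close>-th input is beyond the threshold of the output
  \<open>\<omega> i\<close> at times arbitrarily close to the starting time. The motion \<open>y\<close> considered here is a
  hypothetical one; it is unique for smooth fields.\<close>

definition forced_to_cross ::
  "real \<Rightarrow> ('m::finite \<Rightarrow> real^'n) \<Rightarrow> ('m \<Rightarrow> int \<Rightarrow> real^'n \<Rightarrow> real^'n) \<Rightarrow>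
   ('m \<Rightarrow> real) \<Rightarrow> real^'n \<Rightarrow> ('m \<Rightarrow> int) \<Rightarrow> 'm \<Rightarrow> bool" where
  "forced_to_cross \<eta> \<xi> g a x \<omega> i \<longleftrightarrow>
    (\<exists>\<delta>>0. \<exists>y. y 0 = x \<and>
      (\<forall>s\<in>{0..\<delta>}. (y has_vector_derivative velocity g \<omega> a (y s)) (at s within {0..\<delta>})) \<and>
      (\<exists>\<^sub>F s in at_right 0. beyond_threshold \<eta> (\<omega> i) (y s \<bullet> \<xi> i)))"

definition switch ::
  "real \<Rightarrow> ('m::finite \<Rightarrow> real^'n) \<Rightarrow> ('m \<Rightarrow> int \<Rightarrow> real^'n \<Rightarrow> real^'n) \<Rightarrow>
   ('m \<Rightarrow> real) \<Rightarrow> real^'n \<Rightarrow> ('m \<Rightarrow> int) \<Rightarrow> ('m \<Rightarrow> int)" where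
  "switch \<eta> \<xi> g a x \<omega> = (\<lambda>i. if forced_to_cross \<eta> \<xi> g a x \<omega> i then - \<omega> i else \<omega> i)"

text \<open>At a switching time the string still has its old value, as the thresholds themselves belong
  to the region where a relay keeps its output; hence \<open>w\<close> is continuous from the left, and
  \<open>w i 0\<close> may differ from the value of \<open>w i\<close> right after time 0. After a switch the
  string has changed and the new mode may force another component across its threshold at once;
  so the switching rule is iterated at the same instant until no component is forced to switch.
  A component cannot switch back at the same instant, the two thresholds being different.

  Since no component is forced to switch right after any \<open>t\<close>, a trajectory that starts in the
  sector of its initial string remains in the sector of the current string.\<close>

definition relay_solution ::
  "real \<Rightarrow> ('m::finite \<Rightarrow> real^'n) \<Rightarrow> ('m \<Rightarrow> int \<Rightarrow> real^'n \<Rightarrow> real^'n) \<Rightarrow>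
   real \<Rightarrow> ('m \<Rightarrow> real \<Rightarrow> real) \<Rightarrow> real^'n \<Rightarrow> ('m \<Rightarrow> int) \<Rightarrow>
   (real \<Rightarrow> real^'n) \<Rightarrow> ('m \<Rightarrow> real \<Rightarrow> int) \<Rightarrow> bool" where
  "relay_solution \<eta> \<xi> g T u A w0 z w \<longleftrightarrow>
    z 0 = A \<and> (\<forall>i. w i 0 = w0 i) \<and>
    absolutely_continuous_on 0 T z \<and>
    (\<forall>i. piecewise_constant_on 0 T (w i)) \<and>
    (\<forall>t\<in>{0..T}. (\<lambda>i. w i t) \<in> strings) \<and>
    (AE t in lborel. t \<in> {0..T} \<longrightarrow>
      (z has_vector_derivative velocity g (\<lambda>i. w i t) (\<lambda>i. u i t) (z t)) (at t)) \<and>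
    (\<forall>t\<in>{0<..T}. \<forall>\<^sub>F s in at_left t. \<forall>i. w i s = w i t) \<and>
    (\<forall>t\<in>{0..<T}. \<exists>a \<omega> k.
      (\<forall>\<^sub>F s in at_right t. \<forall>i. u i s = a i \<and> w i s = \<omega> i) \<and>
      \<omega> = (switch \<eta> \<xi> g a (z t) ^^ k) (\<lambda>i. w i t) \<and>
      switch \<eta> \<xi> g a (z t) \<omega> = \<omega>)"

end

theory Submission
  imports Defs
begin

text \<open>Chow's theorem is proved without differentiating flows in the initial point. Fix an
  equivalence relation \<open>R\<close> whose classes contain the trajectories of the given fields. A field
  \<open>X\<close> is called Euler approximable if, for small \<open>h\<close>, there are continuous maps
  \<open>(s, x) \<mapsto> \<psi> s x\<close>, \<open>0 \<le> s \<le> h\<close>, along \<open>R\<close> with \<open>\<psi> s x = x + s X(x) + o(h)\<close>. Iterating \<open>\<psi> (s / N)\<close>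
  \<open>N\<close> times improves the accuracy to the second Taylor polynomial with error \<open>O(h\<^sup>3)\<close>, which is
  enough to expand the commutator of two such maps at time \<open>\<surd>t\<close>; so Lie brackets are again Euler
  approximable. If brackets \<open>X\<^sub>1, \<dots>, X\<^sub>n\<close> form a basis at \<open>p\<close>, the composition of the
  corresponding maps is a small perturbation of \<open>s \<mapsto> p + \<Sum> s\<^sub>j X\<^sub>j(p)\<close>, and Brouwer's fixed point
  theorem shows that one and the same point is \<open>R\<close>-related to every point near \<open>p\<close>. Hence
  \<open>R\<close>-classes are open, and a connected open set is a single class.

  For the relay system, work in a ball of radius \<open>\<eta>\<close>. There each relay can switch at most once,
  since its thresholds are \<open>2 \<eta>\<close> apart. Follow a Chow path to the target in the current mode; if a
  switch is forced on the way, perform it and start again in the new mode. After finitely many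
  switches the target is reached, and a chain of balls along the segment joins any two points.\<close>

section \<open>Functions of class \<open>C\<^sup>k\<close>\<close>

text \<open>Of a flow only its continuity and the estimate \<open>x + s X(x) + O(s^2)\<close> are
  used. More would not survive: the map made for a bracket runs its factors for time
  \<open>sqrt s\<close> and is known to be no more than continuous. This is also why Brouwer's
  theorem stands in for the inverse function theorem. The Euler property by itself does not pass to
  brackets: four maps run for time \<open>t\<close> produce a bracket displacement of order
  \<open>t^2\<close>, which their own error \<open>o(t)\<close> would hide. Subdividing each map
  buys the missing order, at the price that the maps depend on the largest time \<open>h\<close> and
  on the accuracy wanted.

  The relation \<open>R\<close> cannot be reachability for the relay system: hysteresis makes that a
  relation between pairs of a point and a string, with no evident symmetry. Chow's theorem is
  therefore applied to the mode frozen at one string, with the thresholds ignored, and a relay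
  trajectory follows such a path only up to the first forced switch.\<close>

lemma Ck_SucI:
  assumes "\<And>x. (f has_derivative f' x) (at x)" and "\<And>v. Ck k (\<lambda>x. f' x v)"
  shows "Ck (Suc k) f"
proof -
  have "frechet_derivative f (at x) = f' x" for x
    using frechet_derivative_at[OF assms(1)] by simp
  then show ?thesis
    using assms(2) differentiableI[OF assms(1)] by simp
qed

lemma Ck_Suc_has_derivative:
  "Ck (Suc k) f \<Longrightarrow> (f has_derivative frechet_derivative f (at x)) (at x)"
  by (simp add: frechet_derivative_works)

text \<open>Class \<open>C^(k+1)\<close> demands continuity only of the derivatives of top order;
  continuity at the lower levels comes from differentiability, which is the base case.\<close>

lemma Ck_Suc_imp_Ck: "Ck (Suc k) f \<Longrightarrow> Ck k f"
proof (induction k arbitrary: f)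
  case 0
  then have "\<And>x. (f has_derivative frechet_derivative f (at x)) (at x)"
    by (rule Ck_Suc_has_derivative)
  then show ?case
    unfolding Ck.simps(1) by (rule has_derivative_continuous_on[OF has_derivative_at_withinI])
next
  case (Suc k)
  have "\<forall>x. f differentiable (at x)" "\<And>v. Ck (Suc k) (\<lambda>x. frechet_derivative f (at x) v)"
    using Suc.prems unfolding Ck.simps(2)[of "Suc k"] by blast+
  then show ?case
    by (intro Ck_SucI[OF Ck_Suc_has_derivative[OF Suc.prems]] Suc.IH)
qed

lemma Ck_const: "Ck k (\<lambda>x. c)"
  by (induction k arbitrary: c) (auto intro!: continuous_intros)

lemma Ck_add: "Ck k f \<Longrightarrow> Ck k g \<Longrightarrow> Ck k (\<lambda>x. f x + g x)"
proof (induction k arbitrary: f g)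
  case 0
  then show ?case by (auto intro!: continuous_intros)
next
  case (Suc k)
  show ?case
    by (rule Ck_SucI[OF has_derivative_add[OF Suc.prems[THEN Ck_Suc_has_derivative]]])
       (use Suc in simp)
qed

lemma Ck_sum: "(\<And>i. i \<in> I \<Longrightarrow> Ck k (f i)) \<Longrightarrow> Ck k (\<lambda>x. \<Sum>i\<in>I. f i x)"
  by (induction I rule: infinite_finite_induct) (simp_all add: Ck_const Ck_add)

lemma Ck_bounded_linear: "bounded_linear L \<Longrightarrow> Ck k f \<Longrightarrow> Ck k (\<lambda>x. L (f x))"
proof (induction k arbitrary: f)
  case 0
  then show ?case by (simp add: bounded_linear.continuous_on)
next
  case (Suc k)
  show ?case
    by (rule Ck_SucI[OF bounded_linear.has_derivative[OF Suc.prems(1) Ck_Suc_has_derivative[OF Suc.prems(2)]]])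
       (use Suc in simp)
qed

lemma Ck_scaleR: "Ck k f \<Longrightarrow> Ck k g \<Longrightarrow> Ck k (\<lambda>x. f x *\<^sub>R g x)"
proof (induction k arbitrary: f g)
  case 0
  then show ?case by (auto intro!: continuous_intros)
next
  case (Suc k)
  have "Ck k (\<lambda>x. f x *\<^sub>R frechet_derivative g (at x) v + frechet_derivative f (at x) v *\<^sub>R g x)" for v
    using Suc.prems[THEN Ck_Suc_imp_Ck] Suc.prems by (intro Ck_add Suc.IH) simp_all
  then show ?case
    by (rule Ck_SucI[OF has_derivative_scaleR[OF Suc.prems[THEN Ck_Suc_has_derivative]]])
qed

lemma smooth_imp_Ck: "smooth f \<Longrightarrow> Ck k f"
  by (simp add: smooth_def)

lemma smooth_uminus: "smooth f \<Longrightarrow> smooth (\<lambda>x. - f x)"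
  by (simp add: smooth_def Ck_bounded_linear[OF bounded_linear_minus[OF bounded_linear_ident]])

lemma linear_Basis_expansion:
  fixes F :: "'a::euclidean_space \<Rightarrow> 'b::real_vector"
  assumes "linear F"
  shows "F v = (\<Sum>b\<in>Basis. (v \<bullet> b) *\<^sub>R F b)"
  using assms by (metis (no_types, lifting) euclidean_representation linear_scale linear_sum sum.cong)

text \<open>\<open>Ck\<close> speaks of derivatives in a fixed direction, while a bracket
  differentiates along a direction that moves with the point. Expanding the direction in
  \<open>Basis\<close> gives products of scalar components and derivatives in fixed
  directions.\<close>

lemma smooth_lie_bracket:
  assumes "smooth f" "smooth h"
  shows "smooth (lie_bracket f h)"
proof -
  have *: "Ck k (\<lambda>x. frechet_derivative h (at x) (f x))" if "smooth f" "smooth h"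
    for k and f h :: "'a \<Rightarrow> 'a"
  proof -
    have h: "Ck (Suc k) h" and f: "Ck k f" using that by (simp_all add: smooth_def del: Ck.simps)
    have "frechet_derivative h (at x) (f x)
        = (\<Sum>b\<in>Basis. (f x \<bullet> b) *\<^sub>R frechet_derivative h (at x) b)" for x
      using has_derivative_bounded_linear[OF Ck_Suc_has_derivative[OF h]]
      by (intro linear_Basis_expansion bounded_linear.linear)
    then show ?thesis
      using h f
      by (auto intro!: Ck_sum Ck_scaleR Ck_bounded_linear[OF bounded_linear_inner_left])
  qed
  have "Ck k (\<lambda>x. frechet_derivative h (at x) (f x) + - frechet_derivative f (at x) (h x))" for k
    by (intro Ck_add Ck_bounded_linear[OF bounded_linear_minus[OF bounded_linear_ident]] * assms)
  then show ?thesis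
    by (simp add: smooth_def lie_bracket_def[abs_def])
qed

lemma frechet_derivative_uminus:
  assumes "f differentiable (at x)"
  shows "frechet_derivative (\<lambda>x. - f x) (at x) = (\<lambda>v. - frechet_derivative f (at x) v)"
  using frechet_derivative_at[OF has_derivative_minus[OF frechet_derivative_works[THEN iffD1, OF assms]]]
  by simp

section \<open>Uniform bounds on balls\<close>

lemma compact_continuous_norm_bound:
  fixes f :: "'a::topological_space \<Rightarrow> 'b::real_normed_vector"
  assumes "compact S" "continuous_on S f"
  obtains M where "M \<ge> 0" "\<And>x. x \<in> S \<Longrightarrow> norm (f x) \<le> M"
  using compact_imp_bounded[OF compact_continuous_image[OF assms(2,1)]]
  unfolding bounded_iff by (metis imageI norm_ge_zero order.trans dual_order.trans linorder_linear)

text \<open>Leads from the fixed-direction form of \<open>Ck\<close> to bounds uniform in the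
  direction: a linear map is controlled by its values on the finitely many basis vectors.\<close>

lemma linear_norm_le_Basis:
  fixes F :: "'a::euclidean_space \<Rightarrow> 'b::real_normed_vector"
  assumes "linear F" "\<And>b. b \<in> Basis \<Longrightarrow> norm (F b) \<le> M b"
  shows "norm (F v) \<le> (\<Sum>b\<in>Basis. M b) * norm v"
proof -
  have "F v = (\<Sum>b\<in>Basis. (v \<bullet> b) *\<^sub>R F b)"
    by (rule linear_Basis_expansion[OF assms(1)])
  then have "norm (F v) \<le> (\<Sum>b\<in>Basis. norm ((v \<bullet> b) *\<^sub>R F b))"
    by (metis norm_sum)
  also have "\<dots> \<le> (\<Sum>b\<in>Basis. norm v * M b)"
    using assms(2) by (intro sum_mono) (auto intro!: mult_mono Basis_le_norm)
  finally show ?thesis by (simp add: sum_distrib_left mult.commute)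
qed

lemma Ck1_derivative_bound:
  fixes f :: "'a::euclidean_space \<Rightarrow> 'b::real_normed_vector"
  assumes f: "Ck 1 f"
  obtains L where "L \<ge> 0" "\<And>x v. x \<in> cball p r \<Longrightarrow> norm (frechet_derivative f (at x) v) \<le> L * norm v"
proof -
  let ?D = "\<lambda>x. frechet_derivative f (at x)"
  have der: "(f has_derivative ?D x) (at x)" for x
    using f unfolding One_nat_def by (rule Ck_Suc_has_derivative)
  have "\<exists>M. M \<ge> 0 \<and> (\<forall>x\<in>cball p r. norm (?D x b) \<le> M)" for b
  proof -
    have "continuous_on UNIV (\<lambda>x. ?D x b)"
      using f by simp
    then have "continuous_on (cball p r) (\<lambda>x. ?D x b)"
      by (rule continuous_on_subset) simp
    from compact_continuous_norm_bound[OF compact_cball this] show ?thesis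
      by metis
  qed
  then obtain M where M: "\<And>b. M b \<ge> 0" "\<And>b x. x \<in> cball p r \<Longrightarrow> norm (?D x b) \<le> M b"
    by metis
  show ?thesis
  proof (rule that)
    show "0 \<le> (\<Sum>b\<in>Basis. M b)"
      by (intro sum_nonneg M(1))
    show "norm (?D x v) \<le> (\<Sum>b\<in>Basis. M b) * norm v" if "x \<in> cball p r" for x v
      by (intro linear_norm_le_Basis bounded_linear.linear[OF has_derivative_bounded_linear[OF der]] M(2) that)
  qed
qed

lemma Ck1_lipschitz:
  fixes f :: "'a::euclidean_space \<Rightarrow> 'b::real_normed_vector"
  assumes f: "Ck 1 f"
  obtains L where "L > 0" "\<And>x y. x \<in> cball p r \<Longrightarrow> y \<in> cball p r \<Longrightarrow> norm (f x - f y) \<le> L * norm (x - y)"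
proof -
  obtain L where L: "L \<ge> 0" "\<And>x v. x \<in> cball p r \<Longrightarrow> norm (frechet_derivative f (at x) v) \<le> L * norm v"
    by (rule Ck1_derivative_bound[OF f, where p = p and r = r]) (rule that)
  have der: "(f has_derivative frechet_derivative f (at x)) (at x within cball p r)" for x
    using f unfolding One_nat_def by (rule has_derivative_at_withinI[OF Ck_Suc_has_derivative])
  have on: "onorm (frechet_derivative f (at x)) \<le> L" if "x \<in> cball p r" for x
    by (rule onorm_le) (rule L(2)[OF that])
  show ?thesis
  \<comment> \<open>The added 1 makes the constant positive, since time steps of the form
    \<open>1 / (2 * L)\<close> are built from it.\<close>
  proof (rule that[of "L + 1"])
    show "norm (f x - f y) \<le> (L + 1) * norm (x - y)" if "x \<in> cball p r" "y \<in> cball p r" for x y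
      using differentiable_bound[OF convex_cball der on that] by (simp add: algebra_simps add_increasing)
  qed (use L(1) in simp)
qed

text \<open>One constant serves all bounds, and \<open>L \<ge> 1\<close> lets higher powers of
  \<open>L\<close> absorb lower ones. The last bound is a Taylor remainder: along the segment from
  \<open>x\<close> the derivative differs from that at \<open>x\<close> by at most a multiple of the
  distance.\<close>

lemma Ck2_local_bounds:
  fixes f :: "'a::euclidean_space \<Rightarrow> 'b::real_normed_vector"
  assumes f: "Ck 2 f"
  obtains L where "L \<ge> 1"
    "\<And>x. x \<in> cball p r \<Longrightarrow> norm (f x) \<le> L"
    "\<And>x y. x \<in> cball p r \<Longrightarrow> y \<in> cball p r \<Longrightarrow> norm (f x - f y) \<le> L * norm (x - y)"
    "\<And>x v. x \<in> cball p r \<Longrightarrow> norm (frechet_derivative f (at x) v) \<le> L * norm v"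
    "\<And>x y v. x \<in> cball p r \<Longrightarrow> y \<in> cball p r \<Longrightarrow>
      norm (frechet_derivative f (at x) v - frechet_derivative f (at y) v) \<le> L * norm (x - y) * norm v"
    "\<And>x y. x \<in> cball p r \<Longrightarrow> y \<in> cball p r \<Longrightarrow>
      norm (f y - f x - frechet_derivative f (at x) (y - x)) \<le> L * norm (y - x) ^ 2"
proof -
  let ?D = "\<lambda>x. frechet_derivative f (at x)"
  have f2: "Ck (Suc (Suc 0)) f" using f unfolding numeral_2_eq_2 .
  then have f1: "Ck 1 f" unfolding One_nat_def by (rule Ck_Suc_imp_Ck)
  have der: "(f has_derivative ?D x) (at x)" for x
    using Ck_Suc_has_derivative[OF f2] .
  have cont: "continuous_on UNIV f"
    by (rule has_derivative_continuous_on[OF has_derivative_at_withinI[OF der]])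
  obtain M where M: "M \<ge> 0" "\<And>x. x \<in> cball p r \<Longrightarrow> norm (f x) \<le> M"
    by (rule compact_continuous_norm_bound[OF compact_cball[of p r] continuous_on_subset[OF cont subset_UNIV]]) (rule that)
  obtain L1 where L1: "L1 > 0" "\<And>x y. x \<in> cball p r \<Longrightarrow> y \<in> cball p r \<Longrightarrow> norm (f x - f y) \<le> L1 * norm (x - y)"
    by (rule Ck1_lipschitz[OF f1, where p = p and r = r]) (rule that)
  obtain L2 where L2: "L2 \<ge> 0" "\<And>x v. x \<in> cball p r \<Longrightarrow> norm (?D x v) \<le> L2 * norm v"
    by (rule Ck1_derivative_bound[OF f1, where p = p and r = r]) (rule that)
  have "\<exists>L>0. \<forall>x\<in>cball p r. \<forall>y\<in>cball p r. norm (?D x b - ?D y b) \<le> L * norm (x - y)" for b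
  proof -
    have "Ck 1 (\<lambda>x. ?D x b)" using f2 unfolding One_nat_def Ck.simps(2)[of "Suc 0"] by blast
    from Ck1_lipschitz[OF this, of p r] show ?thesis by metis
  qed
  then obtain N where N: "\<And>b. N b > 0"
      "\<And>b x y. x \<in> cball p r \<Longrightarrow> y \<in> cball p r \<Longrightarrow> norm (?D x b - ?D y b) \<le> N b * norm (x - y)"
    by metis
  have lin: "linear (?D x)" for x
    by (rule bounded_linear.linear[OF has_derivative_bounded_linear[OF der]])
  define L3 where "L3 = (\<Sum>b\<in>Basis. N b)"
  have L3: "L3 \<ge> 0" unfolding L3_def by (intro sum_nonneg less_imp_le N(1))
  have D2: "norm (?D x v - ?D y v) \<le> L3 * norm (x - y) * norm v" if "x \<in> cball p r" "y \<in> cball p r" for x y v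
    using linear_norm_le_Basis[OF linear_compose_sub[OF lin[of x] lin[of y]], of "\<lambda>b. N b * norm (x - y)" v] N(2)[OF that]
    by (simp add: L3_def sum_distrib_right)
  have T2: "norm (f y - f x - ?D x (y - x)) \<le> L3 * norm (y - x) ^ 2" if xy: "x \<in> cball p r" "y \<in> cball p r" for x y
  proof -
    have seg: "x + t *\<^sub>R (y - x) \<in> closed_segment x y" if "t \<in> {0..1}" for t
      using that by (auto simp: closed_segment_def algebra_simps intro!: exI[of _ t])
    have sub: "closed_segment x y \<subseteq> cball p r"
      using xy by (simp add: closed_segment_subset)
    have on: "onorm (?D z - ?D x) \<le> L3 * norm (y - x)" if "z \<in> closed_segment x y" for z
    proof (rule onorm_le)
      fix v
      have "norm ((?D z - ?D x) v) \<le> L3 * norm (z - x) * norm v"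
        using D2[of z x v] sub that xy by auto
      also have "\<dots> \<le> L3 * norm (y - x) * norm v"
        using segment_bound1[OF that] L3 by (intro mult_right_mono mult_left_mono) auto
      finally show "norm ((?D z - ?D x) v) \<le> L3 * norm (y - x) * norm v" .
    qed
    have "norm (f y - f x - ?D x (y - x)) \<le> norm (y - x) * (L3 * norm (y - x))"
      by (rule differentiable_bound_linearization[OF seg has_derivative_at_withinI[OF der] on])
         auto
    then show ?thesis by (simp add: power2_eq_square mult_ac)
  qed
  define L where "L = 1 + M + L1 + L2 + L3"
  have ge: "L \<ge> 1" "M \<le> L" "L1 \<le> L" "L2 \<le> L" "L3 \<le> L"
    using M L1 L2 L3 by (auto simp: L_def)
  show ?thesis
  proof (rule that[OF ge(1)])
    show "norm (f x) \<le> L" if "x \<in> cball p r" for x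
      using M(2)[OF that] ge by simp
    show "norm (f x - f y) \<le> L * norm (x - y)" if "x \<in> cball p r" "y \<in> cball p r" for x y
      using L1(2)[OF that] mult_right_mono[OF ge(3) norm_ge_zero, of "x - y"] by simp
    show "norm (?D x v) \<le> L * norm v" if "x \<in> cball p r" for x v
      using L2(2)[OF that, of v] mult_right_mono[OF ge(4) norm_ge_zero, of v] by simp
    show "norm (?D x v - ?D y v) \<le> L * norm (x - y) * norm v" if "x \<in> cball p r" "y \<in> cball p r" for x y v
      using D2[OF that, of v] mult_right_mono[OF mult_right_mono[OF ge(5) norm_ge_zero] norm_ge_zero, of "x - y" v] by simp
    show "norm (f y - f x - ?D x (y - x)) \<le> L * norm (y - x) ^ 2" if "x \<in> cball p r" "y \<in> cball p r" for x y
      using T2[OF that] mult_right_mono[OF ge(5) zero_le_power2, of "norm (y - x)"] by simp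
  qed
qed

section \<open>Ordinary differential equations\<close>

lemma vector_derivative_dist_bound:
  fixes f :: "real \<Rightarrow> 'a::real_normed_vector"
  assumes "\<And>s. s \<in> {a..b} \<Longrightarrow> (f has_vector_derivative f' s) (at s within {a..b})"
    and "\<And>s. s \<in> {a..b} \<Longrightarrow> norm (f' s) \<le> B"
    and "s \<in> {a..b}" "t \<in> {a..b}"
  shows "norm (f s - f t) \<le> B * \<bar>s - t\<bar>"
proof -
  have "onorm (\<lambda>x. x *\<^sub>R f' z) \<le> B" if "z \<in> {a..b}" for z
    by (rule onorm_le) (use mult_right_mono[OF assms(2)[OF that] abs_ge_zero] in \<open>simp add: mult.commute\<close>)
  then show ?thesis
    using differentiable_bound[of "{a..b}" f "\<lambda>z x. x *\<^sub>R f' z" B s t] assms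
    by (simp add: has_vector_derivative_def real_norm_def)
qed

definition solves_ode :: "('a::real_normed_vector \<Rightarrow> 'a) \<Rightarrow> real \<Rightarrow> (real \<Rightarrow> 'a) \<Rightarrow> bool" where
  "solves_ode V T y \<longleftrightarrow> (\<forall>s\<in>{0..T}. (y has_vector_derivative V (y s)) (at s within {0..T}))"

lemma solves_odeD: "solves_ode V T y \<Longrightarrow> s \<in> {0..T} \<Longrightarrow> (y has_vector_derivative V (y s)) (at s within {0..T})"
  by (simp add: solves_ode_def)

lemma solves_ode_subset: "solves_ode V T y \<Longrightarrow> T' \<le> T \<Longrightarrow> solves_ode V T' y"
  unfolding solves_ode_def
  by (meson atLeastAtMost_iff atLeastatMost_subset_iff has_vector_derivative_within_subset order.refl order.trans)

lemma solves_ode_continuous_on: "solves_ode V T y \<Longrightarrow> continuous_on {0..T} y"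
  by (meson continuous_on_vector_derivative solves_odeD)

lemma solves_ode_shift:
  assumes y: "solves_ode V T y" and t: "0 \<le> t" "t + T' \<le> T"
  shows "solves_ode V T' (\<lambda>s. y (t + s))"
  unfolding solves_ode_def
proof
  fix s assume s: "s \<in> {0..T'}"
  have "(y has_vector_derivative V (y (t + s))) (at (t + s) within {0..T})"
    using y s t by (intro solves_odeD) auto
  then have "(y has_vector_derivative V (y (t + s))) (at (t + s) within (+) t ` {0..T'})"
    by (rule has_vector_derivative_within_subset) (use s t in auto)
  moreover have "((+) t has_vector_derivative 1) (at s within {0..T'})"
    by (auto intro!: derivative_eq_intros)
  ultimately show "((\<lambda>s. y (t + s)) has_vector_derivative V (y (t + s))) (at s within {0..T'})"
    using vector_diff_chain_within[of "(+) t" 1 s "{0..T'}" y] by (simp add: o_def)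
qed

lemma solves_ode_reverse:
  assumes y: "solves_ode V T y"
  shows "solves_ode (\<lambda>x. - V x) T (\<lambda>s. y (T - s))"
  unfolding solves_ode_def
proof
  fix s assume s: "s \<in> {0..T}"
  have "(y has_vector_derivative V (y (T - s))) (at (T - s) within {0..T})"
    using y s by (intro solves_odeD) auto
  then have "(y has_vector_derivative V (y (T - s))) (at (T - s) within (-) T ` {0..T})"
    by (rule has_vector_derivative_within_subset) (use s in auto)
  moreover have "((-) T has_vector_derivative -1) (at s within {0..T})"
    by (auto intro!: derivative_eq_intros)
  ultimately show "((\<lambda>s. y (T - s)) has_vector_derivative - V (y (T - s))) (at s within {0..T})"
    using vector_diff_chain_within[of "(-) T" "-1" s "{0..T}" y] by (simp add: o_def)
qed

text \<open>Takes the place of Gronwall's inequality: where the distance attains its maximum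
  \<open>M\<close>, the mean value inequality gives \<open>M \<le> M0 + e * L * M\<close> with
  \<open>M0\<close> the initial distance, and \<open>e * L \<le> 1 / 2\<close> absorbs the last
  term.\<close>

lemma solves_ode_dist_le:
  assumes y1: "solves_ode V e y1" and y2: "solves_ode V e y2"
    and S: "\<And>s. s \<in> {0..e} \<Longrightarrow> y1 s \<in> S" "\<And>s. s \<in> {0..e} \<Longrightarrow> y2 s \<in> S"
    and L: "\<And>x y. x \<in> S \<Longrightarrow> y \<in> S \<Longrightarrow> norm (V x - V y) \<le> L * norm (x - y)" "0 \<le> L"
    and e: "e * L \<le> 1 / 2" and s: "s \<in> {0..e}"
  shows "norm (y1 s - y2 s) \<le> 2 * norm (y1 0 - y2 0)"
proof -
  have "continuous_on {0..e} (\<lambda>s. norm (y1 s - y2 s))"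
    using y1 y2 by (intro continuous_intros solves_ode_continuous_on)
  moreover have "{0..e} \<noteq> {}" using s by auto
  ultimately obtain m where m: "m \<in> {0..e}" "\<And>t. t \<in> {0..e} \<Longrightarrow> norm (y1 t - y2 t) \<le> norm (y1 m - y2 m)"
    using continuous_attains_sup[OF compact_Icc] by blast
  let ?M = "norm (y1 m - y2 m)"
  have "norm ((y1 m - y2 m) - (y1 0 - y2 0)) \<le> L * ?M * \<bar>m - 0\<bar>"
  proof (rule vector_derivative_dist_bound[of 0 e "\<lambda>s. y1 s - y2 s" "\<lambda>s. V (y1 s) - V (y2 s)"])
    show "((\<lambda>s. y1 s - y2 s) has_vector_derivative V (y1 s) - V (y2 s)) (at s within {0..e})" if "s \<in> {0..e}" for s
      using y1 y2 that by (intro has_vector_derivative_diff solves_odeD)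
    show "norm (V (y1 s) - V (y2 s)) \<le> L * ?M" if "s \<in> {0..e}" for s
      using L(1)[OF S[OF that]] mult_left_mono[OF m(2)[OF that] L(2)] by linarith
  qed (use m(1) in auto)
  also have "\<dots> \<le> ?M * (1 / 2)"
  proof -
    have "m * L \<le> e * L" using m(1) L(2) by (intro mult_right_mono) auto
    then have "?M * (m * L) \<le> ?M * (1 / 2)" using e by (intro mult_left_mono) auto
    then show ?thesis using m(1) by (simp add: mult_ac)
  qed
  finally have "?M \<le> 2 * norm (y1 0 - y2 0)"
    using norm_triangle_ineq2[of "y1 m - y2 m" "y1 0 - y2 0"] by linarith
  then show ?thesis using m(2)[OF s] by linarith
qed

text \<open>The field is only locally Lipschitz, so the interval is shrunk until both solutions stay
  in one unit ball, on which a Lipschitz constant exists. This will identify the hypothetical motion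
  in \<open>forced_to_cross\<close> with a motion already at hand.\<close>

lemma solves_ode_local_unique:
  fixes V :: "'a::euclidean_space \<Rightarrow> 'a"
  assumes V: "Ck 1 V" and y1: "solves_ode V d y1" and y2: "solves_ode V d y2"
    and d: "0 < d" and eq: "y1 0 = y2 0"
  obtains e where "0 < e" "e \<le> d" "\<And>s. s \<in> {0..e} \<Longrightarrow> y1 s = y2 s"
proof -
  obtain L where L: "L > 0" "\<And>x y. x \<in> cball (y1 0) 1 \<Longrightarrow> y \<in> cball (y1 0) 1 \<Longrightarrow> norm (V x - V y) \<le> L * norm (x - y)"
    by (rule Ck1_lipschitz[OF V, where p = "y1 0" and r = 1]) (rule that)
  have near: "\<exists>r>0. \<forall>s\<in>{0..d}. s < r \<longrightarrow> y s \<in> cball (y 0) 1" if y: "solves_ode V d y" for y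
  proof -
    obtain r where "r > 0" "\<And>s. s \<in> {0..d} \<Longrightarrow> dist s 0 < r \<Longrightarrow> dist (y s) (y 0) < 1"
      using solves_ode_continuous_on[OF y] d unfolding continuous_on_iff
      by (metis atLeastAtMost_iff order.refl less_imp_le zero_less_one)
    then show ?thesis
      by (intro exI[of _ r]) (auto simp: dist_commute less_imp_le dist_real_def)
  qed
  obtain r1 where r1: "r1 > 0" "\<And>s. s \<in> {0..d} \<Longrightarrow> s < r1 \<Longrightarrow> y1 s \<in> cball (y1 0) 1"
    using near[OF y1] by blast
  obtain r2 where r2: "r2 > 0" "\<And>s. s \<in> {0..d} \<Longrightarrow> s < r2 \<Longrightarrow> y2 s \<in> cball (y1 0) 1"
    using near[OF y2] eq by auto
  define e where "e = min d (min (r1 / 2) (min (r2 / 2) (1 / (2 * L))))"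
  have e: "0 < e" "e \<le> d" "e < r1" "e < r2" "e \<le> 1 / (2 * L)"
    using d r1 r2 L(1) by (auto simp: e_def min_def)
  then have "e * L \<le> 1 / 2" using L(1) by (simp add: field_simps)
  then have "norm (y1 s - y2 s) \<le> 2 * norm (y1 0 - y2 0)" if "s \<in> {0..e}" for s
    using e r1 r2 L that
    by (intro solves_ode_dist_le[OF solves_ode_subset[OF y1 e(2)] solves_ode_subset[OF y2 e(2)], where S = "cball (y1 0) 1" and L = L])
       auto
  then show ?thesis
    using e(1,2) eq that by simp
qed

text \<open>Banach's fixed point theorem for the integral operator, which contracts by the factor
  1/2 in the sup norm since \<open>h * L \<le> 1 / 2\<close>. The global Lipschitz condition is
  arranged in \<open>local_flow\<close> by a retraction.\<close>

lemma picard: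
  fixes W :: "'a::euclidean_space \<Rightarrow> 'a"
  assumes L: "\<And>x y. norm (W x - W y) \<le> L * norm (x - y)" "0 \<le> L"
    and h: "0 < h" "h * L \<le> 1 / 2"
  obtains y where "y 0 = x" "solves_ode W h y"
proof -
  have contW: "continuous_on UNIV W"
    by (rule lipschitz_on_continuous_on[of L], rule lipschitz_onI) (use L in \<open>auto simp: dist_norm\<close>)
  have contWf: "continuous_on {0..t} (\<lambda>s. W (apply_bcontfun f s))" for f t
    by (rule continuous_on_compose2[OF contW]) auto
  let ?F = "\<lambda>f t. x + integral {0..t} (\<lambda>s. W (apply_bcontfun f s))"
  have contF: "continuous_on (cbox 0 h) (?F f)" for f
    unfolding cbox_interval
    by (intro continuous_intros indefinite_integral_continuous_1 integrable_continuous_real contWf)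
  \<comment> \<open>The complete space at hand consists of bounded continuous functions on the whole
    line; clamping the time to \<open>[0, h]\<close> extends the integral to all times and keeps it
    bounded.\<close>
  have "\<exists>g. \<forall>t. apply_bcontfun g t = ?F f (clamp 0 h t)" for f
    by (rule continuous_on_cbox_bcontfunE[OF contF[of f]]) blast
  then obtain G where G: "\<And>f t. apply_bcontfun (G f) t = ?F f (clamp 0 h t)"
    by metis
  have "dist (G f) (G g) \<le> (1 / 2) * dist f g" for f g
  proof (rule dist_bound)
    fix t
    define c where "c = clamp 0 h t"
    have c: "0 \<le> c" "c \<le> h" using clamp_in_interval[of 0 h t] h by (auto simp: c_def)
    have "dist (apply_bcontfun (G f) t) (apply_bcontfun (G g) t)
        = norm (integral {0..c} (\<lambda>s. W (apply_bcontfun f s) - W (apply_bcontfun g s)))"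
      by (subst integral_diff) (auto simp: G dist_norm c_def intro!: integrable_continuous_real contWf)
    also have "\<dots> \<le> L * dist f g * (c - 0)"
    proof (rule integral_bound[OF c(1)])
      show "norm (W (apply_bcontfun f s) - W (apply_bcontfun g s)) \<le> L * dist f g" for s
        using L(1)[of "apply_bcontfun f s" "apply_bcontfun g s"] mult_left_mono[OF dist_bounded[of f s g] L(2)]
        by (simp add: dist_norm)
    qed (intro continuous_intros contWf)
    also have "\<dots> \<le> (1 / 2) * dist f g"
    proof -
      have "c * L \<le> h * L" using c L(2) by (intro mult_right_mono)
      then have "(c * L) * dist f g \<le> (1 / 2) * dist f g" using h by (intro mult_right_mono) auto
      then show ?thesis by (simp add: mult_ac)
    qed
    finally show "dist (apply_bcontfun (G f) t) (apply_bcontfun (G g) t) \<le> (1 / 2) * dist f g" .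
  qed
  then obtain f where f: "G f = f"
    using banach_fix_type[of "1 / 2" G] by auto
  let ?y = "apply_bcontfun f"
  have y: "?y t = ?F f t" if "t \<in> {0..h}" for t
    using G[of f t] f that by (simp add: clamp_cancel_cbox)
  show ?thesis
  proof (rule that)
    show "?y 0 = x" using y[of 0] h by simp
    show "solves_ode W h ?y"
      unfolding solves_ode_def
    proof
      fix s assume s: "s \<in> {0..h}"
      have "(?F f has_vector_derivative 0 + W (?y s)) (at s within {0..h})"
        by (intro has_vector_derivative_add has_vector_derivative_const integral_has_vector_derivative contWf s)
      then show "(?y has_vector_derivative W (?y s)) (at s within {0..h})"
        by (intro has_vector_derivative_transform[OF s, of ?y "?F f"]) (auto simp: y)
    qed
  qed
qed

text \<open>The field is precomposed with the nearest-point retraction onto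
  \<open>cball p R\<close>, which makes it globally Lipschitz and bounded. A solution starting in
  the half ball cannot leave \<open>ball p R\<close> within time \<open>h\<close>, so it solves the
  original equation as well.\<close>

lemma local_flow:
  fixes V :: "'a::euclidean_space \<Rightarrow> 'a"
  assumes V: "Ck 1 V" and R: "0 < R"
  obtains r h C \<psi> where "0 < r" "r < R" "0 < h"
    "\<And>x. x \<in> cball p r \<Longrightarrow> \<psi> 0 x = x"
    "\<And>x. x \<in> cball p r \<Longrightarrow> solves_ode V h (\<lambda>s. \<psi> s x)"
    "\<And>x s. x \<in> cball p r \<Longrightarrow> s \<in> {0..h} \<Longrightarrow> \<psi> s x \<in> ball p R"
    "continuous_on ({0..h} \<times> cball p r) (\<lambda>(s, x). \<psi> s x)"
    "\<And>x s. x \<in> cball p r \<Longrightarrow> s \<in> {0..h} \<Longrightarrow> norm (\<psi> s x - (x + s *\<^sub>R V x)) \<le> C * s\<^sup>2"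
proof -
  define c where "c = closest_point (cball p R)"
  have c: "c x \<in> cball p R" "x \<in> cball p R \<Longrightarrow> c x = x" "norm (c x - c y) \<le> norm (x - y)" for x y
    using R closest_point_in_set[of "cball p R" x] closest_point_lipschitz[of "cball p R" x y] closest_point_self[of x "cball p R"]
    by (auto simp: c_def dist_norm)
  obtain L where L: "L > 0" "\<And>x y. x \<in> cball p R \<Longrightarrow> y \<in> cball p R \<Longrightarrow> norm (V x - V y) \<le> L * norm (x - y)"
    by (rule Ck1_lipschitz[OF V, where p = p and r = R]) (rule that)
  have contV: "continuous_on (cball p R) V"
    by (rule lipschitz_on_continuous_on[of L], rule lipschitz_onI) (use L in \<open>auto simp: dist_norm\<close>)
  obtain M where M: "M \<ge> 0" "\<And>x. x \<in> cball p R \<Longrightarrow> norm (V x) \<le> M"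
    by (rule compact_continuous_norm_bound[OF compact_cball contV]) (rule that)
  define W where "W x = V (c x)" for x
  have W: "norm (W x - W y) \<le> L * norm (x - y)" "norm (W x) \<le> M" for x y
    using order.trans[OF L(2)[OF c(1) c(1)] mult_left_mono[OF c(3) less_imp_le[OF L(1)]]] M(2)[OF c(1)]
    by (auto simp: W_def)
  \<comment> \<open>The first entry makes Picard's operator contract; the second keeps the
    displacement \<open>h * M\<close> below \<open>R / 2\<close>. Writing \<open>M + 1\<close> keeps
    the quotient positive when \<open>M = 0\<close>.\<close>
  define h where "h = min (1 / (2 * L)) (R / (4 * (M + 1)))"
  have h: "0 < h" "h * L \<le> 1 / 2" "h * M < R / 2"
  proof -
    show "0 < h" using L(1) M(1) R by (simp add: h_def)
    have "h \<le> 1 / (2 * L)" by (simp add: h_def)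
    then show "h * L \<le> 1 / 2" using L(1) by (simp add: field_simps)
    have "h \<le> R / (4 * (M + 1))" by (simp add: h_def)
    then have "h * (M + 1) \<le> R / 4" using M(1) by (simp add: field_simps)
    then show "h * M < R / 2" using \<open>0 < h\<close> R by (simp add: algebra_simps)
  qed
  have "\<exists>y. y 0 = x \<and> solves_ode W h y" for x
    by (rule picard[OF W(1) less_imp_le[OF L(1)] h(1,2), of x]) blast
  then obtain Y where Y: "\<And>x. Y x 0 = x" "\<And>x. solves_ode W h (Y x)"
    by metis
  have lip: "norm (Y x s - Y x t) \<le> M * \<bar>s - t\<bar>" if "s \<in> {0..h}" "t \<in> {0..h}" for x s t
    by (rule vector_derivative_dist_bound[OF solves_odeD[OF Y(2)] W(2) that])
  have inball: "Y x s \<in> ball p R" if x: "x \<in> cball p (R / 2)" and s: "s \<in> {0..h}" for x s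
  proof -
    have "norm (Y x s - x) \<le> M * s"
      using lip[of s 0 x] s h(1) Y(1)[of x] by simp
    also have "\<dots> \<le> h * M" using s M(1) mult_left_mono[of s h M] by (simp add: mult.commute)
    finally have "norm (Y x s - x) < R / 2" using h(3) by simp
    then show ?thesis
      using x dist_triangle[of p "Y x s" x] by (simp add: dist_norm norm_minus_commute)
  qed
  have ode: "solves_ode V h (Y x)" if "x \<in> cball p (R / 2)" for x
    using Y(2)[of x] inball[OF that] c(2) unfolding solves_ode_def W_def
    by (metis ball_subset_cball subsetD)
  have dep: "norm (Y x s - Y x' s) \<le> 2 * norm (x - x')" if "s \<in> {0..h}" for x x' s
    using solves_ode_dist_le[OF Y(2)[of x] Y(2)[of x'] UNIV_I UNIV_I W(1) less_imp_le[OF L(1)] h(2) that] Y(1) by simp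
  have cont: "continuous_on ({0..h} \<times> cball p (R / 2)) (\<lambda>(s, x). Y x s)"
  proof (rule lipschitz_on_continuous_on[of "M + 2"], rule lipschitz_onI)
    fix q q' assume q: "q \<in> {0..h} \<times> cball p (R / 2)" "q' \<in> {0..h} \<times> cball p (R / 2)"
    obtain s x s' x' where eq: "q = (s, x)" "q' = (s', x')" by (metis surj_pair)
    have "norm (Y x s - Y x' s') \<le> norm (Y x s - Y x s') + norm (Y x s' - Y x' s')"
      using norm_triangle_ineq[of "Y x s - Y x s'" "Y x s' - Y x' s'"] by simp
    also have "\<dots> \<le> M * dist s s' + 2 * dist x x'"
      using lip[of s s' x] dep[of s' x x'] q eq by (intro add_mono) (auto simp: dist_norm)
    also have "\<dots> \<le> M * dist q q' + 2 * dist q q'"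
      using dist_fst_le[of q q'] dist_snd_le[of q q'] M(1) eq by (intro add_mono mult_left_mono) auto
    finally show "dist (case q of (s, x) \<Rightarrow> Y x s) (case q' of (s, x) \<Rightarrow> Y x s) \<le> (M + 2) * dist q q'"
      by (simp add: eq dist_norm algebra_simps)
  qed (use M in simp)
  have est: "norm (Y x s - (x + s *\<^sub>R V x)) \<le> (L * M) * s\<^sup>2" if x: "x \<in> cball p (R / 2)" and s: "s \<in> {0..h}" for x s
  proof -
    \<comment> \<open>Subtracting the linear motion leaves the velocity
      \<open>V (Y x t) - V x\<close>, at most \<open>L * (M * s)\<close> because the point has moved
      by at most \<open>M * s\<close>.\<close>
    have "norm ((Y x s - s *\<^sub>R V x) - (Y x 0 - 0 *\<^sub>R V x)) \<le> (L * (M * s)) * \<bar>s - 0\<bar>"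
    proof (rule vector_derivative_dist_bound[of 0 s _ "\<lambda>t. V (Y x t) - V x"])
      fix t assume t: "t \<in> {0..s}"
      have "(Y x has_vector_derivative V (Y x t)) (at t within {0..s})"
        using solves_ode_subset[OF ode[OF x], of s] s t by (intro solves_odeD) auto
      then show "((\<lambda>t. Y x t - t *\<^sub>R V x) has_vector_derivative V (Y x t) - V x) (at t within {0..s})"
        by (auto intro!: derivative_eq_intros)
      have "norm (V (Y x t) - V x) \<le> L * norm (Y x t - x)"
        using L(2)[of "Y x t" x] inball[OF x, of t] x s t R by auto
      also have "\<dots> \<le> L * (M * s)"
      proof (rule mult_left_mono)
        have "norm (Y x t - x) \<le> M * t" using lip[of t 0 x] s t Y(1)[of x] by simp
        also have "\<dots> \<le> M * s" using t M(1) by (intro mult_left_mono) auto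
        finally show "norm (Y x t - x) \<le> M * s" .
      qed (use L(1) in simp)
      finally show "norm (V (Y x t) - V x) \<le> L * (M * s)" .
    qed (use s in auto)
    then show ?thesis using s Y(1)[of x] by (simp add: power2_eq_square mult_ac algebra_simps)
  qed
  show ?thesis
  proof (rule that[of "R / 2" h "\<lambda>s x. Y x s" "L * M"])
    show "Y x s \<in> ball p R" if "x \<in> cball p (R / 2)" "s \<in> {0..h}" for x s
      by (rule inball[OF that])
    show "norm (Y x s - (x + s *\<^sub>R V x)) \<le> L * M * s\<^sup>2" if "x \<in> cball p (R / 2)" "s \<in> {0..h}" for x s
      by (rule est[OF that])
  qed (use R h Y ode cont in auto)
qed

section \<open>Approximation of flows inside an equivalence relation\<close>

text \<open>The radius \<open>r\<close> must not depend on \<open>\<epsilon>\<close>: when such a map is iterated with a smaller step, a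
  smaller \<open>\<epsilon>\<close> is needed on the same ball.\<close>

definition euler_approximable ::
  "('a::euclidean_space \<Rightarrow> 'a \<Rightarrow> bool) \<Rightarrow> ('a \<Rightarrow> 'a) \<Rightarrow> 'a \<Rightarrow> bool" where
  "euler_approximable R X p \<longleftrightarrow> (\<exists>r>0. \<forall>\<epsilon>>0. \<exists>h0>0. \<forall>h. 0 < h \<and> h \<le> h0 \<longrightarrow>
    (\<exists>\<psi>. continuous_on ({0..h} \<times> cball p r) (\<lambda>(s, x). \<psi> s x) \<and>
      (\<forall>s\<in>{0..h}. \<forall>x\<in>cball p r. R x (\<psi> s x) \<and> norm (\<psi> s x - (x + s *\<^sub>R X x)) \<le> \<epsilon> * h)))"

text \<open>The second-order Taylor polynomial in time of the flow of \<open>X\<close>: a solution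
  moving with velocity \<open>X\<close> has the second derivative \<open>DX(x)(X x)\<close>.\<close>

definition taylor :: "('a::euclidean_space \<Rightarrow> 'a) \<Rightarrow> real \<Rightarrow> 'a \<Rightarrow> 'a" where
  "taylor X s x = x + s *\<^sub>R X x + (s\<^sup>2 / 2) *\<^sub>R frechet_derivative X (at x) (X x)"

text \<open>As in \<open>euler_approximable\<close>, the error is measured by the largest time
  \<open>h\<close> and not by \<open>s\<close>; the map may change with \<open>h\<close> and need
  not be the identity at \<open>s = 0\<close>.\<close>

definition taylor_approximable ::
  "('a::euclidean_space \<Rightarrow> 'a \<Rightarrow> bool) \<Rightarrow> ('a \<Rightarrow> 'a) \<Rightarrow> 'a \<Rightarrow> bool" where
  "taylor_approximable R X p \<longleftrightarrow> (\<exists>r>0. \<exists>C. \<exists>h0>0. \<forall>h. 0 < h \<and> h \<le> h0 \<longrightarrow>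
    (\<exists>\<psi>. continuous_on ({0..h} \<times> cball p r) (\<lambda>(s, x). \<psi> s x) \<and>
      (\<forall>s\<in>{0..h}. \<forall>x\<in>cball p r. R x (\<psi> s x) \<and> norm (\<psi> s x - taylor X s x) \<le> C * h ^ 3)))"

section \<open>From first to second order by subdividing the time\<close>

lemma continuous_on_flow_compose:
  assumes "continuous_on (A \<times> B) (\<lambda>(s, x). \<psi> s x)" "continuous_on S \<tau>" "continuous_on S G"
    and "\<And>q. q \<in> S \<Longrightarrow> \<tau> q \<in> A" "\<And>q. q \<in> S \<Longrightarrow> G q \<in> B"
  shows "continuous_on S (\<lambda>q. \<psi> (\<tau> q) (G q))"
  using continuous_on_compose2[OF assms(1) continuous_on_Pair[OF assms(2,3)]] assms(4,5) by auto

lemma norm_triangle_4: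
  fixes a b c d :: "'a::real_normed_vector"
  shows "norm (a + b + c - d) \<le> norm a + norm b + norm c + norm d"
  using norm_triangle_ineq4[of "a + b + c" d] norm_triangle_ineq[of "a + b" c] norm_triangle_ineq[of a b]
  by linarith

lemma norm_scaleR_add_le:
  fixes a b :: "'a::real_normed_vector"
  assumes "norm (e) \<le> \<epsilon>" "norm X \<le> M" "0 \<le> s"
  shows "norm (s *\<^sub>R X + e) \<le> s * M + \<epsilon>"
  using norm_triangle_ineq[of "s *\<^sub>R X" e] mult_left_mono[OF assms(2,3)] assms(1,3) by simp

lemma taylor_dist_le:
  assumes X: "norm (X x) \<le> L" "\<And>v. norm (frechet_derivative X (at x) v) \<le> L * norm v"
    and L: "1 \<le> L" and t: "0 \<le> t" "t \<le> 1"
  shows "norm (taylor X t x - x) \<le> 2 * L\<^sup>2 * t"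
proof -
  have "norm (taylor X t x - x) \<le> norm (t *\<^sub>R X x) + norm ((t\<^sup>2 / 2) *\<^sub>R frechet_derivative X (at x) (X x))"
    by (simp only: taylor_def add.assoc add_diff_cancel_left' norm_triangle_ineq)
  also have "\<dots> \<le> t * L + t\<^sup>2 / 2 * (L * L)"
    using X(1) order.trans[OF X(2) mult_left_mono[OF X(1)]] L t
    by (auto intro!: add_mono mult_left_mono)
  also have "\<dots> \<le> t * L\<^sup>2 + t * L\<^sup>2"
  proof (rule add_mono)
    show "t * L \<le> t * L\<^sup>2"
      using L t by (intro mult_left_mono) (auto simp: power2_eq_square)
    have "t\<^sup>2 \<le> t" using t by (simp add: power2_eq_square mult_left_le)
    then have "t\<^sup>2 / 2 \<le> t" using t by simp
    then show "t\<^sup>2 / 2 * (L * L) \<le> t * L\<^sup>2"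
      using mult_right_mono[of "t\<^sup>2 / 2" t "L\<^sup>2"] by (simp add: power2_eq_square)
  qed
  finally show ?thesis by (simp add: algebra_simps)
qed

text \<open>Truncation error of one Euler step of length \<open>k\<close> taken on the Taylor curve
  at time \<open>t\<close>: the step itself costs \<open>k^2\<close>, and since the curve solves the
  equation only up to order \<open>t^2\<close>, a further \<open>k * t^2\<close> arises.\<close>

lemma taylor_consistency:
  assumes lin: "linear (frechet_derivative X (at x))"
    and X: "norm (X x) \<le> L" "\<And>v. norm (frechet_derivative X (at x) v) \<le> L * norm v"
      "norm (X (taylor X t x) - X x - frechet_derivative X (at x) (taylor X t x - x)) \<le> L * norm (taylor X t x - x) ^ 2"
    and L: "1 \<le> L" and t: "0 \<le> t" "t \<le> 1" and k: "0 \<le> k"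
  shows "norm (taylor X (t + k) x - taylor X t x - k *\<^sub>R X (taylor X t x)) \<le> 5 * L ^ 5 * (k\<^sup>2 + k * t\<^sup>2)"
proof -
  let ?D = "frechet_derivative X (at x)"
  define A where "A = ?D (X x)"
  define d where "d = taylor X t x - x"
  define e where "e = X (taylor X t x) - X x - ?D d"
  have d: "d = t *\<^sub>R X x + (t\<^sup>2 / 2) *\<^sub>R A" by (simp add: d_def taylor_def A_def)
  have Dd: "?D d = t *\<^sub>R A + (t\<^sup>2 / 2) *\<^sub>R ?D A"
    using lin by (simp add: d linear_add linear_scale A_def)
  have "norm A \<le> L * L" unfolding A_def using order.trans[OF X(2) mult_left_mono[OF X(1)]] L by simp
  then have A: "norm A \<le> L\<^sup>2" "norm (?D A) \<le> L ^ 3"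
    using order.trans[OF X(2) mult_left_mono[of "norm A" "L * L" L]] L
    by (simp_all add: power2_eq_square power3_eq_cube)
  have "norm d \<le> 2 * L\<^sup>2 * t"
    unfolding d_def by (rule taylor_dist_le[OF X(1,2) L t])
  then have "(norm d)\<^sup>2 \<le> (2 * L\<^sup>2 * t)\<^sup>2" by (intro power_mono) auto
  then have "L * (norm d)\<^sup>2 \<le> L * (2 * L\<^sup>2 * t)\<^sup>2" using L by (intro mult_left_mono) auto
  then have e: "norm e \<le> 4 * L ^ 5 * t\<^sup>2"
    using X(3) unfolding e_def d_def by (simp add: power_mult_distrib eval_nat_numeral algebra_simps)
  \<comment> \<open>The terms of order \<open>k\<close> and \<open>k * t\<close> cancel; the latter
    is what the quadratic term of \<open>taylor\<close> is there for.\<close>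
  have "taylor X (t + k) x - taylor X t x - k *\<^sub>R X (taylor X t x)
      = (k\<^sup>2 / 2) *\<^sub>R A - (k * t\<^sup>2 / 2) *\<^sub>R ?D A - k *\<^sub>R e"
  proof -
    have X': "X (taylor X t x) = X x + t *\<^sub>R A + (t\<^sup>2 / 2) *\<^sub>R ?D A + e"
      unfolding e_def Dd by simp
    have q: "(t + k)\<^sup>2 / 2 = t\<^sup>2 / 2 + k * t + k\<^sup>2 / 2"
      by (simp add: power2_eq_square field_simps)
    show ?thesis
      unfolding X' unfolding taylor_def A_def[symmetric] q
      by (simp add: scaleR_add_left scaleR_add_right)
  qed
  also have "norm \<dots> \<le> norm ((k\<^sup>2 / 2) *\<^sub>R A) + norm ((k * t\<^sup>2 / 2) *\<^sub>R ?D A) + norm (k *\<^sub>R e)"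
    by (intro order.trans[OF norm_triangle_ineq4] add_right_mono norm_triangle_ineq4)
  also have "\<dots> \<le> k\<^sup>2 / 2 * L\<^sup>2 + k * t\<^sup>2 / 2 * L ^ 3 + k * (4 * L ^ 5 * t\<^sup>2)"
    using A e k by (auto intro!: add_mono mult_left_mono)
  also have "\<dots> \<le> k\<^sup>2 / 2 * L ^ 5 + k * t\<^sup>2 / 2 * L ^ 5 + k * (4 * L ^ 5 * t\<^sup>2)"
    using k L by (intro add_mono order.refl mult_left_mono power_increasing) auto
  \<comment> \<open>Here \<open>9 / 2\<close> is \<open>1 / 2\<close> from the term with
    \<open>?D A\<close> plus 4 from the remainder \<open>e\<close>, which is at most
    \<open>L * (2 * L^2 * t)^2\<close>.\<close>
  also have "\<dots> = L ^ 5 * (k\<^sup>2 / 2 + 9 / 2 * (k * t\<^sup>2))" by (simp add: algebra_simps)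
  also have "\<dots> \<le> L ^ 5 * (5 * (k\<^sup>2 + k * t\<^sup>2))"
  proof (rule mult_left_mono)
    have *: "a / 2 + 9 / 2 * b \<le> 5 * (a + b)" if "0 \<le> a" "0 \<le> b" for a b :: real
      using add_mono[of "a / 2" "5 * a" "9 / 2 * b" "5 * b"] that by (simp add: distrib_left)
    show "k\<^sup>2 / 2 + 9 / 2 * (k * t\<^sup>2) \<le> 5 * (k\<^sup>2 + k * t\<^sup>2)"
      by (rule *) (use k in auto)
  qed (use L in simp)
  finally show ?thesis by (simp add: algebra_simps)
qed

text \<open>A crude discrete Gronwall inequality: each of the \<open>j\<close> inhomogeneities is
  amplified by at most the full factor \<open>(1 + a) ^ j\<close>.\<close>

lemma linear_recurrence_bound:
  fixes e :: "nat \<Rightarrow> real"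
  assumes "e 0 \<le> 0" and "\<And>j. j < N \<Longrightarrow> e (Suc j) \<le> (1 + a) * e j + D" and a: "0 \<le> a" and D: "0 \<le> D"
  shows "j \<le> N \<Longrightarrow> e j \<le> real j * D * (1 + a) ^ j"
proof (induction j)
  case (Suc j)
  have "e (Suc j) \<le> (1 + a) * e j + D" using Suc assms by simp
  also have "\<dots> \<le> (1 + a) * (real j * D * (1 + a) ^ j) + D * (1 + a) ^ Suc j"
  proof (rule add_mono)
    show "(1 + a) * e j \<le> (1 + a) * (real j * D * (1 + a) ^ j)"
      using Suc a by (intro mult_left_mono) auto
    have "1 \<le> (1 + a) ^ Suc j" using a by (intro one_le_power) auto
    then show "D \<le> D * (1 + a) ^ Suc j" using D by (simp add: mult_le_cancel_left1)
  qed
  finally show ?case by (simp add: algebra_simps)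
qed (use assms in simp)

text \<open>Convergence of Euler's method, with the given maps as inexact Euler steps. There are
  \<open>N\<close> steps of length \<open>H = h / N\<close>, each with a local error
  \<open>O(H * h^2)\<close>, so that the sum is \<open>O(h^3)\<close>. The accuracy
  \<open>h^2\<close> is chosen after \<open>h\<close>.\<close>

lemma taylor_approximable_if_euler_approximable:
  fixes X :: "'a::euclidean_space \<Rightarrow> 'a"
  assumes X: "Ck 2 X" and R: "reflp R" "transp R" and E: "euler_approximable R X p"
  shows "taylor_approximable R X p"
proof -
  obtain r where r: "0 < r" and E': "\<And>\<epsilon>. \<epsilon> > 0 \<Longrightarrow> \<exists>h0>0. \<forall>h. 0 < h \<and> h \<le> h0 \<longrightarrow>
    (\<exists>\<psi>. continuous_on ({0..h} \<times> cball p r) (\<lambda>(s, x). \<psi> s x) \<and>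
      (\<forall>s\<in>{0..h}. \<forall>x\<in>cball p r. R x (\<psi> s x) \<and> norm (\<psi> s x - (x + s *\<^sub>R X x)) \<le> \<epsilon> * h))"
    using E unfolding euler_approximable_def by blast
  obtain L where L: "L \<ge> 1"
    "\<And>x. x \<in> cball p r \<Longrightarrow> norm (X x) \<le> L"
    "\<And>x y. x \<in> cball p r \<Longrightarrow> y \<in> cball p r \<Longrightarrow> norm (X x - X y) \<le> L * norm (x - y)"
    "\<And>x v. x \<in> cball p r \<Longrightarrow> norm (frechet_derivative X (at x) v) \<le> L * norm v"
    "\<And>x y. x \<in> cball p r \<Longrightarrow> y \<in> cball p r \<Longrightarrow>
      norm (X y - X x - frechet_derivative X (at x) (y - x)) \<le> L * norm (y - x) ^ 2"
    by (rule Ck2_local_bounds[OF X, where p = p and r = r]) (rule that)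
  have lin: "linear (frechet_derivative X (at x))" for x
    using X unfolding numeral_2_eq_2
    by (rule bounded_linear.linear[OF has_derivative_bounded_linear[OF Ck_Suc_has_derivative]])
  \<comment> \<open>Keeps the Taylor curve, which moves at most \<open>2 * L^2 * h\<close>, and the
    iterates, which move at most \<open>2 * L * h\<close>, within \<open>r / 4\<close> of a start in
    the half ball.\<close>
  define h1 where "h1 = min 1 (r / (8 * L\<^sup>2))"
  have h1: "0 < h1" "h1 \<le> 1" "2 * L\<^sup>2 * h1 \<le> r / 4"
  proof -
    show "0 < h1" "h1 \<le> 1" using r L(1) by (auto simp: h1_def)
    have "h1 \<le> r / (8 * L\<^sup>2)" by (simp add: h1_def)
    then show "2 * L\<^sup>2 * h1 \<le> r / 4" using L(1) by (simp add: field_simps)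
  qed
  have LL: "L \<le> L\<^sup>2" using L(1) by (simp add: power2_eq_square)
  \<comment> \<open>In each step 10 comes from the truncation error and 1 from the inexactness of
    the given map; \<open>exp L\<close> bounds the amplification
    \<open>(1 + H * L) ^ N\<close>.\<close>
  define C where "C = 11 * L ^ 5 * exp L"
  have "\<exists>\<phi>. continuous_on ({0..h} \<times> cball p (r / 2)) (\<lambda>(s, x). \<phi> s x) \<and>
      (\<forall>s\<in>{0..h}. \<forall>x\<in>cball p (r / 2). R x (\<phi> s x) \<and> norm (\<phi> s x - taylor X s x) \<le> C * h ^ 3)"
    if h: "0 < h" "h \<le> h1" for h
  proof -
    obtain h0 where h0: "h0 > 0" "\<And>H. 0 < H \<Longrightarrow> H \<le> h0 \<Longrightarrow>
      (\<exists>\<psi>. continuous_on ({0..H} \<times> cball p r) (\<lambda>(s, x). \<psi> s x) \<and>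
      (\<forall>s\<in>{0..H}. \<forall>x\<in>cball p r. R x (\<psi> s x) \<and> norm (\<psi> s x - (x + s *\<^sub>R X x)) \<le> h\<^sup>2 * H))"
      using E'[of "h\<^sup>2"] h by auto
    \<comment> \<open>\<open>H \<le> h0\<close> makes the approximating map available;
      \<open>H \<le> h^2\<close> brings the part \<open>k^2\<close> of the truncation error down to
      \<open>H * h^2\<close>.\<close>
    define m where "m = min h0 (h\<^sup>2)"
    have m: "m > 0" using h0 h by (simp add: m_def)
    define N where "N = Suc (nat \<lceil>h / m\<rceil>)"
    define H where "H = h / real N"
    have N: "N > 0" "real N \<ge> h / m"
      by (auto simp: N_def intro: order.trans[OF real_nat_ceiling_ge])
    have H: "0 < H" "H \<le> h0" "H \<le> h\<^sup>2" "real N * H = h"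
    proof -
      show "0 < H" "real N * H = h" using h N by (auto simp: H_def)
      have "H \<le> m" using N m h by (simp add: H_def field_simps)
      then show "H \<le> h0" "H \<le> h\<^sup>2" by (auto simp: m_def)
    qed
    obtain \<psi> where \<psi>: "continuous_on ({0..H} \<times> cball p r) (\<lambda>(s, x). \<psi> s x)"
      "\<And>s x. s \<in> {0..H} \<Longrightarrow> x \<in> cball p r \<Longrightarrow> R x (\<psi> s x)"
      "\<And>s x. s \<in> {0..H} \<Longrightarrow> x \<in> cball p r \<Longrightarrow> norm (\<psi> s x - (x + s *\<^sub>R X x)) \<le> h\<^sup>2 * H"
      using h0(2)[OF H(1,2)] by blast
    define \<phi> where "\<phi> j s x = ((\<psi> (s / real N)) ^^ j) x" for j s x
    have \<phi>0: "\<phi> 0 s x = x" and \<phi>S: "\<phi> (Suc j) s x = \<psi> (s / real N) (\<phi> j s x)" for j s x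
      by (simp_all add: \<phi>_def)
    have sN: "s / real N \<in> {0..H}" if "s \<in> {0..h}" for s
      using that N by (auto simp: H_def divide_right_mono)
    have h2: "h\<^sup>2 \<le> L"
    proof -
      have "h\<^sup>2 \<le> 1\<^sup>2" using h h1 by (intro power_mono) auto
      then show ?thesis using L(1) by simp
    qed
    have step: "norm (\<psi> k z - z) \<le> 2 * L * H" if k: "k \<in> {0..H}" and z: "z \<in> cball p r" for k z
    proof -
      have "norm (\<psi> k z - z) = norm (k *\<^sub>R X z + (\<psi> k z - (z + k *\<^sub>R X z)))" by simp
      also have "\<dots> \<le> k * L + h\<^sup>2 * H"
        by (rule norm_scaleR_add_le[OF \<psi>(3)[OF k z] L(2)[OF z]]) (use k in simp)
      also have "\<dots> \<le> H * L + L * H"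
        using k L(1) h2 H(1) by (intro add_mono mult_right_mono) auto
      finally show ?thesis by (simp add: mult_ac)
    qed
    have dist: "norm (\<phi> j s x - x) \<le> real j * (2 * L * H) \<and> \<phi> j s x \<in> cball p r \<and> R x (\<phi> j s x)"
      if s: "s \<in> {0..h}" and x: "x \<in> cball p (r / 2)" and "j \<le> N" for j s x
      using \<open>j \<le> N\<close>
    proof (induction j)
      case 0
      then show ?case using x r R(1) by (auto simp: \<phi>0 reflp_def)
    next
      case (Suc j)
      have IH: "norm (\<phi> j s x - x) \<le> real j * (2 * L * H)" "\<phi> j s x \<in> cball p r" "R x (\<phi> j s x)"
        using Suc by auto
      have "norm (\<phi> (Suc j) s x - x) \<le> norm (\<phi> (Suc j) s x - \<phi> j s x) + norm (\<phi> j s x - x)"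
        using norm_triangle_ineq[of "\<phi> (Suc j) s x - \<phi> j s x" "\<phi> j s x - x"] by simp
      also have "\<dots> \<le> 2 * L * H + real j * (2 * L * H)"
        using step[OF sN[OF s] IH(2)] IH(1) by (intro add_mono) (auto simp: \<phi>S)
      finally have a: "norm (\<phi> (Suc j) s x - x) \<le> real (Suc j) * (2 * L * H)" by (simp add: algebra_simps)
      also have "\<dots> \<le> real N * (2 * L * H)" using Suc.prems L(1) H(1) by (intro mult_right_mono) auto
      also have "\<dots> = 2 * L * h" using H(4) by (simp add: algebra_simps)
      also have "\<dots> \<le> 2 * L\<^sup>2 * h1" using LL h L(1) by (intro mult_mono) auto
      finally have "norm (\<phi> (Suc j) s x - x) \<le> r / 4" using h1 by simp
      then have "\<phi> (Suc j) s x \<in> cball p r"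
        using x r dist_triangle[of p "\<phi> (Suc j) s x" x] by (simp add: dist_norm norm_minus_commute)
      moreover have "R x (\<phi> (Suc j) s x)"
        using transpD[OF R(2) IH(3)] \<psi>(2)[OF sN[OF s] IH(2)] by (simp add: \<phi>S)
      ultimately show ?case using a by blast
    qed
    have cont: "continuous_on ({0..h} \<times> cball p (r / 2)) (\<lambda>q. \<phi> j (fst q) (snd q))" if "j \<le> N" for j
      using that
    proof (induction j)
      case 0
      then show ?case by (simp add: \<phi>0 continuous_intros)
    next
      case (Suc j)
      show ?case unfolding \<phi>S
        by (rule continuous_on_flow_compose[OF \<psi>(1) continuous_on_divide Suc.IH])
          (use Suc.prems sN dist N in \<open>auto intro!: continuous_intros\<close>)
    qed
    have err: "norm (\<phi> N s x - taylor X s x) \<le> C * h ^ 3"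
      if s: "s \<in> {0..h}" and x: "x \<in> cball p (r / 2)" for s x
    proof -
      define k where "k = s / real N"
      have k: "k \<in> {0..H}" "0 \<le> k" "k \<le> H" "real N * k = s" using sN[OF s] N by (auto simp: k_def)
      define y where "y j = taylor X (real j * k) x" for j
      define e where "e j = norm (\<phi> j s x - y j)" for j
      have xr: "x \<in> cball p r" using x r by auto
      have jk: "0 \<le> real j * k" "real j * k \<le> h" "real j * k \<le> 1" if "j \<le> N" for j
      proof -
        show "0 \<le> real j * k" using k by simp
        have "real j * k \<le> real N * k" using that k by (intro mult_right_mono) auto
        then show "real j * k \<le> h" "real j * k \<le> 1" using k s h h1 by auto
      qed
      have y: "y j \<in> cball p r" if "j \<le> N" for j
      proof -
        have "norm (y j - x) \<le> 2 * L\<^sup>2 * (real j * k)"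
          unfolding y_def by (rule taylor_dist_le[OF L(2)[OF xr] L(4)[OF xr] L(1) jk(1,3)[OF that]])
        also have "\<dots> \<le> 2 * L\<^sup>2 * h1" using jk(2)[OF that] h by (intro mult_left_mono) auto
        finally show ?thesis
          using h1 x r dist_triangle[of p "y j" x] by (simp add: dist_norm norm_minus_commute)
      qed
      have rec: "e (Suc j) \<le> (1 + H * L) * e j + 11 * L ^ 5 * (H * h\<^sup>2)" if j: "j < N" for j
      proof -
        let ?z = "\<phi> j s x"
        have z: "?z \<in> cball p r" using dist[OF s x, of j] j by simp
        have c: "norm (y (Suc j) - y j - k *\<^sub>R X (y j)) \<le> 5 * L ^ 5 * (k\<^sup>2 + k * (real j * k)\<^sup>2)"
          using taylor_consistency[OF lin L(2)[OF xr] L(4)[OF xr] L(5)[OF xr y[of j, unfolded y_def]] L(1) jk(1,3)[of j] k(2)] j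
          by (simp add: y_def algebra_simps)
        also have "\<dots> \<le> 5 * L ^ 5 * (2 * (H * h\<^sup>2))"
        proof (rule mult_left_mono)
          have "k\<^sup>2 \<le> H * H" using k by (simp add: power2_eq_square mult_mono)
          also have "\<dots> \<le> H * h\<^sup>2" using H by (intro mult_left_mono) auto
          finally have 1: "k\<^sup>2 \<le> H * h\<^sup>2" .
          have "(real j * k)\<^sup>2 \<le> h\<^sup>2" using jk[of j] j by (intro power_mono) auto
          then have "k * (real j * k)\<^sup>2 \<le> H * h\<^sup>2" using k by (intro mult_mono) auto
          then show "k\<^sup>2 + k * (real j * k)\<^sup>2 \<le> 2 * (H * h\<^sup>2)" using 1 by simp
        qed (use L(1) in simp)
        finally have c: "norm (y (Suc j) - y j - k *\<^sub>R X (y j)) \<le> 10 * L ^ 5 * (H * h\<^sup>2)" by simp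
        have d: "norm (\<phi> (Suc j) s x - (?z + k *\<^sub>R X ?z)) \<le> 1 * (H * h\<^sup>2)"
          using \<psi>(3)[OF k(1) z] by (simp add: \<phi>S k_def mult.commute)
        have "\<dots> \<le> L ^ 5 * (H * h\<^sup>2)"
          using L(1) H(1) by (intro mult_right_mono one_le_power) auto
        with d have d: "norm (\<phi> (Suc j) s x - (?z + k *\<^sub>R X ?z)) \<le> L ^ 5 * (H * h\<^sup>2)" by simp
        have l: "norm (k *\<^sub>R (X ?z - X (y j))) \<le> H * L * e j"
        proof -
          have "k * norm (X ?z - X (y j)) \<le> H * (L * e j)"
            using L(3)[OF z y[of j]] j k unfolding e_def by (intro mult_mono) auto
          then show ?thesis using k by simp
        qed
        \<comment> \<open>In order: inexactness of the map, old error, propagation of the old error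
          through the field, truncation error.\<close>
        have "\<phi> (Suc j) s x - y (Suc j) = (\<phi> (Suc j) s x - (?z + k *\<^sub>R X ?z)) + (?z - y j)
            + k *\<^sub>R (X ?z - X (y j)) - (y (Suc j) - y j - k *\<^sub>R X (y j))"
          by (simp add: algebra_simps)
        then have "e (Suc j) \<le> norm (\<phi> (Suc j) s x - (?z + k *\<^sub>R X ?z)) + e j
            + norm (k *\<^sub>R (X ?z - X (y j))) + norm (y (Suc j) - y j - k *\<^sub>R X (y j))"
          unfolding e_def by (metis norm_triangle_4)
        also have "\<dots> \<le> L ^ 5 * (H * h\<^sup>2) + e j + H * L * e j + 10 * L ^ 5 * (H * h\<^sup>2)"
          using c d l by (intro add_mono) auto
        finally show ?thesis by (simp add: algebra_simps)
      qed
      have "e N \<le> real N * (11 * L ^ 5 * (H * h\<^sup>2)) * (1 + H * L) ^ N"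
        by (rule linear_recurrence_bound[where e = e and N = N and a = "H * L", OF _ rec])
          (use H L(1) in \<open>auto simp: e_def y_def \<phi>0 taylor_def\<close>)
      also have "\<dots> = 11 * L ^ 5 * h ^ 3 * (1 + H * L) ^ N"
        using H(4) by (simp add: power2_eq_square power3_eq_cube algebra_simps)
      also have "\<dots> \<le> 11 * L ^ 5 * h ^ 3 * exp L"
      proof (rule mult_left_mono)
        have "(1 + H * L) ^ N \<le> exp (H * L) ^ N"
          using H L(1) by (intro power_mono exp_ge_add_one_self) auto
        also have "\<dots> = exp (h * L)" using H(4) by (metis exp_of_nat_mult mult.assoc)
        also have "\<dots> \<le> exp L" using h h1 L(1) by (simp add: mult_le_cancel_right1)
        finally show "(1 + H * L) ^ N \<le> exp L" .
      qed (use L(1) h in simp)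
      finally show ?thesis
        using k(4) by (simp add: e_def y_def C_def algebra_simps)
    qed
    show ?thesis
      using cont[of N] dist[of _ _ N] err by (intro exI[of _ "\<phi> N"]) (auto simp: case_prod_unfold)
  qed
  then show ?thesis
    unfolding taylor_approximable_def using h1 r half_gt_zero[OF r] by blast
qed

section \<open>Second-order expansion of a composition of approximate flows\<close>

definition quadratic_expansion :: "real \<Rightarrow> real \<Rightarrow> real \<Rightarrow> 'a::real_normed_vector \<Rightarrow> 'a \<Rightarrow> 'a \<Rightarrow> 'a \<Rightarrow> bool" where
  "quadratic_expansion K h s x y v w \<longleftrightarrow>
    norm v \<le> K \<and> norm w \<le> K \<and> norm (y - (x + s *\<^sub>R v + s\<^sup>2 *\<^sub>R w)) \<le> K * h ^ 3"

lemma quadratic_expansion_dist: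
  assumes "quadratic_expansion K h s x y v w" "0 \<le> s" "s \<le> h" "h \<le> 1"
  shows "norm (y - x) \<le> 3 * K * h"
proof -
  have K: "0 \<le> K" using assms(1) norm_ge_zero[of v] unfolding quadratic_expansion_def by linarith
  have s2: "s\<^sup>2 \<le> h" and h3: "h ^ 3 \<le> h"
  proof -
    have "s\<^sup>2 \<le> s * 1" unfolding power2_eq_square using assms by (intro mult_left_mono) auto
    then show "s\<^sup>2 \<le> h" using assms by simp
    have "h ^ 3 \<le> h ^ 1" using assms by (intro power_decreasing) auto
    then show "h ^ 3 \<le> h" by simp
  qed
  have "y - x = s *\<^sub>R v + s\<^sup>2 *\<^sub>R w + (y - (x + s *\<^sub>R v + s\<^sup>2 *\<^sub>R w))" by simp
  then have "norm (y - x) \<le> norm (s *\<^sub>R v) + norm (s\<^sup>2 *\<^sub>R w) + norm (y - (x + s *\<^sub>R v + s\<^sup>2 *\<^sub>R w))"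
    by (metis norm_triangle_ineq norm_triangle_mono order.refl)
  also have "\<dots> \<le> h * K + h * K + K * h"
    using assms s2 h3 K unfolding quadratic_expansion_def
    by (intro add_mono) (auto intro!: mult_mono order.trans[of _ "K * h ^ 3" "K * h"] mult_left_mono)
  finally show ?thesis by simp
qed

text \<open>Appends one more Taylor map to a composition, with everything expanded at the starting
  point \<open>x\<close>. The mixed term \<open>DF(x) v\<close> arises because \<open>F\<close> is
  evaluated at a point displaced by \<open>s v\<close>; half of \<open>DF(x)(F x)\<close> is the
  quadratic term of \<open>taylor\<close>. Since \<open>K\<close> bounds the remainder and also the
  coefficients, the result can be fed back with \<open>K'\<close> in place of
  \<open>K\<close>.\<close>

lemma quadratic_expansion_step:
  fixes F :: "'a::euclidean_space \<Rightarrow> 'a"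
  assumes F: "Ck 2 F"
  obtains K' where "K \<le> K'"
    "\<And>x y y' v w s h. \<lbrakk>x \<in> cball p r; y \<in> cball p r; 0 \<le> s; s \<le> h; h \<le> 1;
      quadratic_expansion K h s x y v w; norm (y' - taylor F s y) \<le> K * h ^ 3\<rbrakk> \<Longrightarrow>
      quadratic_expansion K' h s x y' (v + F x)
        (w + frechet_derivative F (at x) v + (1 / 2) *\<^sub>R frechet_derivative F (at x) (F x))"
proof -
  let ?D = "\<lambda>x. frechet_derivative F (at x)"
  obtain L where L: "L \<ge> 1"
    "\<And>x. x \<in> cball p r \<Longrightarrow> norm (F x) \<le> L"
    "\<And>x y. x \<in> cball p r \<Longrightarrow> y \<in> cball p r \<Longrightarrow> norm (F x - F y) \<le> L * norm (x - y)"
    "\<And>x v. x \<in> cball p r \<Longrightarrow> norm (?D x v) \<le> L * norm v"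
    "\<And>x y v. x \<in> cball p r \<Longrightarrow> y \<in> cball p r \<Longrightarrow>
      norm (?D x v - ?D y v) \<le> L * norm (x - y) * norm v"
    "\<And>x y. x \<in> cball p r \<Longrightarrow> y \<in> cball p r \<Longrightarrow>
      norm (F y - F x - ?D x (y - x)) \<le> L * norm (y - x) ^ 2"
    by (rule Ck2_local_bounds[OF F, where p = p and r = r]) (rule that)
  have lin: "linear (?D x)" for x
    using F unfolding numeral_2_eq_2
    by (rule bounded_linear.linear[OF has_derivative_bounded_linear[OF Ck_Suc_has_derivative]])
  \<comment> \<open>The multiple of \<open>\<bar>K\<bar>\<close> covers the four remainder terms
    estimated below; \<open>L + L\<^sup>2\<close> enters through the norms of the new coefficients.
    The sign of \<open>K\<close> is unknown at this point, hence the absolute values.\<close>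
  define K' where "K' = \<bar>K\<bar> * (2 + 3 * L + 9 * L * \<bar>K\<bar> + 3 * L\<^sup>2) + L + L\<^sup>2"
  have pos: "0 \<le> L" "0 \<le> L * \<bar>K\<bar>" "0 \<le> L\<^sup>2" "0 \<le> L\<^sup>2 * \<bar>K\<bar>" "0 \<le> L * \<bar>K\<bar> * \<bar>K\<bar>" using L(1) by auto
  have K': "K' = 2 * \<bar>K\<bar> + 3 * (L * \<bar>K\<bar>) + 9 * (L * \<bar>K\<bar> * \<bar>K\<bar>) + 3 * (L\<^sup>2 * \<bar>K\<bar>) + L + L\<^sup>2"
    by (simp add: K'_def algebra_simps)
  have "K \<le> K'"
    using pos abs_ge_self[of K] abs_ge_zero[of K] unfolding K' by linarith
  moreover have "quadratic_expansion K' h s x y' (v + F x) (w + ?D x v + (1 / 2) *\<^sub>R ?D x (F x))"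
    if x: "x \<in> cball p r" and y: "y \<in> cball p r" and s: "0 \<le> s" "s \<le> h" "h \<le> 1"
      and exp: "quadratic_expansion K h s x y v w" and y': "norm (y' - taylor F s y) \<le> K * h ^ 3"
    for x y y' v w s h
  proof -
    \<comment> \<open>The errors are kept apart: \<open>e\<close> of the previous expansion,
      \<open>e1\<close> of linearising \<open>F\<close> at \<open>x\<close>, \<open>e2\<close> from
      the change of \<open>DF(F)\<close> between \<open>x\<close> and \<open>y\<close>,
      \<open>e3\<close> of the new map.\<close>
    define e where "e = y - (x + s *\<^sub>R v + s\<^sup>2 *\<^sub>R w)"
    define e1 where "e1 = F y - F x - ?D x (y - x)"
    define e2 where "e2 = ?D y (F y) - ?D x (F x)"
    define e3 where "e3 = y' - taylor F s y"
    have K: "norm v \<le> K" "norm w \<le> K" "norm e \<le> K * h ^ 3" "0 \<le> K" "norm e3 \<le> K * h ^ 3"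
      using exp order.trans[OF norm_ge_zero[of v], of K] y' unfolding quadratic_expansion_def e_def e3_def by auto
    have d: "norm (y - x) \<le> 3 * K * h" by (rule quadratic_expansion_dist[OF exp s])
    have DF: "norm (?D x (F x)) \<le> L * L"
      using order.trans[OF L(4)[OF x] mult_left_mono[OF L(2)[OF x]]] L(1) by simp
    have h0: "0 \<le> h" "s\<^sup>2 \<le> h\<^sup>2" using s by (auto intro: power_mono)
    have h32: "h ^ 3 \<le> h\<^sup>2" using h0 s by (intro power_decreasing) auto
    have e1: "norm e1 \<le> 9 * L * K\<^sup>2 * h\<^sup>2"
    proof -
      have "norm e1 \<le> L * (3 * K * h)\<^sup>2"
        unfolding e1_def using L(1) d by (intro order.trans[OF L(6)[OF x y]] mult_left_mono power_mono) auto
      then show ?thesis by (simp add: power_mult_distrib mult_ac)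
    qed
    have e2: "norm e2 \<le> 6 * L\<^sup>2 * K * h"
    proof -
      have "e2 = ?D y (F y - F x) + (?D y (F x) - ?D x (F x))"
        using lin[of y] by (simp add: e2_def linear_diff)
      then have "norm e2 \<le> norm (?D y (F y - F x)) + norm (?D y (F x) - ?D x (F x))"
        by (simp only: norm_triangle_ineq)
      also have "\<dots> \<le> L * (L * norm (y - x)) + L * norm (y - x) * L"
        using L(1) order.trans[OF L(4)[OF y] mult_left_mono[OF L(3)[OF y x]]]
          order.trans[OF L(5)[OF y x] mult_left_mono[OF L(2)[OF x]]]
        by (intro add_mono) auto
      also have "\<dots> = 2 * L\<^sup>2 * norm (y - x)" by (simp add: power2_eq_square)
      also have "\<dots> \<le> 2 * L\<^sup>2 * (3 * K * h)" using d by (intro mult_left_mono) auto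
      finally show ?thesis by simp
    qed
    have yx: "y - x = s *\<^sub>R v + s\<^sup>2 *\<^sub>R w + e" by (simp add: e_def)
    have Fy: "F y = F x + s *\<^sub>R ?D x v + s\<^sup>2 *\<^sub>R ?D x w + ?D x e + e1"
      using lin[of x] unfolding e1_def yx by (simp add: linear_add linear_scale)
    have eq: "y' - (x + s *\<^sub>R (v + F x) + s\<^sup>2 *\<^sub>R (w + ?D x v + (1 / 2) *\<^sub>R ?D x (F x)))
       = (e + e3) + s *\<^sub>R (s\<^sup>2 *\<^sub>R ?D x w + ?D x e) + s *\<^sub>R e1 - (- (s\<^sup>2 / 2) *\<^sub>R e2)"
    proof -
      have "y' = y + s *\<^sub>R F y + (s\<^sup>2 / 2) *\<^sub>R ?D y (F y) + e3" by (simp add: e3_def taylor_def)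
      also have "?D y (F y) = ?D x (F x) + e2" by (simp add: e2_def)
      also note Fy
      also have "y = x + s *\<^sub>R v + s\<^sup>2 *\<^sub>R w + e" by (simp add: e_def)
      finally show ?thesis
        by (simp add: scaleR_add_right power2_eq_square)
    qed
    have "norm (y' - (x + s *\<^sub>R (v + F x) + s\<^sup>2 *\<^sub>R (w + ?D x v + (1 / 2) *\<^sub>R ?D x (F x))))
       \<le> norm (e + e3) + norm (s *\<^sub>R (s\<^sup>2 *\<^sub>R ?D x w + ?D x e)) + norm (s *\<^sub>R e1) + norm (- (s\<^sup>2 / 2) *\<^sub>R e2)"
      unfolding eq by (rule norm_triangle_4)
    also have "\<dots> \<le> 2 * K * h ^ 3 + 2 * L * K * h ^ 3 + 9 * L * K\<^sup>2 * h ^ 3 + 3 * L\<^sup>2 * K * h ^ 3"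
    proof (intro add_mono)
      show "norm (e + e3) \<le> 2 * K * h ^ 3" using norm_triangle_ineq[of e e3] K by linarith
      have "norm (s\<^sup>2 *\<^sub>R ?D x w + ?D x e) \<le> h\<^sup>2 * (L * K) + L * (K * h ^ 3)"
      proof -
        have "norm (s\<^sup>2 *\<^sub>R ?D x w) \<le> h\<^sup>2 * (L * K)"
          using h0 order.trans[OF L(4)[OF x] mult_left_mono[OF K(2)]] L(1) by (auto intro!: mult_mono)
        moreover have "norm (?D x e) \<le> L * (K * h ^ 3)"
          using order.trans[OF L(4)[OF x] mult_left_mono[OF K(3)]] L(1) by auto
        ultimately show ?thesis using norm_triangle_ineq[of "s\<^sup>2 *\<^sub>R ?D x w" "?D x e"] by linarith
      qed
      also have "\<dots> \<le> h\<^sup>2 * (L * K) + L * (K * h\<^sup>2)"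
        using h32 L(1) K by (intro add_mono mult_left_mono) auto
      finally have "norm (s\<^sup>2 *\<^sub>R ?D x w + ?D x e) \<le> 2 * L * K * h\<^sup>2" by (simp add: mult_ac)
      then have "s * norm (s\<^sup>2 *\<^sub>R ?D x w + ?D x e) \<le> h * (2 * L * K * h\<^sup>2)" using s by (intro mult_mono) auto
      then show "norm (s *\<^sub>R (s\<^sup>2 *\<^sub>R ?D x w + ?D x e)) \<le> 2 * L * K * h ^ 3"
        using s by (simp add: power2_eq_square power3_eq_cube mult_ac)
      have "s * norm e1 \<le> h * (9 * L * K\<^sup>2 * h\<^sup>2)" using s e1 by (intro mult_mono) auto
      then show "norm (s *\<^sub>R e1) \<le> 9 * L * K\<^sup>2 * h ^ 3"
        using s by (simp add: power2_eq_square power3_eq_cube mult_ac)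
      have "s\<^sup>2 / 2 * norm e2 \<le> h\<^sup>2 / 2 * (6 * L\<^sup>2 * K * h)" using h0 e2 by (intro mult_mono) auto
      then show "norm (- (s\<^sup>2 / 2) *\<^sub>R e2) \<le> 3 * L\<^sup>2 * K * h ^ 3"
        by (simp add: power2_eq_square power3_eq_cube mult_ac)
    qed
    also have "\<dots> = (2 * K + 2 * (L * K) + 9 * (L * K * K) + 3 * (L\<^sup>2 * K)) * h ^ 3"
      by (simp add: algebra_simps power2_eq_square)
    also have "\<dots> \<le> K' * h ^ 3"
      using K(4) pos h0 by (intro mult_right_mono) (auto simp: K')
    finally have "norm (y' - (x + s *\<^sub>R (v + F x) + s\<^sup>2 *\<^sub>R (w + ?D x v + (1 / 2) *\<^sub>R ?D x (F x)))) \<le> K' * h ^ 3" .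
    moreover have "norm (v + F x) \<le> K'"
      using norm_triangle_ineq[of v "F x"] K L(2)[OF x] pos unfolding K' by linarith
    moreover have "norm (w + ?D x v + (1 / 2) *\<^sub>R ?D x (F x)) \<le> K'"
    proof -
      have "norm (?D x v) \<le> L * K" using order.trans[OF L(4)[OF x] mult_left_mono[OF K(1)]] L(1) by auto
      moreover have "norm ((1 / 2) *\<^sub>R ?D x (F x)) \<le> L\<^sup>2"
        using DF norm_ge_zero[of "?D x (F x)"] unfolding power2_eq_square norm_scaleR by linarith
      moreover have "L * K = L * \<bar>K\<bar>" "K = \<bar>K\<bar>" using K by auto
      ultimately show ?thesis
        using norm_triangle_ineq[of "w + ?D x v" "(1 / 2) *\<^sub>R ?D x (F x)"] norm_triangle_ineq[of w "?D x v"] K(2,4) pos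
        unfolding K' by linarith
    qed
    ultimately show ?thesis unfolding quadratic_expansion_def by blast
  qed
  ultimately show ?thesis by (rule that)
qed

text \<open>The fields \<open>f\<close>, \<open>g\<close>, \<open>-f\<close>, \<open>-g\<close> are
  run in turn, each for time \<open>sqrt s\<close>. The coefficients of \<open>sqrt s\<close>
  cancel, that of \<open>s\<close> is exactly the bracket, and the remainder of order
  \<open>h * sqrt h\<close> is below \<open>\<epsilon> * h\<close> for small
  \<open>h\<close>.\<close>

lemma euler_approximable_lie_bracket:
  fixes f g :: "'a::euclidean_space \<Rightarrow> 'a"
  assumes f: "Ck 2 f" and g: "Ck 2 g" and R: "transp R"
    and T: "taylor_approximable R f p" "taylor_approximable R g p"
      "taylor_approximable R (\<lambda>x. - f x) p" "taylor_approximable R (\<lambda>x. - g x) p"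
  shows "euler_approximable R (lie_bracket f g) p"
proof -
  define F where "F i = [f, g, \<lambda>x. - f x, \<lambda>x. - g x] ! i" for i
  have Tay: "\<exists>r C h0. r > 0 \<and> h0 > 0 \<and> (\<forall>h. 0 < h \<and> h \<le> h0 \<longrightarrow>
    (\<exists>\<psi>. continuous_on ({0..h} \<times> cball p r) (\<lambda>(s, x). \<psi> s x) \<and>
      (\<forall>s\<in>{0..h}. \<forall>x\<in>cball p r. R x (\<psi> s x) \<and> norm (\<psi> s x - taylor (F i) s x) \<le> C * h ^ 3)))"
    if "i < 4" for i
  proof -
    have "taylor_approximable R (F i) p"
      using that T by (auto simp: F_def less_Suc_eq eval_nat_numeral)
    then show ?thesis unfolding taylor_approximable_def by blast
  qed
  then obtain r C h0 where r: "\<And>i. i < 4 \<Longrightarrow> r i > 0" and h0: "\<And>i. i < 4 \<Longrightarrow> h0 i > 0"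
    and Tay: "\<And>i h. \<lbrakk>i < 4; 0 < h; h \<le> h0 i\<rbrakk> \<Longrightarrow>
    (\<exists>\<psi>. continuous_on ({0..h} \<times> cball p (r i)) (\<lambda>(s, x). \<psi> s x) \<and>
      (\<forall>s\<in>{0..h}. \<forall>x\<in>cball p (r i). R x (\<psi> s x) \<and> norm (\<psi> s x - taylor (F i) s x) \<le> C i * h ^ 3))"
    by metis
  define \<rho> where "\<rho> = Min (r ` {..<4})"
  define \<eta> where "\<eta> = Min (h0 ` {..<4})"
  define K0 where "K0 = Max (insert 0 (C ` {..<4}))"
  have ne: "{..<4::nat} \<noteq> {}" by (metis lessThan_iff empty_iff zero_less_numeral)
  have \<rho>: "0 < \<rho>" "\<And>i. i < 4 \<Longrightarrow> \<rho> \<le> r i" using r ne unfolding \<rho>_def by (subst Min_gr_iff) auto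
  have \<eta>: "0 < \<eta>" "\<And>i. i < 4 \<Longrightarrow> \<eta> \<le> h0 i" using h0 ne unfolding \<eta>_def by (subst Min_gr_iff) auto
  have K0: "0 \<le> K0" "\<And>i. i < 4 \<Longrightarrow> C i \<le> K0" unfolding K0_def by auto
  let ?Df = "\<lambda>x. frechet_derivative f (at x)" and ?Dg = "\<lambda>x. frechet_derivative g (at x)"
  have diff: "f differentiable (at x)" "g differentiable (at x)" for x
    using f g unfolding numeral_2_eq_2 by (simp_all only: Ck.simps)
  have lin: "linear (?Df x)" "linear (?Dg x)" for x
    using diff by (auto intro: linear_frechet_derivative)
  have f': "Ck 2 (\<lambda>x. - f x)" and g': "Ck 2 (\<lambda>x. - g x)"
    by (intro Ck_bounded_linear[OF bounded_linear_minus[OF bounded_linear_ident]] f g)+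
  note step = quadratic_expansion_step[where p = p and r = \<rho>]
  obtain K1 where K1: "K0 \<le> K1" "\<And>x y y' v w s h. \<lbrakk>x \<in> cball p \<rho>; y \<in> cball p \<rho>; 0 \<le> s; s \<le> h; h \<le> 1;
      quadratic_expansion K0 h s x y v w; norm (y' - taylor f s y) \<le> K0 * h ^ 3\<rbrakk> \<Longrightarrow>
      quadratic_expansion K1 h s x y' (v + f x) (w + ?Df x v + (1 / 2) *\<^sub>R ?Df x (f x))"
    by (rule step[OF f, where K = K0]) (rule that)
  obtain K2 where K2: "K1 \<le> K2" "\<And>x y y' v w s h. \<lbrakk>x \<in> cball p \<rho>; y \<in> cball p \<rho>; 0 \<le> s; s \<le> h; h \<le> 1;
      quadratic_expansion K1 h s x y v w; norm (y' - taylor g s y) \<le> K1 * h ^ 3\<rbrakk> \<Longrightarrow>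
      quadratic_expansion K2 h s x y' (v + g x) (w + ?Dg x v + (1 / 2) *\<^sub>R ?Dg x (g x))"
    by (rule step[OF g, where K = K1]) (rule that)
  obtain K3 where K3: "K2 \<le> K3" "\<And>x y y' v w s h. \<lbrakk>x \<in> cball p \<rho>; y \<in> cball p \<rho>; 0 \<le> s; s \<le> h; h \<le> 1;
      quadratic_expansion K2 h s x y v w; norm (y' - taylor (\<lambda>x. - f x) s y) \<le> K2 * h ^ 3\<rbrakk> \<Longrightarrow>
      quadratic_expansion K3 h s x y' (v - f x) (w - ?Df x v + (1 / 2) *\<^sub>R ?Df x (f x))"
    by (rule step[OF f', where K = K2, unfolded frechet_derivative_uminus[OF diff(1)] linear_neg[OF lin(1)]])
      (rule that, simp_all)
  obtain K4 where K4: "K3 \<le> K4" "\<And>x y y' v w s h. \<lbrakk>x \<in> cball p \<rho>; y \<in> cball p \<rho>; 0 \<le> s; s \<le> h; h \<le> 1;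
      quadratic_expansion K3 h s x y v w; norm (y' - taylor (\<lambda>x. - g x) s y) \<le> K3 * h ^ 3\<rbrakk> \<Longrightarrow>
      quadratic_expansion K4 h s x y' (v - g x) (w - ?Dg x v + (1 / 2) *\<^sub>R ?Dg x (g x))"
    by (rule step[OF g', where K = K3, unfolded frechet_derivative_uminus[OF diff(2)] linear_neg[OF lin(2)]])
      (rule that, simp_all)
  have K4pos: "0 \<le> K4" using K0 K1 K2 K3 K4 by linarith
  show ?thesis
    unfolding euler_approximable_def
  proof (rule exI[of _ "\<rho> / 2"], intro conjI allI impI)
    show "0 < \<rho> / 2" using \<rho> by simp
    fix \<epsilon> :: real assume \<epsilon>: "\<epsilon> > 0"
    \<comment> \<open>Bounds on the running time \<open>H\<close>: the expansions require
      \<open>H \<le> 1\<close>, all four maps exist up to \<open>\<eta>\<close>, the third entry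
      keeps the intermediate points in \<open>cball p \<rho>\<close>, and the fourth makes the error
      \<open>K4 * H ^ 3\<close> at most \<open>\<epsilon> * H^2\<close>.\<close>
    define \<sigma> where "\<sigma> = Min {1, \<eta>, \<rho> / (6 * (K4 + 1)), \<epsilon> / (K4 + 1)}"
    have \<sigma>: "0 < \<sigma>" "\<sigma> \<le> 1" "\<sigma> \<le> \<eta>" "\<sigma> \<le> \<rho> / (6 * (K4 + 1))" "\<sigma> \<le> \<epsilon> / (K4 + 1)"
      using \<eta>(1) \<rho>(1) \<epsilon> K4pos by (auto simp: \<sigma>_def)
    show "\<exists>h0>0. \<forall>h. 0 < h \<and> h \<le> h0 \<longrightarrow>
      (\<exists>\<psi>. continuous_on ({0..h} \<times> cball p (\<rho> / 2)) (\<lambda>(s, x). \<psi> s x) \<and>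
        (\<forall>s\<in>{0..h}. \<forall>x\<in>cball p (\<rho> / 2). R x (\<psi> s x) \<and>
          norm (\<psi> s x - (x + s *\<^sub>R lie_bracket f g x)) \<le> \<epsilon> * h))"
    proof (rule exI[of _ "\<sigma>\<^sup>2"], intro conjI allI impI)
      show "0 < \<sigma>\<^sup>2" using \<sigma>(1) by simp
      fix h assume h: "0 < h \<and> h \<le> \<sigma>\<^sup>2"
      define H where "H = sqrt h"
      have H: "0 < H" "H \<le> \<sigma>" "H\<^sup>2 = h"
        using h \<sigma>(1) by (auto simp: H_def real_le_lsqrt)
      have "\<forall>i<4. \<exists>\<psi>. continuous_on ({0..H} \<times> cball p \<rho>) (\<lambda>(s, x). \<psi> s x) \<and>
        (\<forall>s\<in>{0..H}. \<forall>x\<in>cball p \<rho>. R x (\<psi> s x) \<and> norm (\<psi> s x - taylor (F i) s x) \<le> K0 * H ^ 3)"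
      proof (intro allI impI)
        fix i :: nat assume i: "i < 4"
        have sub: "cball p \<rho> \<subseteq> cball p (r i)" using \<rho>(2)[OF i] by auto
        have C: "C i * H ^ 3 \<le> K0 * H ^ 3" using K0(2)[OF i] H(1) by (intro mult_right_mono) auto
        obtain \<psi> where "continuous_on ({0..H} \<times> cball p (r i)) (\<lambda>(s, x). \<psi> s x)"
          "\<forall>s\<in>{0..H}. \<forall>x\<in>cball p (r i). R x (\<psi> s x) \<and> norm (\<psi> s x - taylor (F i) s x) \<le> C i * H ^ 3"
          using Tay[OF i H(1)] H(2) \<sigma>(3) \<eta>(2)[OF i] by auto
        then show "\<exists>\<psi>. continuous_on ({0..H} \<times> cball p \<rho>) (\<lambda>(s, x). \<psi> s x) \<and>
          (\<forall>s\<in>{0..H}. \<forall>x\<in>cball p \<rho>. R x (\<psi> s x) \<and> norm (\<psi> s x - taylor (F i) s x) \<le> K0 * H ^ 3)"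
          using sub C by (intro exI[of _ \<psi>]) (fastforce intro: continuous_on_subset)
      qed
      then obtain \<psi> where cont: "\<And>i. i < 4 \<Longrightarrow> continuous_on ({0..H} \<times> cball p \<rho>) (\<lambda>(s, x). \<psi> i s x)"
        and R\<psi>: "\<And>i s x. i < 4 \<Longrightarrow> s \<in> {0..H} \<Longrightarrow> x \<in> cball p \<rho> \<Longrightarrow> R x (\<psi> i s x)"
        and app: "\<And>i s x. i < 4 \<Longrightarrow> s \<in> {0..H} \<Longrightarrow> x \<in> cball p \<rho> \<Longrightarrow>
            norm (\<psi> i s x - taylor (F i) s x) \<le> K0 * H ^ 3"
        by metis
      have F: "F 0 = f" "F (Suc 0) = g" "F 2 = (\<lambda>x. - f x)" "F 3 = (\<lambda>x. - g x)"
        by (simp_all add: F_def)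
      define y1 where "y1 q = \<psi> 0 (sqrt (fst q)) (snd q)" for q
      define y2 where "y2 q = \<psi> 1 (sqrt (fst q)) (y1 q)" for q
      define y3 where "y3 q = \<psi> 2 (sqrt (fst q)) (y2 q)" for q
      define y4 where "y4 q = \<psi> 3 (sqrt (fst q)) (y3 q)" for q
      let ?S = "{0..h} \<times> cball p (\<rho> / 2)"
      have sq: "sqrt (fst q) \<in> {0..H}" if "q \<in> ?S" for q
        using that by (auto simp: H_def)
      have near: "y \<in> cball p \<rho>" if q: "q \<in> ?S" and e: "quadratic_expansion K H (sqrt (fst q)) (snd q) y v w" and K: "K \<le> K4" for q y v w K
      proof -
        have "norm (y - snd q) \<le> 3 * K * H"
          using quadratic_expansion_dist[OF e] sq[OF q] H \<sigma>(2) by simp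
        also have "\<dots> \<le> 3 * (K4 + 1) * (\<rho> / (6 * (K4 + 1)))"
          using K K4pos H \<sigma>(4) order.trans[OF norm_ge_zero[of v], of K] e
          unfolding quadratic_expansion_def by (intro mult_mono) auto
        also have "\<dots> = \<rho> / 2" using K4pos by (simp add: field_simps)
        finally show ?thesis
          using q dist_triangle[of p y "snd q"] by (auto simp: dist_norm norm_minus_commute)
      qed
      have big: "norm a \<le> K * H ^ 3" if "norm a \<le> K0 * H ^ 3" "K0 \<le> K" for a :: 'a and K
        using that H(1) by (meson mult_right_mono zero_le_power less_imp_le order.trans)
      have main: "y1 q \<in> cball p \<rho> \<and> y2 q \<in> cball p \<rho> \<and> y3 q \<in> cball p \<rho> \<and> R (snd q) (y4 q) \<and>
         norm (y4 q - (snd q + fst q *\<^sub>R lie_bracket f g (snd q))) \<le> K4 * H ^ 3" if q: "q \<in> ?S" for q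
      proof -
        define x where "x = snd q"
        define s where "s = sqrt (fst q)"
        have s: "0 \<le> s" "s \<le> H" "s \<in> {0..H}" "s\<^sup>2 = fst q" and H1: "H \<le> 1" using sq[OF q] q H \<sigma> by (auto simp: s_def)
        have x: "x \<in> cball p \<rho>" using q \<rho>(1) by (auto simp: x_def)
        have 0: "quadratic_expansion K0 H s x x 0 0" using K0 H by (simp add: quadratic_expansion_def)
        have 1: "quadratic_expansion K1 H s x (y1 q) (f x) ((1 / 2) *\<^sub>R ?Df x (f x))"
          using K1(2)[OF x x s(1,2) H1 0, of "y1 q"] app[of 0 s x] s x linear_0[OF lin(1)]
          by (simp add: y1_def F x_def[symmetric] s_def[symmetric])
        have n1: "y1 q \<in> cball p \<rho>"
          by (rule near[OF q 1[unfolded x_def s_def]]) (use K2 K3 K4 in linarith)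
        have 2: "quadratic_expansion K2 H s x (y2 q) (f x + g x) ((1 / 2) *\<^sub>R ?Df x (f x) + ?Dg x (f x) + (1 / 2) *\<^sub>R ?Dg x (g x))"
          by (rule K2(2)[OF x n1 s(1,2) H1 1 big[OF _ K1(1)]])
            (use app[of 1 s "y1 q"] s n1 in \<open>simp add: y2_def F s_def[symmetric]\<close>)
        have n2: "y2 q \<in> cball p \<rho>"
          by (rule near[OF q 2[unfolded x_def s_def]]) (use K3 K4 in linarith)
        have 3: "quadratic_expansion K3 H s x (y3 q) (f x + g x - f x)
           ((1 / 2) *\<^sub>R ?Df x (f x) + ?Dg x (f x) + (1 / 2) *\<^sub>R ?Dg x (g x) - ?Df x (f x + g x) + (1 / 2) *\<^sub>R ?Df x (f x))"
          by (rule K3(2)[OF x n2 s(1,2) H1 2 big])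
            (use app[of 2 s "y2 q"] s n2 K1 K2 in \<open>simp_all add: y3_def F s_def[symmetric]\<close>)
        have n3: "y3 q \<in> cball p \<rho>"
          by (rule near[OF q 3[unfolded x_def s_def]]) (use K4 in linarith)
        have 4: "quadratic_expansion K4 H s x (y4 q) (f x + g x - f x - g x)
           ((1 / 2) *\<^sub>R ?Df x (f x) + ?Dg x (f x) + (1 / 2) *\<^sub>R ?Dg x (g x) - ?Df x (f x + g x) + (1 / 2) *\<^sub>R ?Df x (f x)
             - ?Dg x (f x + g x - f x) + (1 / 2) *\<^sub>R ?Dg x (g x))"
          by (rule K4(2)[OF x n3 s(1,2) H1 3 big])
            (use app[of 3 s "y3 q"] s n3 K1 K2 K3 in \<open>simp_all add: y4_def F s_def[symmetric]\<close>)
        \<comment> \<open>The two halves of \<open>Df(f)\<close>, from running \<open>f\<close> and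
          \<open>-f\<close>, add up and are cancelled by a mixed term; the same happens to
          \<open>Dg(g)\<close>, which leaves \<open>Dg(f) - Df(g)\<close>.\<close>
        have half: "(1 / 2) *\<^sub>R a + (1 / 2) *\<^sub>R a = a" for a :: 'a
          by (simp flip: scaleR_add_left)
        have "(1 / 2) *\<^sub>R ?Df x (f x) + ?Dg x (f x) + (1 / 2) *\<^sub>R ?Dg x (g x) - ?Df x (f x + g x) + (1 / 2) *\<^sub>R ?Df x (f x)
             - ?Dg x (f x + g x - f x) + (1 / 2) *\<^sub>R ?Dg x (g x)
          = ((1 / 2) *\<^sub>R ?Df x (f x) + (1 / 2) *\<^sub>R ?Df x (f x)) + ((1 / 2) *\<^sub>R ?Dg x (g x) + (1 / 2) *\<^sub>R ?Dg x (g x))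
             + ?Dg x (f x) - ?Df x (f x + g x) - ?Dg x (g x)"
          by simp
        also have "\<dots> = lie_bracket f g x"
          unfolding half using linear_add[OF lin(1)] by (simp add: lie_bracket_def)
        finally have "quadratic_expansion K4 H s x (y4 q) 0 (lie_bracket f g x)" using 4 by simp
        then have "norm (y4 q - (x + fst q *\<^sub>R lie_bracket f g x)) \<le> K4 * H ^ 3"
          using s(4) by (simp add: quadratic_expansion_def)
        moreover have "R x (y4 q)"
          using R\<psi>[of 0 s x] R\<psi>[of 1 s "y1 q"] R\<psi>[of 2 s "y2 q"] R\<psi>[of 3 s "y3 q"] s x n1 n2 n3
          by (simp add: y1_def y2_def y3_def y4_def x_def[symmetric] s_def[symmetric])
            (meson R transpD)
        ultimately show ?thesis using n1 n2 n3 by (simp add: x_def)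
      qed
      have csq: "continuous_on ?S (\<lambda>q. sqrt (fst q))" by (intro continuous_intros)
      have "continuous_on ?S y4"
        unfolding y4_def
      proof (rule continuous_on_flow_compose[OF cont csq])
        show "continuous_on ?S y3"
          unfolding y3_def
        proof (rule continuous_on_flow_compose[OF cont csq])
          show "continuous_on ?S y2"
            unfolding y2_def
          proof (rule continuous_on_flow_compose[OF cont csq])
            show "continuous_on ?S y1"
              unfolding y1_def
              by (rule continuous_on_flow_compose[OF cont csq]) (use sq \<rho>(1) in \<open>auto intro!: continuous_intros\<close>)
          qed (use sq main in auto)
        qed (use sq main in auto)
      qed (use sq main in auto)
      moreover have "K4 * H ^ 3 \<le> \<epsilon> * h"
      proof -
        have "K4 * H \<le> (K4 + 1) * (\<epsilon> / (K4 + 1))"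
          using H \<sigma>(5) K4pos by (intro mult_mono) auto
        then have "(K4 * H) * H\<^sup>2 \<le> \<epsilon> * H\<^sup>2"
          using K4pos by (intro mult_right_mono) auto
        then show ?thesis unfolding H(3) by (simp add: H(3)[symmetric] power3_eq_cube power2_eq_square mult_ac)
      qed
      ultimately show "\<exists>\<psi>. continuous_on ?S (\<lambda>(s, x). \<psi> s x) \<and>
        (\<forall>s\<in>{0..h}. \<forall>x\<in>cball p (\<rho> / 2). R x (\<psi> s x) \<and>
          norm (\<psi> s x - (x + s *\<^sub>R lie_bracket f g x)) \<le> \<epsilon> * h)"
        using main by (intro exI[of _ "\<lambda>s x. y4 (s, x)"]) (fastforce simp: case_prod_unfold)
    qed
  qed
qed

text \<open>A commutator also runs its fields backwards, so the induction must carry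
  \<open>-X\<close> along with \<open>X\<close>; antisymmetry closes it, \<open>-[f, h]\<close>
  being \<open>[h, f]\<close>.\<close>

lemma euler_approximable_iterated_brackets:
  assumes R: "reflp R" "transp R"
    and F: "\<And>f. f \<in> F \<Longrightarrow> smooth f"
      "\<And>f. f \<in> F \<Longrightarrow> euler_approximable R f p"
      "\<And>f. f \<in> F \<Longrightarrow> euler_approximable R (\<lambda>x. - f x) p"
    and X: "X \<in> iterated_brackets F"
  shows "smooth X \<and> euler_approximable R X p \<and> euler_approximable R (\<lambda>x. - X x) p"
  using X
proof induction
  case (field f)
  then show ?case using F by blast
next
  case (bracket f h)
  have tay: "taylor_approximable R f p" "taylor_approximable R h p"
      "taylor_approximable R (\<lambda>x. - f x) p" "taylor_approximable R (\<lambda>x. - h x) p"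
    using bracket.IH smooth_uminus smooth_imp_Ck R by (blast intro: taylor_approximable_if_euler_approximable)+
  have C: "Ck 2 f" "Ck 2 h" using bracket.IH smooth_imp_Ck by blast+
  have "euler_approximable R (lie_bracket f h) p" "euler_approximable R (lie_bracket h f) p"
    using tay C R by (auto intro!: euler_approximable_lie_bracket)
  moreover have "(\<lambda>x. - lie_bracket f h x) = lie_bracket h f"
    by (simp add: fun_eq_iff lie_bracket_def)
  ultimately show ?case
    using bracket.IH by (simp add: smooth_lie_bracket)
qed

section \<open>Chow's theorem\<close>

text \<open>The maps of the fields \<open>X b\<close> are composed, for times given by functions
  \<open>l b\<close> of a parameter \<open>v\<close>; to first order the displacements simply add
  up. In the application these times are the coordinates of \<open>v\<close> in a basis.\<close>

lemma euler_approximable_sum: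
  fixes X :: "'a::euclidean_space \<Rightarrow> 'a \<Rightarrow> 'a"
  assumes R: "reflp R" "transp R" and B: "finite B"
    and X: "\<And>b. b \<in> B \<Longrightarrow> Ck 1 (X b)" "\<And>b. b \<in> B \<Longrightarrow> euler_approximable R (X b) p"
    and l: "\<And>b. b \<in> B \<Longrightarrow> continuous_on UNIV (l b)"
  shows "\<exists>r>0. \<forall>\<epsilon>>0. \<exists>h0>0. \<forall>h. 0 < h \<and> h \<le> h0 \<longrightarrow> (\<exists>G. \<forall>x\<in>cball p r.
    continuous_on {v::'a. \<forall>b\<in>B. l b v \<in> {0..h}} (\<lambda>v. G v x) \<and>
    (\<forall>v. (\<forall>b\<in>B. l b v \<in> {0..h}) \<longrightarrow> R x (G v x) \<and>
      norm (G v x - (x + (\<Sum>b\<in>B. l b v *\<^sub>R X b x))) \<le> \<epsilon> * h))"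
  using B X l
proof (induction B)
  case empty
  have "\<exists>G. \<forall>x\<in>cball p 1. continuous_on UNIV (\<lambda>v::'a. G v x) \<and> (\<forall>v. R x (G v x) \<and> norm (G v x - x) \<le> \<epsilon> * h)"
    if "0 < \<epsilon>" "0 < h" for \<epsilon> h :: real
    by (rule exI[of _ "\<lambda>v x. x"]) (use that R in \<open>auto simp: reflp_def\<close>)
  then show ?case
    by (intro exI[of _ 1] conjI allI impI; force intro: exI[of _ 1])
next
  case (insert b B)
  obtain r1 where r1: "0 < r1" and G1: "\<And>\<epsilon>. \<epsilon> > 0 \<Longrightarrow> \<exists>h0>0. \<forall>h. 0 < h \<and> h \<le> h0 \<longrightarrow> (\<exists>G. \<forall>x\<in>cball p r1.
    continuous_on {v::'a. \<forall>b\<in>B. l b v \<in> {0..h}} (\<lambda>v. G v x) \<and>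
    (\<forall>v. (\<forall>b\<in>B. l b v \<in> {0..h}) \<longrightarrow> R x (G v x) \<and>
      norm (G v x - (x + (\<Sum>b\<in>B. l b v *\<^sub>R X b x))) \<le> \<epsilon> * h))"
    using insert.IH insert.prems by blast
  obtain r2 where r2: "0 < r2" and G2: "\<And>\<epsilon>. \<epsilon> > 0 \<Longrightarrow> \<exists>h0>0. \<forall>h. 0 < h \<and> h \<le> h0 \<longrightarrow>
    (\<exists>\<psi>. continuous_on ({0..h} \<times> cball p r2) (\<lambda>(s, x). \<psi> s x) \<and>
      (\<forall>s\<in>{0..h}. \<forall>x\<in>cball p r2. R x (\<psi> s x) \<and> norm (\<psi> s x - (x + s *\<^sub>R X b x)) \<le> \<epsilon> * h))"
    using insert.prems(2)[of b] unfolding euler_approximable_def by blast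
  define r where "r = min r1 (r2 / 2)"
  have r: "0 < r" "r \<le> r1" "r \<le> r2 / 2" using r1 r2 by (auto simp: r_def)
  obtain L where L: "L > 0" "\<And>x y. x \<in> cball p r2 \<Longrightarrow> y \<in> cball p r2 \<Longrightarrow> norm (X b x - X b y) \<le> L * norm (x - y)"
    by (rule Ck1_lipschitz[where p = p and r = r2, OF insert.prems(1)[of b]]) (simp, rule that)
  have "continuous_on UNIV (X c)" if "c \<in> B" for c
    using insert.prems(1)[of c] that Ck_Suc_imp_Ck[of 0 "X c"] by simp
  then have "continuous_on (cball p r) (\<lambda>x. \<Sum>c\<in>B. norm (X c x))"
    by (intro continuous_intros) (blast intro: continuous_on_subset)
  then obtain K where K: "K \<ge> 0" "\<And>x. x \<in> cball p r \<Longrightarrow> norm (\<Sum>c\<in>B. norm (X c x)) \<le> K"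
    by (rule compact_continuous_norm_bound[OF compact_cball]) (rule that)
  show ?case
  proof (rule exI[of _ r], intro conjI allI impI)
    fix \<epsilon> :: real assume \<epsilon>: "0 < \<epsilon>"
    obtain h1 where h1: "0 < h1" "\<And>h. 0 < h \<Longrightarrow> h \<le> h1 \<Longrightarrow> (\<exists>G. \<forall>x\<in>cball p r1.
      continuous_on {v::'a. \<forall>b\<in>B. l b v \<in> {0..h}} (\<lambda>v. G v x) \<and>
      (\<forall>v. (\<forall>b\<in>B. l b v \<in> {0..h}) \<longrightarrow> R x (G v x) \<and>
        norm (G v x - (x + (\<Sum>b\<in>B. l b v *\<^sub>R X b x))) \<le> \<epsilon> / 3 * h))"
      using G1[of "\<epsilon> / 3"] \<epsilon> by auto
    obtain h2 where h2: "0 < h2" "\<And>h. 0 < h \<Longrightarrow> h \<le> h2 \<Longrightarrow>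
      (\<exists>\<psi>. continuous_on ({0..h} \<times> cball p r2) (\<lambda>(s, x). \<psi> s x) \<and>
        (\<forall>s\<in>{0..h}. \<forall>x\<in>cball p r2. R x (\<psi> s x) \<and> norm (\<psi> s x - (x + s *\<^sub>R X b x)) \<le> \<epsilon> / 3 * h))"
      using G2[of "\<epsilon> / 3"] \<epsilon> by auto
    \<comment> \<open>\<open>G v x\<close> moves at most \<open>(K + \<epsilon>) * h\<close> away
      from \<open>x\<close>; the third entry therefore keeps it in \<open>cball p r2\<close>, and by
      the fourth \<open>X b\<close> changes on the way by at most
      \<open>\<epsilon> / 3\<close>.\<close>
    define h0 where "h0 = Min {h1, h2, r2 / (2 * (K + \<epsilon>)), \<epsilon> / (3 * L * (K + \<epsilon>))}"
    have h0: "0 < h0" "h0 \<le> h1" "h0 \<le> h2" "h0 \<le> r2 / (2 * (K + \<epsilon>))" "h0 \<le> \<epsilon> / (3 * L * (K + \<epsilon>))"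
      using h1 h2 r2 K(1) \<epsilon> L(1) by (auto simp: h0_def)
    show "\<exists>h0>0. \<forall>h. 0 < h \<and> h \<le> h0 \<longrightarrow> (\<exists>G. \<forall>x\<in>cball p r.
      continuous_on {v::'a. \<forall>b\<in>insert b B. l b v \<in> {0..h}} (\<lambda>v. G v x) \<and>
      (\<forall>v. (\<forall>b\<in>insert b B. l b v \<in> {0..h}) \<longrightarrow> R x (G v x) \<and>
        norm (G v x - (x + (\<Sum>b\<in>insert b B. l b v *\<^sub>R X b x))) \<le> \<epsilon> * h))"
    proof (rule exI[of _ h0], intro conjI allI impI)
      fix h assume h: "0 < h \<and> h \<le> h0"
      let ?V = "{v::'a. \<forall>b\<in>insert b B. l b v \<in> {0..h}}"
      obtain G where G: "\<And>x. x \<in> cball p r1 \<Longrightarrow> continuous_on {v::'a. \<forall>b\<in>B. l b v \<in> {0..h}} (\<lambda>v. G v x)"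
        "\<And>x v. x \<in> cball p r1 \<Longrightarrow> \<forall>b\<in>B. l b v \<in> {0..h} \<Longrightarrow> R x (G v x)"
        "\<And>x v. x \<in> cball p r1 \<Longrightarrow> \<forall>b\<in>B. l b v \<in> {0..h} \<Longrightarrow>
          norm (G v x - (x + (\<Sum>b\<in>B. l b v *\<^sub>R X b x))) \<le> \<epsilon> / 3 * h"
        using h1(2)[of h] h h0 by fastforce
      obtain \<psi> where \<psi>: "continuous_on ({0..h} \<times> cball p r2) (\<lambda>(s, x). \<psi> s x)"
        "\<And>s x. s \<in> {0..h} \<Longrightarrow> x \<in> cball p r2 \<Longrightarrow> R x (\<psi> s x)"
        "\<And>s x. s \<in> {0..h} \<Longrightarrow> x \<in> cball p r2 \<Longrightarrow> norm (\<psi> s x - (x + s *\<^sub>R X b x)) \<le> \<epsilon> / 3 * h"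
        using h2(2)[of h] h h0 by fastforce
      have Gdist: "norm (G v x - x) \<le> (K + \<epsilon>) * h" if x: "x \<in> cball p r" and v: "v \<in> ?V" for x v
      proof -
        let ?S = "\<Sum>b\<in>B. l b v *\<^sub>R X b x"
        have "norm ?S \<le> (\<Sum>c\<in>B. h * norm (X c x))"
          using v by (intro order.trans[OF norm_sum] sum_mono) (auto intro!: mult_right_mono)
        also have "\<dots> \<le> h * K" using K(2)[OF x] h by (simp add: sum_distrib_left[symmetric])
        finally have "norm ?S \<le> h * K" .
        moreover have "norm (G v x - (x + ?S)) \<le> \<epsilon> / 3 * h" using G(3)[of x v] x v r by auto
        moreover have "G v x - x = (G v x - (x + ?S)) + ?S" by simp
        then have "norm (G v x - x) \<le> norm (G v x - (x + ?S)) + norm ?S" by (metis norm_triangle_ineq)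
        moreover have "\<epsilon> / 3 * h \<le> \<epsilon> * h" using \<epsilon> h by simp
        ultimately show ?thesis by (simp add: algebra_simps)
      qed
      have Gin: "G v x \<in> cball p r2" if x: "x \<in> cball p r" and v: "v \<in> ?V" for x v
      proof -
        have "(K + \<epsilon>) * h \<le> (K + \<epsilon>) * (r2 / (2 * (K + \<epsilon>)))"
          using h h0 K \<epsilon> by (intro mult_left_mono) auto
        also have "\<dots> = r2 / 2" using K \<epsilon> by (simp add: field_simps)
        finally show ?thesis
          using Gdist[OF x v] x r dist_triangle[of p "G v x" x] by (simp add: dist_norm norm_minus_commute)
      qed
      have "\<forall>x\<in>cball p r. continuous_on ?V (\<lambda>v. \<psi> (l b v) (G v x)) \<and>
        (\<forall>v. (\<forall>b\<in>insert b B. l b v \<in> {0..h}) \<longrightarrow> R x (\<psi> (l b v) (G v x)) \<and>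
        norm (\<psi> (l b v) (G v x) - (x + (\<Sum>b\<in>insert b B. l b v *\<^sub>R X b x))) \<le> \<epsilon> * h)"
      proof (intro ballI conjI allI impI)
        fix x assume x: "x \<in> cball p r"
        then have x1: "x \<in> cball p r1" and x2: "x \<in> cball p r2" using r r2 by auto
        show "continuous_on ?V (\<lambda>v. \<psi> (l b v) (G v x))"
        proof (rule continuous_on_flow_compose[OF \<psi>(1)])
          show "continuous_on ?V (l b)" using insert.prems(3)[of b] by (auto intro: continuous_on_subset)
          show "continuous_on ?V (\<lambda>v. G v x)" by (rule continuous_on_subset[OF G(1)[OF x1]]) auto
        qed (use Gin[OF x] in auto)
        fix v assume v: "\<forall>b\<in>insert b B. l b v \<in> {0..h}"
        then have lb: "l b v \<in> {0..h}" and vB: "\<forall>b\<in>B. l b v \<in> {0..h}" by auto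
        have Gv: "G v x \<in> cball p r2" using Gin[OF x] v by blast
        show "R x (\<psi> (l b v) (G v x))"
          using transpD[OF R(2) G(2)[OF x1 vB] \<psi>(2)[OF lb Gv]] .
        have "norm (X b (G v x) - X b x) \<le> L * ((K + \<epsilon>) * h)"
          using L(1) Gdist[OF x, of v] v by (intro order.trans[OF L(2)[OF Gv x2]] mult_left_mono) auto
        also have "\<dots> \<le> L * ((K + \<epsilon>) * (\<epsilon> / (3 * L * (K + \<epsilon>))))"
          using h h0 K \<epsilon> L(1) by (intro mult_left_mono) auto
        also have "\<dots> = \<epsilon> / 3"
        proof -
          have "L * (M * (\<epsilon> / (3 * L * M))) = \<epsilon> / 3" if "M > 0" for M
            using L(1) that by (simp add: field_simps)
          from this[of "K + \<epsilon>"] show ?thesis using K(1) \<epsilon> by simp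
        qed
        finally have "norm (X b (G v x) - X b x) \<le> \<epsilon> / 3" .
        then have "l b v * norm (X b (G v x) - X b x) \<le> h * (\<epsilon> / 3)"
          using lb h by (intro mult_mono) auto
        then have 3: "norm (l b v *\<^sub>R (X b (G v x) - X b x)) \<le> \<epsilon> / 3 * h" using lb by (simp add: mult.commute)
        let ?S = "\<Sum>b\<in>B. l b v *\<^sub>R X b x"
        have eq: "\<psi> (l b v) (G v x) - (x + (\<Sum>b\<in>insert b B. l b v *\<^sub>R X b x))
          = (\<psi> (l b v) (G v x) - (G v x + l b v *\<^sub>R X b (G v x))) + (G v x - (x + ?S))
            + l b v *\<^sub>R (X b (G v x) - X b x) - 0"
          using insert.hyps by (simp add: algebra_simps)
        have "norm (\<psi> (l b v) (G v x) - (x + (\<Sum>b\<in>insert b B. l b v *\<^sub>R X b x)))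
          \<le> norm (\<psi> (l b v) (G v x) - (G v x + l b v *\<^sub>R X b (G v x))) + norm (G v x - (x + ?S))
            + norm (l b v *\<^sub>R (X b (G v x) - X b x)) + norm (0::'a)"
          unfolding eq by (rule norm_triangle_4)
        also have "\<dots> \<le> \<epsilon> / 3 * h + \<epsilon> / 3 * h + \<epsilon> / 3 * h + 0"
          by (intro add_mono \<psi>(3)[OF lb Gv] G(3)[OF x1 vB] 3) simp
        finally show "norm (\<psi> (l b v) (G v x) - (x + (\<Sum>b\<in>insert b B. l b v *\<^sub>R X b x))) \<le> \<epsilon> * h"
          by simp
      qed
      then show "\<exists>G. \<forall>x\<in>cball p r. continuous_on ?V (\<lambda>v. G v x) \<and>
        (\<forall>v. (\<forall>b\<in>insert b B. l b v \<in> {0..h}) \<longrightarrow> R x (G v x) \<and>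
        norm (G v x - (x + (\<Sum>b\<in>insert b B. l b v *\<^sub>R X b x))) \<le> \<epsilon> * h)"
        by (rule exI[of _ "\<lambda>v x. \<psi> (l b v) (G v x)"])
    qed (rule h0)
  qed (rule r)
qed

text \<open>All times must be nonnegative, so the parameters range over a ball around
  \<open>v0\<close>, whose coordinates are all \<open>h / 2\<close>, and the maps reach points near
  \<open>p + v0\<close> rather than near \<open>p\<close>. Varying the starting point repairs this:
  every \<open>x\<close> near \<open>p\<close> reaches \<open>p + v0\<close>, so does
  \<open>p\<close> itself, and \<open>R\<close> is symmetric.\<close>

lemma orbit_neighbourhood:
  fixes p :: "'a::euclidean_space"
  assumes R: "reflp R" "symp R" "transp R"
    and F: "\<And>f. f \<in> F \<Longrightarrow> smooth f"
      "\<And>f. f \<in> F \<Longrightarrow> euler_approximable R f p"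
      "\<And>f. f \<in> F \<Longrightarrow> euler_approximable R (\<lambda>x. - f x) p"
    and chow: "span {f p | f. f \<in> iterated_brackets F} = UNIV"
  obtains d where "0 < d" "\<And>x. x \<in> ball p d \<Longrightarrow> R p x"
proof -
  obtain B where B: "B \<subseteq> {f p | f. f \<in> iterated_brackets F}" "independent B"
      "{f p | f. f \<in> iterated_brackets F} \<subseteq> span B"
    by (rule basis_exists[of "{f p | f. f \<in> iterated_brackets F}"]) (rule that)
  have span: "span B = UNIV"
    using span_mono[OF B(3)] unfolding chow span_span by auto
  have fin: "finite B" using B(2) independent_bound by blast
  have "\<forall>b\<in>B. \<exists>f. f \<in> iterated_brackets F \<and> f p = b" using B(1) by blast
  from bchoice[OF this] obtain X
    where X: "\<And>b. b \<in> B \<Longrightarrow> X b \<in> iterated_brackets F" "\<And>b. b \<in> B \<Longrightarrow> X b p = b"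
    by blast
  have Xp: "smooth (X b)" "euler_approximable R (X b) p" if "b \<in> B" for b
    using euler_approximable_iterated_brackets[OF R(1,3) F X(1)[OF that]] by blast+
  define l where "l b v = representation B v b" for b v
  have lin: "linear (l b)" for b
    unfolding l_def by (rule linearI) (simp_all add: representation_add[OF B(2)] representation_scale[OF B(2)] span)
  have contl: "continuous_on UNIV (l b)" for b
    by (rule linear_continuous_on) (simp add: lin linear_conv_bounded_linear[symmetric])
  have sum: "(\<Sum>b\<in>B. l b v *\<^sub>R b) = v" for v
    unfolding l_def by (rule sum_representation_eq[OF B(2) _ fin order.refl]) (simp add: span)
  have "\<exists>C>0. \<forall>v. norm (l b v) \<le> C * norm v" for b
    using linear_bounded_pos[OF lin[of b]] by blast
  then obtain C where C: "\<And>b. C b > 0" "\<And>b v. norm (l b v) \<le> C b * norm v" by metis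
  define D where "D = 1 + (\<Sum>b\<in>B. C b)"
  have D: "D > 0" unfolding D_def using C(1) by (intro add_pos_nonneg sum_nonneg) (auto intro: less_imp_le)
  have lD: "\<bar>l b v\<bar> \<le> D * norm v" if "b \<in> B" for b v
  proof -
    have "C b \<le> D" unfolding D_def using member_le_sum[of b B C] that fin C(1) by (simp add: less_imp_le)
    then show ?thesis using order.trans[OF C(2)[of b v] mult_right_mono] by simp
  qed
  \<comment> \<open>On \<open>cball v0 (c * h)\<close> each coordinate differs from
    \<open>h / 2\<close> by at most \<open>D * c * h = h / 2\<close>, so all times remain in
    \<open>[0, h]\<close>.\<close>
  define c where "c = 1 / (2 * D)"
  have c: "0 < c" "D * c = 1 / 2" using D by (auto simp: c_def)
  obtain r where r: "0 < r" and ER: "\<And>\<epsilon>. \<epsilon> > 0 \<Longrightarrow> \<exists>h0>0. \<forall>h. 0 < h \<and> h \<le> h0 \<longrightarrow> (\<exists>G. \<forall>x\<in>cball p r.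
    continuous_on {v::'a. \<forall>b\<in>B. l b v \<in> {0..h}} (\<lambda>v. G v x) \<and>
    (\<forall>v. (\<forall>b\<in>B. l b v \<in> {0..h}) \<longrightarrow> R x (G v x) \<and>
      norm (G v x - (x + (\<Sum>b\<in>B. l b v *\<^sub>R X b x))) \<le> \<epsilon> * h))"
    using euler_approximable_sum[of R B X p l, OF R(1,3) fin] Xp smooth_imp_Ck contl by blast
  obtain h0 where h0: "h0 > 0" and EG: "\<And>h. 0 < h \<Longrightarrow> h \<le> h0 \<Longrightarrow> (\<exists>G. \<forall>x\<in>cball p r.
    continuous_on {v::'a. \<forall>b\<in>B. l b v \<in> {0..h}} (\<lambda>v. G v x) \<and>
    (\<forall>v. (\<forall>b\<in>B. l b v \<in> {0..h}) \<longrightarrow> R x (G v x) \<and>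
      norm (G v x - (x + (\<Sum>b\<in>B. l b v *\<^sub>R X b x))) \<le> c / 3 * h))"
    using ER[of "c / 3"] c by auto
  have "isCont (\<lambda>x. \<Sum>b\<in>B. norm (X b x - b)) p"
  proof (intro continuous_intros)
    fix b assume "b \<in> B"
    then have "continuous_on UNIV (X b)" using Xp(1) smooth_imp_Ck[of "X b" 0] by simp
    then show "isCont (X b) p" by (simp add: continuous_on_eq_continuous_at)
  qed
  moreover have "(\<Sum>b\<in>B. norm (X b p - b)) = 0" using X(2) by simp
  ultimately obtain d1 where d1: "d1 > 0" "\<And>x. dist x p < d1 \<Longrightarrow> (\<Sum>b\<in>B. norm (X b x - b)) < c / 3"
    using c(1) unfolding continuous_at_eps_delta
    by (metis abs_less_iff dist_real_def dist_norm diff_zero divide_pos_pos real_norm_def zero_less_numeral)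
  define h where "h = h0"
  obtain G where G: "\<And>x. x \<in> cball p r \<Longrightarrow> continuous_on {v::'a. \<forall>b\<in>B. l b v \<in> {0..h}} (\<lambda>v. G v x)"
    "\<And>x v. x \<in> cball p r \<Longrightarrow> \<forall>b\<in>B. l b v \<in> {0..h} \<Longrightarrow> R x (G v x)"
    "\<And>x v. x \<in> cball p r \<Longrightarrow> \<forall>b\<in>B. l b v \<in> {0..h} \<Longrightarrow>
      norm (G v x - (x + (\<Sum>b\<in>B. l b v *\<^sub>R X b x))) \<le> c / 3 * h"
    using EG[of h] h0 unfolding h_def by blast
  have hpos: "0 < h" using h0 by (simp add: h_def)
  define v0 where "v0 = (\<Sum>b\<in>B. (h / 2) *\<^sub>R b)"
  have lv0: "l b v0 = h / 2" if "b \<in> B" for b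
  proof -
    have "l b v0 = (\<Sum>b'\<in>B. (h / 2) * l b b')"
      unfolding v0_def using lin[of b] by (simp add: linear_sum linear_scale)
    also have "\<dots> = (\<Sum>b'\<in>B. if b' = b then h / 2 else 0)"
      by (intro sum.cong refl) (auto simp: l_def representation_basis[OF B(2)])
    finally show ?thesis using that fin by simp
  qed
  have box: "\<forall>b\<in>B. l b v \<in> {0..h}" if "v \<in> cball v0 (c * h)" for v
  proof
    fix b assume b: "b \<in> B"
    have "\<bar>l b v - l b v0\<bar> \<le> D * norm (v - v0)"
      using lD[OF b, of "v - v0"] lin[of b] by (simp add: linear_diff)
    also have "\<dots> \<le> D * (c * h)"
      using that D by (intro mult_left_mono) (auto simp: dist_norm norm_minus_commute)
    finally have "\<bar>l b v - h / 2\<bar> \<le> h / 2" using c(2) lv0[OF b] by (simp add: mult.assoc[symmetric])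
    then show "l b v \<in> {0..h}" unfolding abs_le_iff atLeastAtMost_iff by linarith
  qed
  \<comment> \<open>Of the total error \<open>c * h\<close> one third each is granted to the map
    \<open>G\<close>, to the displacement \<open>x - p\<close>, and to the variation of the fields
    between \<open>p\<close> and \<open>x\<close>.\<close>
  define d where "d = Min {r, d1, c / 3 * h}"
  have d: "0 < d" "d \<le> r" "d \<le> d1" "d \<le> c / 3 * h" using r d1(1) c(1) hpos by (auto simp: d_def)
  have hit: "R x (p + v0)" if x: "x \<in> ball p d" for x
  proof -
    have xr: "x \<in> cball p r" using x d by auto
    have app: "norm (G v x - (p + v)) \<le> c * h" if v: "v \<in> cball v0 (c * h)" for v
    proof -
      let ?S = "\<Sum>b\<in>B. l b v *\<^sub>R X b x"
      \<comment> \<open>\<open>v\<close> is expanded in the basis \<open>B\<close>, whose elements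
        are the values \<open>X b p\<close>.\<close>
      have "norm (?S - v) = norm (\<Sum>b\<in>B. l b v *\<^sub>R (X b x - b))"
        by (subst (2) sum[of v, symmetric]) (simp add: scaleR_diff_right sum_subtractf)
      also have "\<dots> \<le> (\<Sum>b\<in>B. h * norm (X b x - b))"
        using box[OF v] by (intro order.trans[OF norm_sum] sum_mono) (auto intro!: mult_right_mono)
      also have "\<dots> \<le> h * (c / 3)"
        using d1(2)[of x] x d hpos by (simp add: sum_distrib_left[symmetric] dist_commute)
      finally have 1: "norm (?S - v) \<le> c / 3 * h" by (simp add: mult.commute)
      have 2: "norm (x - p) \<le> c / 3 * h" using x d by (simp add: dist_norm norm_minus_commute)
      have "G v x - (p + v) = (G v x - (x + ?S)) + (x - p) + (?S - v) - 0" by simp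
      then have "norm (G v x - (p + v)) \<le> norm (G v x - (x + ?S)) + norm (x - p) + norm (?S - v) + norm (0::'a)"
        by (metis norm_triangle_4)
      also have "\<dots> \<le> c / 3 * h + c / 3 * h + c / 3 * h + 0"
        by (intro add_mono G(3)[OF xr box[OF v]] 1 2) simp
      finally show ?thesis by simp
    qed
    \<comment> \<open>A fixed point \<open>v\<close> satisfies \<open>G v x = p + v0\<close>. The
      ball is mapped into itself because \<open>\<Phi> v - v0\<close> is the error
      \<open>p + v - G v x\<close>, of norm at most \<open>c * h\<close>.\<close>
    define \<Phi> where "\<Phi> v = v0 + (v - (G v x - p))" for v
    have cont: "continuous_on (cball v0 (c * h)) \<Phi>"
      unfolding \<Phi>_def
      by (intro continuous_intros continuous_on_subset[OF G(1)[OF xr]]) (use box in blast)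
    have maps: "\<Phi> \<in> cball v0 (c * h) \<rightarrow> cball v0 (c * h)"
    proof
      fix v assume "v \<in> cball v0 (c * h)"
      then show "\<Phi> v \<in> cball v0 (c * h)"
        using app[of v] by (simp add: \<Phi>_def dist_norm norm_minus_commute algebra_simps)
    qed
    have "cball v0 (c * h) \<noteq> {}" using mult_pos_pos[OF c(1) hpos] by simp
    then obtain v where v: "v \<in> cball v0 (c * h)" "\<Phi> v = v"
      by (rule brouwer[OF compact_cball convex_cball _ cont maps]) (rule that)
    have "G v x = p + v0" using v(2) by (simp add: \<Phi>_def algebra_simps)
    then show ?thesis using G(2)[OF xr box[OF v(1)]] by simp
  qed
  show ?thesis
  proof (rule that[OF d(1)])
    fix x assume "x \<in> ball p d"
    then have "R x (p + v0)" "R p (p + v0)" using hit d(1) by auto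
    then show "R p x" using R(2,3) by (meson sympD transpD)
  qed
qed

lemma orbit_connected:
  fixes U :: "'a::euclidean_space set"
  assumes R: "reflp R" "symp R" "transp R" and U: "open U" "connected U" "a \<in> U" "b \<in> U"
    and F: "\<And>f. f \<in> F \<Longrightarrow> smooth f"
      "\<And>f p. f \<in> F \<Longrightarrow> p \<in> U \<Longrightarrow> euler_approximable R f p"
      "\<And>f p. f \<in> F \<Longrightarrow> p \<in> U \<Longrightarrow> euler_approximable R (\<lambda>x. - f x) p"
    and chow: "chow_hypothesis F"
  shows "R a b"
proof (rule connected_equivalence_relation[OF U(2,3,4)])
  show "R x y \<Longrightarrow> R y x" for x y using R(2) by (rule sympD)
  show "R x y \<Longrightarrow> R y z \<Longrightarrow> R x z" for x y z using R(3) by (rule transpD)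
  fix p assume p: "p \<in> U"
  obtain d where d: "0 < d" "\<And>x. x \<in> ball p d \<Longrightarrow> R p x"
    by (rule orbit_neighbourhood[OF R F(1) F(2)[OF _ p] F(3)[OF _ p]])
      (use chow in \<open>auto simp: chow_hypothesis_def\<close>)
  show "\<exists>T. openin (top_of_set U) T \<and> p \<in> T \<and> (\<forall>x\<in>T. R p x)"
    using d p U(1) by (intro exI[of _ "U \<inter> ball p d"]) (auto intro!: openin_open_Int)
qed

section \<open>Concatenation of relay trajectories\<close>

lemma lipschitz_imp_absolutely_continuous:
  assumes "L-lipschitz_on {a..b} f"
  shows "absolutely_continuous_on a b f"
  unfolding absolutely_continuous_on_def
proof (intro allI impI)
  fix \<epsilon> :: real assume \<epsilon>: "\<epsilon> > 0"
  have L: "L \<ge> 0" using assms by (rule lipschitz_on_nonneg)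
  show "\<exists>\<delta>>0. \<forall>(N::nat) s t. (\<forall>k<N. a \<le> s k \<and> s k \<le> t k \<and> t k \<le> b) \<longrightarrow>
      disjoint_family_on (\<lambda>k. {s k<..<t k}) {..<N} \<longrightarrow>
      (\<Sum>k<N. t k - s k) < \<delta> \<longrightarrow> (\<Sum>k<N. norm (f (t k) - f (s k))) < \<epsilon>"
  proof (rule exI[of _ "\<epsilon> / (L + 1)"], intro conjI allI impI)
    show "0 < \<epsilon> / (L + 1)" using L \<epsilon> by simp
    fix N :: nat and s t :: "nat \<Rightarrow> real"
    assume st: "\<forall>k<N. a \<le> s k \<and> s k \<le> t k \<and> t k \<le> b" and small: "(\<Sum>k<N. t k - s k) < \<epsilon> / (L + 1)"
    have "(\<Sum>k<N. norm (f (t k) - f (s k))) \<le> (\<Sum>k<N. (L + 1) * (t k - s k))"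
    proof (rule sum_mono)
      fix k assume "k \<in> {..<N}"
      then have k: "a \<le> s k" "s k \<le> t k" "t k \<le> b" using st by auto
      have "norm (f (t k) - f (s k)) \<le> L * (t k - s k)"
        using lipschitz_onD[OF assms, of "t k" "s k"] k by (auto simp: dist_norm)
      then show "norm (f (t k) - f (s k)) \<le> (L + 1) * (t k - s k)"
        using k by (simp add: algebra_simps)
    qed
    also have "\<dots> = (L + 1) * (\<Sum>k<N. t k - s k)"
      by (rule sum_distrib_left[symmetric])
    also have "\<dots> < \<epsilon>"
      using small L by (simp add: pos_less_divide_eq mult.commute)
    finally show "(\<Sum>k<N. norm (f (t k) - f (s k))) < \<epsilon>" .
  qed
qed

text \<open>The junction \<open>S\<close> joins the exceptional points; an open interval that avoids
  it lies on one side, where only one of the two functions matters.\<close>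

lemma piecewise_constant_on_concat:
  assumes f: "piecewise_constant_on 0 S f" and h: "piecewise_constant_on 0 T h"
  shows "piecewise_constant_on 0 (S + T) (\<lambda>t. if t \<le> S then f t else h (t - S))"
proof -
  let ?k = "\<lambda>t. if t \<le> S then f t else h (t - S)"
  obtain P where P: "finite P" "\<And>s t. {s<..<t} \<subseteq> {0..S} - P \<Longrightarrow> f constant_on {s<..<t}"
    using f unfolding piecewise_constant_on_def by blast
  obtain Q where Q: "finite Q" "\<And>s t. {s<..<t} \<subseteq> {0..T} - Q \<Longrightarrow> h constant_on {s<..<t}"
    using h unfolding piecewise_constant_on_def by blast
  have "?k constant_on {s<..<t}"
    if sub: "{s<..<t} \<subseteq> {0..S + T} - (insert S (P \<union> (\<lambda>x. x + S) ` Q))" for s t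
  proof (cases "s < t")
    case st: True
    have "S \<notin> {s<..<t}" using sub by auto
    then consider "t \<le> S" | "S \<le> s" by fastforce
    then show ?thesis
    proof cases
      case 1
      have "{s<..<t} \<subseteq> {0..S} - P" using sub 1 by auto
      from P(2)[OF this] show ?thesis
        using 1 unfolding constant_on_def by auto
    next
      case 2
      have "{s - S<..<t - S} \<subseteq> {0..T} - Q"
      proof
        fix x assume "x \<in> {s - S<..<t - S}"
        then have "x + S \<in> {s<..<t}" by auto
        then have "x + S \<in> {0..S + T} - (insert S (P \<union> (\<lambda>x. x + S) ` Q))" using sub by blast
        then show "x \<in> {0..T} - Q" using \<open>x + S \<in> {s<..<t}\<close> 2 by auto
      qed
      from Q(2)[OF this] obtain c where "\<And>x. x \<in> {s - S<..<t - S} \<Longrightarrow> h x = c"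
        unfolding constant_on_def by blast
      then show ?thesis
        using 2 unfolding constant_on_def by (intro exI[of _ c]) auto
    qed
  qed (auto simp: constant_on_def)
  then show ?thesis
    unfolding piecewise_constant_on_def using P(1) Q(1)
    by (intro exI[of _ "insert S (P \<union> (\<lambda>x. x + S) ` Q)"]) auto
qed

lemma piecewise_constant_on_const_after: "piecewise_constant_on 0 T (\<lambda>t. if t \<le> 0 then c else d)"
  unfolding piecewise_constant_on_def constant_on_def
  by (intro exI[of _ "{0}"]) (auto intro!: exI[of _ d])

lemma in_sector_iff: "z \<in> sector \<eta> \<xi> \<omega> \<longleftrightarrow> (\<forall>i. \<not> beyond_threshold \<eta> (\<omega> i) (z \<bullet> \<xi> i))"
  by (auto simp: sector_def beyond_threshold_def not_less)

lemma closed_sector: "closed (sector \<eta> \<xi> \<omega>)"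
proof -
  have "sector \<eta> \<xi> \<omega> = (\<Inter>i. {z. \<omega> i = 1 \<longrightarrow> - \<eta> \<le> z \<bullet> \<xi> i} \<inter> {z. \<omega> i = -1 \<longrightarrow> z \<bullet> \<xi> i \<le> \<eta>})"
    by (auto simp: sector_def)
  then show ?thesis
    by (auto intro!: closed_INT closed_Int closed_Collect_imp closed_Collect_le continuous_intros)
qed

lemma forced_to_cross_iff:
  "forced_to_cross \<eta> \<xi> g a x \<omega> i \<longleftrightarrow>
    (\<exists>\<delta>>0. \<exists>y. y 0 = x \<and> solves_ode (velocity g \<omega> a) \<delta> y \<and>
      (\<exists>\<^sub>F s in at_right 0. beyond_threshold \<eta> (\<omega> i) (y s \<bullet> \<xi> i)))"
  unfolding forced_to_cross_def solves_ode_def ..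

text \<open>Compared with \<open>relay_solution\<close>, the final state is recorded, \<open>z\<close> is Lipschitz, and the
  differential equation may fail at finitely many times only, which makes concatenation easy.\<close>

definition steers ::
  "real \<Rightarrow> ('m::finite \<Rightarrow> real^'n) \<Rightarrow> ('m \<Rightarrow> int \<Rightarrow> real^'n \<Rightarrow> real^'n) \<Rightarrow>
   real \<Rightarrow> ('m \<Rightarrow> real \<Rightarrow> real) \<Rightarrow> real^'n \<Rightarrow> ('m \<Rightarrow> int) \<Rightarrow> (real \<Rightarrow> real^'n) \<Rightarrow> ('m \<Rightarrow> real \<Rightarrow> int) \<Rightarrow>
   real^'n \<Rightarrow> ('m \<Rightarrow> int) \<Rightarrow> bool" where
  "steers \<eta> \<xi> g T u x0 w0 z w x1 w1 \<longleftrightarrow>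
    0 \<le> T \<and> z 0 = x0 \<and> z T = x1 \<and> (\<forall>i. w i 0 = w0 i) \<and> (\<forall>i. w i T = w1 i) \<and>
    (\<forall>i. piecewise_constant_on 0 T (u i)) \<and> (\<forall>i. piecewise_constant_on 0 T (w i)) \<and>
    (\<exists>L. L-lipschitz_on {0..T} z) \<and>
    (\<forall>t\<in>{0..T}. (\<lambda>i. w i t) \<in> strings) \<and>
    (\<exists>P. finite P \<and> (\<forall>t\<in>{0..T} - P.
      (z has_vector_derivative velocity g (\<lambda>i. w i t) (\<lambda>i. u i t) (z t)) (at t))) \<and>
    (\<forall>t\<in>{0<..T}. \<forall>\<^sub>F s in at_left t. \<forall>i. w i s = w i t) \<and>
    (\<forall>t\<in>{0..<T}. \<exists>a \<omega> k.
      (\<forall>\<^sub>F s in at_right t. \<forall>i. u i s = a i \<and> w i s = \<omega> i) \<and>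
      \<omega> = (switch \<eta> \<xi> g a (z t) ^^ k) (\<lambda>i. w i t) \<and>
      switch \<eta> \<xi> g a (z t) \<omega> = \<omega>)"

lemma steers_switchE:
  assumes "steers \<eta> \<xi> g T u x0 w0 z w x1 w1" and t: "t \<in> {0..<T}"
  obtains a \<omega> k where "\<forall>\<^sub>F s in at_right t. \<forall>i. u i s = a i \<and> w i s = \<omega> i"
    "\<omega> = (switch \<eta> \<xi> g a (z t) ^^ k) (\<lambda>i. w i t)" "switch \<eta> \<xi> g a (z t) \<omega> = \<omega>"
proof -
  have "\<forall>t\<in>{0..<T}. \<exists>a \<omega> k. (\<forall>\<^sub>F s in at_right t. \<forall>i. u i s = a i \<and> w i s = \<omega> i) \<and>
      \<omega> = (switch \<eta> \<xi> g a (z t) ^^ k) (\<lambda>i. w i t) \<and> switch \<eta> \<xi> g a (z t) \<omega> = \<omega>"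
    using assms(1) unfolding steers_def by (elim conjE)
  from bspec[OF this t] show ?thesis
    by (elim exE conjE) (rule that)
qed

lemma relay_solution_if_steers:
  assumes "steers \<eta> \<xi> g T u x0 w0 z w x1 w1"
  shows "relay_solution \<eta> \<xi> g T u x0 w0 z w"
proof -
  obtain P where P: "finite P" "\<forall>t\<in>{0..T} - P.
      (z has_vector_derivative velocity g (\<lambda>i. w i t) (\<lambda>i. u i t) (z t)) (at t)"
    using assms unfolding steers_def by blast
  have "AE t in lborel. t \<notin> P"
    by (rule AE_not_in) (rule finite_imp_null_set_lborel[OF P(1)])
  then have "AE t in lborel. t \<in> {0..T} \<longrightarrow>
      (z has_vector_derivative velocity g (\<lambda>i. w i t) (\<lambda>i. u i t) (z t)) (at t)"
    by eventually_elim (use P(2) in blast)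
  then show ?thesis
    using assms lipschitz_imp_absolutely_continuous unfolding steers_def relay_solution_def by blast
qed

text \<open>At the junction the first piece supplies the behaviour to the left and the second the
  switching rule to the right; they fit because the second starts with the final string of the
  first, any switch at that instant being left to the second. The velocity may jump there, so
  \<open>S\<close> becomes an exceptional time.\<close>

lemma steers_concat:
  assumes 1: "steers \<eta> \<xi> g S u x0 w0 z w x1 w1" and 2: "steers \<eta> \<xi> g T u' x1 w1 z' w' x2 w2"
  shows "steers \<eta> \<xi> g (S + T) (\<lambda>i t. if t \<le> S then u i t else u' i (t - S)) x0 w0
    (\<lambda>t. if t \<le> S then z t else z' (t - S)) (\<lambda>i t. if t \<le> S then w i t else w' i (t - S)) x2 w2"
    (is "steers _ _ _ _ ?u _ _ ?z ?w _ _")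
proof -
  have S: "0 \<le> S" and T: "0 \<le> T" using 1 2 by (auto simp: steers_def)
  have zS: "z S = z' 0" and wS: "w i S = w' i 0" for i using 1 2 by (auto simp: steers_def)
  have ends: "?z 0 = x0" "?z (S + T) = x2" "\<forall>i. ?w i 0 = w0 i" "\<forall>i. ?w i (S + T) = w2 i"
    using 1 2 S T by (auto simp: steers_def dest: order.antisym)
  have pc: "\<forall>i. piecewise_constant_on 0 (S + T) (?u i)" "\<forall>i. piecewise_constant_on 0 (S + T) (?w i)"
    using 1 2 unfolding steers_def by (blast intro: piecewise_constant_on_concat)+
  obtain L M where L: "L-lipschitz_on {0..S} z" and M: "M-lipschitz_on {0..T} z'"
    using 1 2 unfolding steers_def by blast
  have "M-lipschitz_on {S..S + T} (\<lambda>t. z' (t - S))"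
  proof (rule lipschitz_onI)
    show "dist (z' (x - S)) (z' (y - S)) \<le> M * dist x y" if "x \<in> {S..S + T}" "y \<in> {S..S + T}" for x y
      using lipschitz_onD[OF M, of "x - S" "y - S"] that by (simp add: dist_real_def)
  qed (rule lipschitz_on_nonneg[OF M])
  then have lip: "\<exists>L. L-lipschitz_on {0..S + T} ?z"
    using lipschitz_on_concat_max[OF L] zS by fastforce
  have str: "\<forall>t\<in>{0..S + T}. (\<lambda>i. ?w i t) \<in> strings"
  proof
    fix t assume t: "t \<in> {0..S + T}"
    show "(\<lambda>i. ?w i t) \<in> strings"
    proof (cases "t \<le> S")
      case True
      then show ?thesis using 1 t by (simp add: steers_def)
    next
      case False
      then have "t - S \<in> {0..T}" using t by simp
      then show ?thesis using 2 False by (simp add: steers_def)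
    qed
  qed
  obtain P where P: "finite P" "\<And>t. t \<in> {0..S} - P \<Longrightarrow>
      (z has_vector_derivative velocity g (\<lambda>i. w i t) (\<lambda>i. u i t) (z t)) (at t)"
    using 1 unfolding steers_def by blast
  obtain Q where Q: "finite Q" "\<And>t. t \<in> {0..T} - Q \<Longrightarrow>
      (z' has_vector_derivative velocity g (\<lambda>i. w' i t) (\<lambda>i. u' i t) (z' t)) (at t)"
    using 2 unfolding steers_def by blast
  have der: "(?z has_vector_derivative velocity g (\<lambda>i. ?w i t) (\<lambda>i. ?u i t) (?z t)) (at t)"
    if t: "t \<in> {0..S + T} - (insert S (P \<union> (\<lambda>x. x + S) ` Q))" for t
  proof (cases "t < S")
    case True
    have "(z has_vector_derivative velocity g (\<lambda>i. w i t) (\<lambda>i. u i t) (z t)) (at t)"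
      using P(2) t True by auto
    then have "(?z has_vector_derivative velocity g (\<lambda>i. w i t) (\<lambda>i. u i t) (z t)) (at t)"
      by (rule has_vector_derivative_transform_within_open[of _ _ _ "{..<S}"]) (use True in auto)
    then show ?thesis using True by simp
  next
    case False
    then have tS: "S < t" using t by auto
    have "t - S \<in> {0..T} - Q" using t tS by (auto simp: image_iff)
    then have "(z' has_vector_derivative velocity g (\<lambda>i. w' i (t - S)) (\<lambda>i. u' i (t - S)) (z' (t - S))) (at (t - S))"
      by (rule Q(2))
    moreover have "((\<lambda>t. t - S) has_vector_derivative 1) (at t)"
      by (auto intro!: derivative_eq_intros)
    ultimately have "((\<lambda>t. z' (t - S)) has_vector_derivative
        velocity g (\<lambda>i. w' i (t - S)) (\<lambda>i. u' i (t - S)) (z' (t - S))) (at t)"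
      using vector_diff_chain_at[of "\<lambda>t. t - S" 1 t z'] by (simp add: o_def)
    then have "(?z has_vector_derivative
        velocity g (\<lambda>i. w' i (t - S)) (\<lambda>i. u' i (t - S)) (z' (t - S))) (at t)"
      by (rule has_vector_derivative_transform_within_open[of _ _ _ "{S<..}"]) (use tS in auto)
    then show ?thesis using tS by simp
  qed
  have left: "\<forall>\<^sub>F s in at_left t. \<forall>i. ?w i s = ?w i t" if t: "t \<in> {0<..S + T}" for t
  proof (cases "t \<le> S")
    case True
    then have "\<forall>\<^sub>F s in at_left t. \<forall>i. w i s = w i t" using 1 t by (simp add: steers_def)
    then show ?thesis
      unfolding eventually_at_left_field using True by auto
  next
    case False
    then have "t - S \<in> {0<..T}" using t by auto
    then have "\<forall>\<^sub>F s in at_left (t - S). \<forall>i. w' i s = w' i (t - S)" using 2 by (simp add: steers_def)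
    then obtain b where "b < t - S" "\<And>s. b < s \<Longrightarrow> s < t - S \<Longrightarrow> \<forall>i. w' i s = w' i (t - S)"
      unfolding eventually_at_left_field by blast
    then show ?thesis
      unfolding eventually_at_left_field using False by (intro exI[of _ "max S (b + S)"]) auto
  qed
  have right: "\<exists>a \<omega> k. (\<forall>\<^sub>F s in at_right t. \<forall>i. ?u i s = a i \<and> ?w i s = \<omega> i) \<and>
      \<omega> = (switch \<eta> \<xi> g a (?z t) ^^ k) (\<lambda>i. ?w i t) \<and> switch \<eta> \<xi> g a (?z t) \<omega> = \<omega>"
    if t: "t \<in> {0..<S + T}" for t
  proof (cases "t < S")
    case True
    then have tS: "t \<in> {0..<S}" using t by auto
    then obtain a \<omega> k where *: "\<forall>\<^sub>F s in at_right t. \<forall>i. u i s = a i \<and> w i s = \<omega> i"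
      "\<omega> = (switch \<eta> \<xi> g a (z t) ^^ k) (\<lambda>i. w i t)" "switch \<eta> \<xi> g a (z t) \<omega> = \<omega>"
      by (rule steers_switchE[OF 1]) (rule that)
    then obtain b where "t < b" "\<And>s. t < s \<Longrightarrow> s < b \<Longrightarrow> \<forall>i. u i s = a i \<and> w i s = \<omega> i"
      unfolding eventually_at_right_field by blast
    then have ev: "\<forall>\<^sub>F s in at_right t. \<forall>i. ?u i s = a i \<and> ?w i s = \<omega> i"
      unfolding eventually_at_right_field using True by (intro exI[of _ "min S b"]) auto
    have eqs: "?z t = z t" "(\<lambda>i. ?w i t) = (\<lambda>i. w i t)" using True by auto
    show ?thesis unfolding eqs using ev *(2,3) by blast
  next
    case False
    then have tS: "t - S \<in> {0..<T}" using t by auto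
    then obtain a \<omega> k where *: "\<forall>\<^sub>F s in at_right (t - S). \<forall>i. u' i s = a i \<and> w' i s = \<omega> i"
      "\<omega> = (switch \<eta> \<xi> g a (z' (t - S)) ^^ k) (\<lambda>i. w' i (t - S))" "switch \<eta> \<xi> g a (z' (t - S)) \<omega> = \<omega>"
      by (rule steers_switchE[OF 2]) (rule that)
    then obtain b where "t - S < b" "\<And>s. t - S < s \<Longrightarrow> s < b \<Longrightarrow> \<forall>i. u' i s = a i \<and> w' i s = \<omega> i"
      unfolding eventually_at_right_field by blast
    then have ev: "\<forall>\<^sub>F s in at_right t. \<forall>i. ?u i s = a i \<and> ?w i s = \<omega> i"
      unfolding eventually_at_right_field using False by (intro exI[of _ "b + S"]) auto
    \<comment> \<open>At \<open>t = S\<close> the concatenation takes the final values of the first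
      piece, which are the initial values of the second.\<close>
    have eqs: "?z t = z' (t - S)" "(\<lambda>i. ?w i t) = (\<lambda>i. w' i (t - S))"
      using False zS wS by (auto simp: not_less le_less)
    show ?thesis unfolding eqs using ev *(2,3) by blast
  qed
  show ?thesis
    unfolding steers_def
    using S T ends pc lip str left right der P(1) Q(1)
    by (intro conjI ballI exI[of _ "insert S (P \<union> (\<lambda>x. x + S) ` Q)"]) (simp_all only: add_nonneg_nonneg finite_insert finite_Un finite_imageI simp_thms)
qed

section \<open>Controllability of the relay system\<close>

text \<open>Makes room for trajectories of length 0, on which reflexivity of \<open>reaches\<close>
  rests: a singleton contains no nonempty open interval.\<close>

lemma piecewise_constant_on_point: "piecewise_constant_on 0 0 f"
  unfolding piecewise_constant_on_def constant_on_def
proof (intro exI[of _ "{}"] conjI allI impI)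
  fix s t :: real assume sub: "{s<..<t} \<subseteq> {0..0} - {}"
  have "\<not> s < t"
  proof
    assume st: "s < t"
    then obtain m where m: "s < m" "m < t" using dense by blast
    then obtain m' where "m < m'" "m' < t" using dense by blast
    then have "m \<in> {0..0}" "m' \<in> {0..0}" using m sub[THEN subsetD, of m] sub[THEN subsetD, of m'] by auto
    then show False using \<open>m < m'\<close> by simp
  qed
  then show "\<exists>y. \<forall>x\<in>{s<..<t}. f x = y" by simp
qed simp

locale relay_system =
  fixes \<eta> :: real and \<xi> :: "'m::finite \<Rightarrow> real^'n" and g :: "'m \<Rightarrow> int \<Rightarrow> real^'n \<Rightarrow> real^'n"
  assumes eta_pos: "\<eta> > 0"
    and norm_xi: "\<And>i. norm (\<xi> i) = 1"
    and smooth_g: "\<And>i \<sigma>. \<sigma> \<in> {-1, 1} \<Longrightarrow> smooth (g i \<sigma>)"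
    and chow: "\<And>\<omega>. \<omega> \<in> strings \<Longrightarrow> chow_hypothesis (range (\<lambda>i. g i (\<omega> i)))"
begin

text \<open>The state is a point together with a string. Membership in the sector of the final
  string is recorded because a further segment has to start from such a state.\<close>

definition reaches :: "real^'n \<Rightarrow> ('m \<Rightarrow> int) \<Rightarrow> real^'n \<Rightarrow> ('m \<Rightarrow> int) \<Rightarrow> bool" where
  "reaches x0 w0 x1 w1 \<longleftrightarrow> x1 \<in> sector \<eta> \<xi> w1 \<and> w1 \<in> strings \<and>
    (\<exists>T u z w. steers \<eta> \<xi> g T u x0 w0 z w x1 w1)"

lemma reaches_trans:
  assumes "reaches x w x' w'" and "reaches x' w' x'' w''"
  shows "reaches x w x'' w''"
proof -
  obtain S u z v where 1: "steers \<eta> \<xi> g S u x w z v x' w'"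
    using assms(1) unfolding reaches_def by blast
  obtain T u' z' v' where 2: "steers \<eta> \<xi> g T u' x' w' z' v' x'' w''"
    using assms(2) unfolding reaches_def by blast
  show ?thesis
    using assms(2) steers_concat[OF 1 2] unfolding reaches_def by blast
qed

lemma reaches_refl:
  assumes "x \<in> sector \<eta> \<xi> w" "w \<in> strings"
  shows "reaches x w x w"
proof -
  have "steers \<eta> \<xi> g 0 (\<lambda>i t. 0) x w (\<lambda>t. x) (\<lambda>i t. w i) x w"
    unfolding steers_def using assms(2)
    by (auto intro!: piecewise_constant_on_point exI[of _ 0] exI[of _ "{0}"] lipschitz_onI)
  then show ?thesis unfolding reaches_def using assms by blast
qed

section \<open>Motion in a single mode\<close>

lemma smooth_velocity:
  assumes "\<omega> \<in> strings"
  shows "smooth (velocity g \<omega> a)"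
proof -
  have "Ck k (velocity g \<omega> a)" for k
    unfolding velocity_def[abs_def]
    using assms smooth_imp_Ck[OF smooth_g]
    by (intro Ck_sum Ck_bounded_linear[OF bounded_linear_scaleR_right]) (simp add: strings_def)
  then show ?thesis by (simp add: smooth_def)
qed

text \<open>\<open>forced_to_cross\<close> quantifies over hypothetical motions; by local uniqueness
  any of them agrees for a short time with \<open>y\<close>, which stays in the sector.\<close>

lemma not_forced_to_cross:
  assumes w: "\<omega> \<in> strings" and y: "solves_ode (velocity g \<omega> a) T y" and T: "0 < T"
    and sec: "\<And>s. s \<in> {0..T} \<Longrightarrow> y s \<in> sector \<eta> \<xi> \<omega>"
  shows "\<not> forced_to_cross \<eta> \<xi> g a (y 0) \<omega> i"
proof
  assume "forced_to_cross \<eta> \<xi> g a (y 0) \<omega> i"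
  then obtain d y' where d: "0 < d" and y': "y' 0 = y 0" "solves_ode (velocity g \<omega> a) d y'"
    and fr: "\<exists>\<^sub>F s in at_right 0. beyond_threshold \<eta> (\<omega> i) (y' s \<bullet> \<xi> i)"
    unfolding forced_to_cross_iff by blast
  let ?d = "min d T"
  have "Ck 1 (velocity g \<omega> a)" using smooth_velocity[OF w] by (rule smooth_imp_Ck)
  then obtain e where e: "0 < e" "e \<le> ?d" "\<And>s. s \<in> {0..e} \<Longrightarrow> y' s = y s"
    by (rule solves_ode_local_unique[OF _ solves_ode_subset[OF y'(2), of ?d] solves_ode_subset[OF y, of ?d]])
      (use d T y' in auto)
  have "\<not> beyond_threshold \<eta> (\<omega> i) (y' s \<bullet> \<xi> i)" if "0 < s" "s < e" for s
    using sec[of s] e that by (simp add: in_sector_iff)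
  then have "\<forall>\<^sub>F s in at_right 0. \<not> beyond_threshold \<eta> (\<omega> i) (y' s \<bullet> \<xi> i)"
    unfolding eventually_at_right_field using e(1) by blast
  then show False using fr by (simp add: frequently_def)
qed

text \<open>The string is \<open>\<omega>\<close> at time 0 only and \<open>\<omega>'\<close>
  afterwards, in keeping with left continuity, so a cascade of \<open>k\<close> switches fits into
  the starting instant. From then on \<open>\<omega>'\<close> is stable: after any time the rest of
  \<open>y\<close> still runs in the sector, and \<open>not_forced_to_cross\<close> applies to
  it.\<close>

lemma steers_segment:
  assumes w: "\<omega> \<in> strings" "\<omega>' \<in> strings" and k: "\<omega>' = (switch \<eta> \<xi> g a (y 0) ^^ k) \<omega>"
    and y: "solves_ode (velocity g \<omega>' a) T y" and T: "0 < T"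
    and sec: "\<And>s. s \<in> {0..T} \<Longrightarrow> y s \<in> sector \<eta> \<xi> \<omega>'"
  shows "steers \<eta> \<xi> g T (\<lambda>i t. a i) (y 0) \<omega> y (\<lambda>i t. if t \<le> 0 then \<omega> i else \<omega>' i) (y T) \<omega>'"
proof -
  let ?w = "\<lambda>i t. if t \<le> 0 then \<omega> i else \<omega>' i"
  let ?V = "velocity g \<omega>' a"
  have pcu: "piecewise_constant_on 0 T (\<lambda>t. a i)" for i
    unfolding piecewise_constant_on_def constant_on_def by blast
  have "continuous_on UNIV ?V"
    using smooth_imp_Ck[OF smooth_velocity[OF w(2)], of 0] by simp
  then have "continuous_on {0..T} (\<lambda>s. ?V (y s))"
    by (rule continuous_on_compose2[OF _ solves_ode_continuous_on[OF y]]) simp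
  then obtain M where M: "M \<ge> 0" "\<And>s. s \<in> {0..T} \<Longrightarrow> norm (?V (y s)) \<le> M"
    by (rule compact_continuous_norm_bound[OF compact_Icc]) (rule that)
  have "M-lipschitz_on {0..T} y"
    by (rule lipschitz_onI)
      (use M vector_derivative_dist_bound[OF solves_odeD[OF y] M(2)] in \<open>auto simp: dist_norm\<close>)
  then have lip: "\<exists>L. L-lipschitz_on {0..T} y" by blast
  have der: "(y has_vector_derivative velocity g (\<lambda>i. ?w i t) (\<lambda>i. a i) (y t)) (at t)"
    if "t \<in> {0..T} - {0, T}" for t
  proof -
    have t: "0 < t" "t < T" using that by auto
    have "(y has_vector_derivative ?V (y t)) (at t within {0..T})" using y t by (intro solves_odeD) auto
    then show ?thesis using t by (simp add: at_within_Icc_at)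
  qed
  have str: "(\<lambda>i. ?w i t) \<in> strings" for t
    using w by (cases "t \<le> 0") simp_all
  have left: "\<forall>\<^sub>F s in at_left t. \<forall>i. ?w i s = ?w i t" if "t \<in> {0<..T}" for t
    unfolding eventually_at_left_field using that by (intro exI[of _ 0]) auto
  have nf: "switch \<eta> \<xi> g a (y t) \<omega>' = \<omega>'" if t: "t \<in> {0..<T}" for t
  proof -
    have "\<not> forced_to_cross \<eta> \<xi> g a (y (t + 0)) \<omega>' i" for i
      by (rule not_forced_to_cross[OF w(2) solves_ode_shift[OF y, of t "T - t"]]) (use t sec in auto)
    then show ?thesis by (simp add: switch_def)
  qed
  have right: "\<exists>b \<omega>'' k. (\<forall>\<^sub>F s in at_right t. \<forall>i. a i = b i \<and> ?w i s = \<omega>'' i) \<and>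
      \<omega>'' = (switch \<eta> \<xi> g b (y t) ^^ k) (\<lambda>i. ?w i t) \<and> switch \<eta> \<xi> g b (y t) \<omega>'' = \<omega>''"
    if t: "t \<in> {0..<T}" for t
  proof -
    have "\<forall>\<^sub>F s in at_right t. \<forall>i. a i = a i \<and> ?w i s = \<omega>' i"
      unfolding eventually_at_right_field using t by (intro exI[of _ "t + 1"]) auto
    moreover have "\<exists>k. \<omega>' = (switch \<eta> \<xi> g a (y t) ^^ k) (\<lambda>i. ?w i t)"
    proof (cases "t = 0")
      case True
      then show ?thesis using k by auto
    next
      case False
      then show ?thesis using t by (intro exI[of _ 0]) auto
    qed
    ultimately show ?thesis using nf[OF t] by blast
  qed
  show ?thesis
    unfolding steers_def
    using T
    by (intro conjI ballI allI pcu piecewise_constant_on_const_after lip str left right exI[of _ "{0, T}"] der) auto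
qed

text \<open>The relays that can still switch in \<open>U\<close>; their number is the measure that decreases with
  every switch.\<close>

definition switchable :: "(real^'n) set \<Rightarrow> ('m \<Rightarrow> int) \<Rightarrow> 'm set" where
  "switchable U \<omega> = {i. \<exists>x\<in>U. beyond_threshold \<eta> (\<omega> i) (x \<bullet> \<xi> i)}"

text \<open>If the input were strictly on the admissible side of the threshold, continuity would
  keep it there for a short time. For the second claim, points of the motion beyond the threshold
  occur at arbitrarily small times, hence inside the open set \<open>U\<close>.\<close>

lemma at_threshold_if_forced_to_cross:
  assumes "forced_to_cross \<eta> \<xi> g a x \<omega> i"
  shows "(\<omega> i = 1 \<and> x \<bullet> \<xi> i \<le> - \<eta>) \<or> (\<omega> i = -1 \<and> \<eta> \<le> x \<bullet> \<xi> i)"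
    and "open U \<Longrightarrow> x \<in> U \<Longrightarrow> i \<in> switchable U \<omega>"
proof -
  obtain d y where d: "0 < d" and y: "y 0 = x" "solves_ode (velocity g \<omega> a) d y"
    and fr: "\<exists>\<^sub>F s in at_right 0. beyond_threshold \<eta> (\<omega> i) (y s \<bullet> \<xi> i)"
    using assms unfolding forced_to_cross_iff by blast
  have "(y \<longlongrightarrow> x) (at 0 within {0..d})"
    using solves_ode_continuous_on[OF y(2)] d y(1) by (auto simp: continuous_on_def)
  then have lim: "(y \<longlongrightarrow> x) (at_right 0)"
    using d by (simp add: at_within_Icc_at_right)
  show "(\<omega> i = 1 \<and> x \<bullet> \<xi> i \<le> - \<eta>) \<or> (\<omega> i = -1 \<and> \<eta> \<le> x \<bullet> \<xi> i)"
  proof (rule ccontr)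
    assume neg: "\<not> ?thesis"
    have limi: "((\<lambda>s. y s \<bullet> \<xi> i) \<longlongrightarrow> x \<bullet> \<xi> i) (at_right 0)"
      using lim by (intro tendsto_intros)
    have "\<forall>\<^sub>F s in at_right 0. \<not> beyond_threshold \<eta> (\<omega> i) (y s \<bullet> \<xi> i)"
    proof -
      have "\<forall>\<^sub>F s in at_right 0. \<omega> i = 1 \<longrightarrow> - \<eta> < y s \<bullet> \<xi> i"
        using order_tendstoD(1)[OF limi, of "- \<eta>"] neg by (cases "\<omega> i = 1") auto
      moreover have "\<forall>\<^sub>F s in at_right 0. \<omega> i = -1 \<longrightarrow> y s \<bullet> \<xi> i < \<eta>"
        using order_tendstoD(2)[OF limi, of "\<eta>"] neg by (cases "\<omega> i = -1") auto
      ultimately show ?thesis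
        by eventually_elim (auto simp: beyond_threshold_def)
    qed
    then show False using fr by (simp add: frequently_def)
  qed
  show "i \<in> switchable U \<omega>" if "open U" "x \<in> U"
  proof -
    have "\<forall>\<^sub>F s in at_right 0. y s \<in> U" using topological_tendstoD[OF lim that] .
    then have "\<exists>\<^sub>F s in at_right 0. beyond_threshold \<eta> (\<omega> i) (y s \<bullet> \<xi> i) \<and> y s \<in> U"
      by (intro frequently_rev_mp[OF fr]) (auto elim: eventually_mono)
    then show ?thesis unfolding switchable_def by (auto dest!: frequently_ex)
  qed
qed

section \<open>The switching rule inside a ball of radius \<eta>\<close>

lemma switch_in_strings: "\<omega> \<in> strings \<Longrightarrow> switch \<eta> \<xi> g a x \<omega> \<in> strings"
  by (auto simp: strings_def switch_def)

lemma switch_eq_if_not_forced: "switch \<eta> \<xi> g a x \<omega> i = \<omega> i \<longleftrightarrow> \<not> forced_to_cross \<eta> \<xi> g a x \<omega> i" if "\<omega> \<in> strings"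
proof -
  have "\<omega> i = -1 \<or> \<omega> i = 1" using that by (auto simp: strings_def)
  then show ?thesis by (auto simp: switch_def)
qed

text \<open>The two thresholds of a relay are \<open>2 * \<eta>\<close> apart, so in a ball of radius \<open>\<eta>\<close> a relay that
  has switched cannot switch back.\<close>

lemma not_switchable_after_switch:
  assumes w: "\<omega> \<in> strings" and x: "x \<in> ball p \<eta>" and f: "forced_to_cross \<eta> \<xi> g a x \<omega> i"
  shows "i \<notin> switchable (ball p \<eta>) (switch \<eta> \<xi> g a x \<omega>)"
proof
  assume "i \<in> switchable (ball p \<eta>) (switch \<eta> \<xi> g a x \<omega>)"
  then obtain y where y: "y \<in> ball p \<eta>" "beyond_threshold \<eta> (- \<omega> i) (y \<bullet> \<xi> i)"
    using f by (auto simp: switchable_def switch_def)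
  have "norm (y - x) < 2 * \<eta>"
    using x y(1) dist_triangle[of y x p] by (simp add: dist_norm norm_minus_commute)
  then have "\<bar>(y - x) \<bullet> \<xi> i\<bar> < 2 * \<eta>"
    using Cauchy_Schwarz_ineq2[of "y - x" "\<xi> i"] norm_xi[of i] by simp
  then have "\<bar>y \<bullet> \<xi> i - x \<bullet> \<xi> i\<bar> < 2 * \<eta>" by (simp add: inner_diff_left)
  then show False
    using at_threshold_if_forced_to_cross(1)[OF f] y(2) by (auto simp: beyond_threshold_def)
qed

text \<open>A relay that is not forced is unaffected; a forced one was in \<open>switchable\<close>
  before and has left it after the switch. Membership in the sector survives because a relay that is
  not switchable is beyond its threshold at no point of the ball, in particular not at
  \<open>x\<close>.\<close>

lemma switchable_switch:
  assumes w: "\<omega> \<in> strings" and x: "x \<in> ball p \<eta>"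
  shows "switchable (ball p \<eta>) (switch \<eta> \<xi> g a x \<omega>) \<subseteq> switchable (ball p \<eta>) \<omega>"
    and "switch \<eta> \<xi> g a x \<omega> \<noteq> \<omega> \<Longrightarrow>
      switchable (ball p \<eta>) (switch \<eta> \<xi> g a x \<omega>) \<subset> switchable (ball p \<eta>) \<omega>"
    and "x \<in> sector \<eta> \<xi> \<omega> \<Longrightarrow> x \<in> sector \<eta> \<xi> (switch \<eta> \<xi> g a x \<omega>)"
proof -
  let ?w = "switch \<eta> \<xi> g a x \<omega>" and ?U = "ball p \<eta>"
  have unforced: "i \<in> switchable ?U ?w \<longleftrightarrow> i \<in> switchable ?U \<omega>" if "\<not> forced_to_cross \<eta> \<xi> g a x \<omega> i" for i
    using that by (simp add: switchable_def switch_def)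
  have forced: "i \<notin> switchable ?U ?w" "i \<in> switchable ?U \<omega>" if "forced_to_cross \<eta> \<xi> g a x \<omega> i" for i
    using not_switchable_after_switch[OF w x that] at_threshold_if_forced_to_cross(2)[OF that open_ball x] by auto
  show sub: "switchable ?U ?w \<subseteq> switchable ?U \<omega>"
    using forced unforced by blast
  show "switchable ?U ?w \<subset> switchable ?U \<omega>" if neq: "?w \<noteq> \<omega>"
  proof -
    obtain i where "?w i \<noteq> \<omega> i" using neq by (auto simp: fun_eq_iff)
    then have "forced_to_cross \<eta> \<xi> g a x \<omega> i" using switch_eq_if_not_forced[OF w] by blast
    then show ?thesis using sub forced by blast
  qed
  show "x \<in> sector \<eta> \<xi> ?w" if "x \<in> sector \<eta> \<xi> \<omega>"
    unfolding in_sector_iff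
  proof
    fix i show "\<not> beyond_threshold \<eta> (?w i) (x \<bullet> \<xi> i)"
    proof (cases "forced_to_cross \<eta> \<xi> g a x \<omega> i")
      case True
      then show ?thesis using forced(1) x by (auto simp: switchable_def)
    next
      case False
      then show ?thesis using that by (simp add: in_sector_iff switch_def)
    qed
  qed
qed

text \<open>Each round that changes the string removes an element from the finite set
  \<open>switchable\<close>, so the cascade of switches at one instant ends.\<close>

lemma switch_stabilises:
  assumes "\<omega> \<in> strings" "x \<in> ball p \<eta>" "x \<in> sector \<eta> \<xi> \<omega>"
  shows "\<exists>k. let \<omega>' = (switch \<eta> \<xi> g a x ^^ k) \<omega> in switch \<eta> \<xi> g a x \<omega>' = \<omega>' \<and> \<omega>' \<in> strings \<and>
    x \<in> sector \<eta> \<xi> \<omega>' \<and> switchable (ball p \<eta>) \<omega>' \<subseteq> switchable (ball p \<eta>) \<omega>"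
  using assms
proof (induction "card (switchable (ball p \<eta>) \<omega>)" arbitrary: \<omega> rule: less_induct)
  case less
  let ?w = "switch \<eta> \<xi> g a x \<omega>"
  show ?case
  proof (cases "?w = \<omega>")
    case True
    then show ?thesis using less.prems by (intro exI[of _ 0]) simp
  next
    case False
    have "card (switchable (ball p \<eta>) ?w) < card (switchable (ball p \<eta>) \<omega>)"
      using switchable_switch(2)[OF less.prems(1,2) False] by (intro psubset_card_mono) auto
    from less.hyps[OF this switch_in_strings[OF less.prems(1)] less.prems(2) switchable_switch(3)[OF less.prems]]
    obtain k where k: "let \<omega>' = (switch \<eta> \<xi> g a x ^^ k) ?w in switch \<eta> \<xi> g a x \<omega>' = \<omega>' \<and> \<omega>' \<in> strings \<and>
      x \<in> sector \<eta> \<xi> \<omega>' \<and> switchable (ball p \<eta>) \<omega>' \<subseteq> switchable (ball p \<eta>) ?w" by blast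
    then show ?thesis
      using switchable_switch(1)[OF less.prems(1,2), of a]
      by (intro exI[of _ "Suc k"]) (auto simp: funpow_Suc_right Let_def simp del: funpow.simps)
  qed
qed

text \<open>A new string becomes visible only right after the switching time, and at rest nothing
  would be forced. So the control \<open>a\<close> that forces the switch is kept for a short time
  in the stabilised mode, which moves the state on to some \<open>x'\<close> still in the
  ball.\<close>

lemma reaches_by_switching:
  assumes w: "\<omega> \<in> strings" and x: "x \<in> ball p \<eta>" "x \<in> sector \<eta> \<xi> \<omega>"
    and sw: "switch \<eta> \<xi> g a x \<omega> \<noteq> \<omega>"
  shows "\<exists>x' \<omega>'. reaches x \<omega> x' \<omega>' \<and> x' \<in> ball p \<eta> \<and> switchable (ball p \<eta>) \<omega>' \<subset> switchable (ball p \<eta>) \<omega>"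
proof -
  let ?w = "switch \<eta> \<xi> g a x \<omega>"
  obtain k where k: "let \<omega>' = (switch \<eta> \<xi> g a x ^^ k) ?w in switch \<eta> \<xi> g a x \<omega>' = \<omega>' \<and> \<omega>' \<in> strings \<and>
    x \<in> sector \<eta> \<xi> \<omega>' \<and> switchable (ball p \<eta>) \<omega>' \<subseteq> switchable (ball p \<eta>) ?w"
    using switch_stabilises[OF switch_in_strings[OF w] x(1) switchable_switch(3)[OF w x]] by blast
  define \<omega>' where "\<omega>' = (switch \<eta> \<xi> g a x ^^ k) ?w"
  have w': "switch \<eta> \<xi> g a x \<omega>' = \<omega>'" "\<omega>' \<in> strings" "x \<in> sector \<eta> \<xi> \<omega>'"
    and less: "switchable (ball p \<eta>) \<omega>' \<subset> switchable (ball p \<eta>) \<omega>"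
    using k switchable_switch(2)[OF w x(1) sw] by (auto simp: \<omega>'_def Let_def)
  have \<omega>'_pow: "\<omega>' = (switch \<eta> \<xi> g a x ^^ Suc k) \<omega>"
    by (simp add: \<omega>'_def funpow_Suc_right del: funpow.simps)
  obtain r where r: "0 < r" "ball x r \<subseteq> ball p \<eta>"
    using x(1) open_contains_ball_eq[OF open_ball, of x p \<eta>] by blast
  have "Ck 1 (velocity g \<omega>' a)" using smooth_velocity[OF w'(2)] by (rule smooth_imp_Ck)
  then obtain h y where h: "0 < h" and y: "y 0 = x" "solves_ode (velocity g \<omega>' a) h y" "\<And>s. s \<in> {0..h} \<Longrightarrow> y s \<in> ball x r"
    by (rule local_flow[where p = x, OF _ r(1)]) (metis centre_in_cball less_imp_le)
  have "\<forall>\<^sub>F s in at_right 0. \<not> beyond_threshold \<eta> (\<omega>' i) (y s \<bullet> \<xi> i)" for i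
  proof -
    have "\<not> forced_to_cross \<eta> \<xi> g a x \<omega>' i"
      using w'(1) switch_eq_if_not_forced[OF w'(2), of a x i] by simp
    then show ?thesis
      using h y(1,2) unfolding forced_to_cross_iff frequently_def by blast
  qed
  \<comment> \<open>There are finitely many relays, so the short times during which each one stays
    admissible have a common positive part.\<close>
  then have "\<forall>\<^sub>F s in at_right 0. \<forall>i. \<not> beyond_threshold \<eta> (\<omega>' i) (y s \<bullet> \<xi> i)"
    by (simp add: eventually_all_finite)
  then obtain b where b: "0 < b" "\<And>s. 0 < s \<Longrightarrow> s < b \<Longrightarrow> y s \<in> sector \<eta> \<xi> \<omega>'"
    unfolding eventually_at_right_field in_sector_iff by blast
  define T where "T = min h (b / 2)"
  have T: "0 < T" "T \<le> h" "T < b" using h b by (auto simp: T_def)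
  have sec: "y s \<in> sector \<eta> \<xi> \<omega>'" if "s \<in> {0..T}" for s
    using b(2)[of s] that T w'(3) y(1) by (cases "s = 0") auto
  have "steers \<eta> \<xi> g T (\<lambda>i t. a i) (y 0) \<omega> y (\<lambda>i t. if t \<le> 0 then \<omega> i else \<omega>' i) (y T) \<omega>'"
    by (rule steers_segment[OF w w'(2), where k = "Suc k", OF _ solves_ode_subset[OF y(2) T(2)] T(1) sec])
      (use \<omega>'_pow y(1) in simp)
  then have "reaches x \<omega> (y T) \<omega>'"
    unfolding reaches_def using y(1) sec[of T] T w'(2) by auto
  moreover have "y T \<in> ball p \<eta>" using y(3)[of T] T r(2) by auto
  ultimately show ?thesis using less by blast
qed

text \<open>As long as \<open>c\<close> stays in the sector it is a relay trajectory. Let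
  \<open>t\<close> be the infimum of the times outside. The sector is closed, so \<open>c t\<close>
  still belongs to it; the times outside accumulate at \<open>t\<close> from the right, and by
  finiteness a single relay is beyond its threshold at arbitrarily close later times, which is
  precisely a forced switch.\<close>

lemma reaches_along:
  assumes w: "\<omega> \<in> strings" and c: "solves_ode (velocity g \<omega> a) T c" "0 \<le> T"
    and U: "\<And>s. s \<in> {0..T} \<Longrightarrow> c s \<in> ball p \<eta>" and c0: "c 0 \<in> sector \<eta> \<xi> \<omega>"
  shows "reaches (c 0) \<omega> (c T) \<omega> \<or>
    (\<exists>x' \<omega>'. reaches (c 0) \<omega> x' \<omega>' \<and> x' \<in> ball p \<eta> \<and> switchable (ball p \<eta>) \<omega>' \<subset> switchable (ball p \<eta>) \<omega>)"
proof -
  have upto: "reaches (c 0) \<omega> (c t) \<omega>" if t: "t \<in> {0..T}" and sec: "\<And>s. s \<in> {0..t} \<Longrightarrow> c s \<in> sector \<eta> \<xi> \<omega>" for t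
  proof (cases "t = 0")
    case True
    then show ?thesis using reaches_refl[OF c0 w] by simp
  next
    case False
    then have "0 < t" using t by auto
    then have "steers \<eta> \<xi> g t (\<lambda>i t. a i) (c 0) \<omega> c (\<lambda>i t. if t \<le> 0 then \<omega> i else \<omega> i) (c t) \<omega>"
      by (intro steers_segment[OF w w, where k = 0] solves_ode_subset[OF c(1)] sec) (use t in auto)
    then show ?thesis unfolding reaches_def using sec[of t] t w by auto
  qed
  show ?thesis
  proof (cases "\<forall>s\<in>{0..T}. c s \<in> sector \<eta> \<xi> \<omega>")
    case True
    then show ?thesis using upto[of T] c(2) by auto
  next
    case False
    define S where "S = {s \<in> {0..T}. c s \<notin> sector \<eta> \<xi> \<omega>}"
    define t where "t = Inf S"
    have S: "S \<noteq> {}" "bdd_below S" using False by (auto simp: S_def bdd_below_def)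
    have t0: "0 \<le> t" unfolding t_def by (rule cInf_greatest[OF S(1)]) (auto simp: S_def)
    have tle: "t \<le> s" if "s \<in> S" for s unfolding t_def using that S(2) by (rule cInf_lower)
    obtain s0 where s0: "s0 \<in> S" using S by blast
    have tT: "t \<le> T" using tle[OF s0] s0 by (auto simp: S_def)
    have before: "c s \<in> sector \<eta> \<xi> \<omega>" if "0 \<le> s" "s < t" for s
      using tle[of s] that tT by (force simp: S_def)
    have ct: "c t \<in> sector \<eta> \<xi> \<omega>"
    proof (cases "t = 0")
      case True
      then show ?thesis using c0 by simp
    next
      case False
      then have t_pos: "0 < t" using t0 by simp
      have "(c \<longlongrightarrow> c t) (at t within {0..T})"
        using solves_ode_continuous_on[OF c(1)] t0 tT by (auto simp: continuous_on_def)
      then have "(c \<longlongrightarrow> c t) (at t within {0..t})"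
        by (rule tendsto_within_subset) (use tT in auto)
      then have lim: "(c \<longlongrightarrow> c t) (at_left t)"
        using t_pos by (simp add: at_within_Icc_at_left)
      have "\<forall>\<^sub>F s in at_left t. c s \<in> sector \<eta> \<xi> \<omega>"
        unfolding eventually_at_left_field using t_pos before by (intro exI[of _ 0]) auto
      then show ?thesis
        by (rule Lim_in_closed_set[OF closed_sector _ _ lim]) simp
    qed
    have tlt: "t < T"
      using tle[OF s0] s0 ct tT by (cases "t = T") (auto simp: S_def)
    have "\<exists>\<^sub>F s in at_right 0. \<exists>i\<in>UNIV. beyond_threshold \<eta> (\<omega> i) (c (t + s) \<bullet> \<xi> i)"
      unfolding frequently_def
    proof
      assume "\<forall>\<^sub>F s in at_right 0. \<not> (\<exists>i\<in>UNIV. beyond_threshold \<eta> (\<omega> i) (c (t + s) \<bullet> \<xi> i))"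
      then obtain b where b: "0 < b" "\<And>s. 0 < s \<Longrightarrow> s < b \<Longrightarrow> c (t + s) \<in> sector \<eta> \<xi> \<omega>"
        unfolding eventually_at_right_field in_sector_iff by blast
      obtain s where s: "s \<in> S" "s < t + b"
        using cInf_lessD[OF S(1), of "t + b"] b(1) unfolding t_def by auto
      then have "t < s" using tle[OF s(1)] ct by (cases "s = t") (auto simp: S_def)
      then show False using b(2)[of "s - t"] s by (auto simp: S_def)
    qed
    from frequently_bex_finite[OF finite_class.finite_UNIV this]
    obtain i where fr: "\<exists>\<^sub>F s in at_right 0. beyond_threshold \<eta> (\<omega> i) (c (t + s) \<bullet> \<xi> i)"
      by blast
    have "forced_to_cross \<eta> \<xi> g a (c t) \<omega> i"
      unfolding forced_to_cross_iff
      using fr tlt solves_ode_shift[OF c(1) t0, of "T - t"]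
      by (intro exI[of _ "T - t"] conjI exI[of _ "\<lambda>s. c (t + s)"]) auto
    then have "switch \<eta> \<xi> g a (c t) \<omega> \<noteq> \<omega>"
      using switch_eq_if_not_forced[OF w] by metis
    from reaches_by_switching[OF w U[of t] ct this] obtain x' \<omega>' where
      *: "reaches (c t) \<omega> x' \<omega>'" "x' \<in> ball p \<eta>" "switchable (ball p \<eta>) \<omega>' \<subset> switchable (ball p \<eta>) \<omega>"
      using t0 tT by auto
    have "reaches (c 0) \<omega> (c t) \<omega>"
      using t0 tT before ct by (intro upto) (auto simp: le_less)
    then show ?thesis using * reaches_trans by blast
  qed
qed

section \<open>Chow's theorem with the mode frozen\<close>

definition joined_in :: "(real^'n) set \<Rightarrow> ('m \<Rightarrow> int) \<Rightarrow> real^'n \<Rightarrow> real^'n \<Rightarrow> bool" where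
  "joined_in U \<omega> x y \<longleftrightarrow> (\<exists>a T c. 0 \<le> T \<and> solves_ode (velocity g \<omega> a) T c \<and> c 0 = x \<and> c T = y \<and>
    (\<forall>s\<in>{0..T}. c s \<in> U))"

text \<open>Reversing time amounts to negating the controls. This works because
  \<open>joined_in\<close> keeps the string fixed and ignores the thresholds; a relay trajectory
  need not be reversible.\<close>

lemma symp_joined_in: "symp (joined_in U \<omega>)"
proof (rule sympI)
  fix x y assume "joined_in U \<omega> x y"
  then obtain a T c where c: "0 \<le> T" "solves_ode (velocity g \<omega> a) T c" "c 0 = x" "c T = y" "\<forall>s\<in>{0..T}. c s \<in> U"
    unfolding joined_in_def by blast
  have "(\<lambda>x. - velocity g \<omega> a x) = velocity g \<omega> (\<lambda>i. - a i)"
    by (simp add: velocity_def fun_eq_iff sum_negf)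
  then have "solves_ode (velocity g \<omega> (\<lambda>i. - a i)) T (\<lambda>s. c (T - s))"
    using solves_ode_reverse[OF c(2)] by simp
  then show "joined_in U \<omega> y x"
    unfolding joined_in_def using c
    by (intro exI[of _ "\<lambda>i. - a i"] exI[of _ T] exI[of _ "\<lambda>s. c (T - s)"]) auto
qed

text \<open>The flow itself serves as the approximating map: its error \<open>C * s^2\<close> is at
  most \<open>\<epsilon> * h\<close> once \<open>h \<le> \<epsilon> / (\<bar>C\<bar> + 1)\<close>.
  Starts in a small ball keep it inside \<open>U\<close>.\<close>

lemma euler_approximable_velocity:
  assumes w: "\<omega> \<in> strings" and U: "open U" "p \<in> U"
  shows "euler_approximable (joined_in U \<omega>)\<^sup>*\<^sup>* (velocity g \<omega> a) p"
proof -
  obtain R where R: "0 < R" "ball p R \<subseteq> U" using U open_contains_ball by blast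
  have "Ck 1 (velocity g \<omega> a)" using smooth_velocity[OF w] by (rule smooth_imp_Ck)
  then obtain r H C \<psi> where r: "0 < r" and H: "0 < H"
    and \<psi>: "\<And>x. x \<in> cball p r \<Longrightarrow> \<psi> 0 x = x"
    "\<And>x. x \<in> cball p r \<Longrightarrow> solves_ode (velocity g \<omega> a) H (\<lambda>s. \<psi> s x)"
    "\<And>x s. x \<in> cball p r \<Longrightarrow> s \<in> {0..H} \<Longrightarrow> \<psi> s x \<in> ball p R"
    "continuous_on ({0..H} \<times> cball p r) (\<lambda>(s, x). \<psi> s x)"
    "\<And>x s. x \<in> cball p r \<Longrightarrow> s \<in> {0..H} \<Longrightarrow> norm (\<psi> s x - (x + s *\<^sub>R velocity g \<omega> a x)) \<le> C * s\<^sup>2"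
    by (rule local_flow[where p = p, OF _ R(1)]) (rule that)
  show ?thesis
    unfolding euler_approximable_def
  proof (rule exI[of _ r], intro conjI allI impI)
    fix \<epsilon> :: real assume \<epsilon>: "0 < \<epsilon>"
    define h0 where "h0 = min H (\<epsilon> / (\<bar>C\<bar> + 1))"
    have h0: "0 < h0" "h0 \<le> H" "h0 \<le> \<epsilon> / (\<bar>C\<bar> + 1)" using H \<epsilon> by (auto simp: h0_def)
    show "\<exists>h0>0. \<forall>h. 0 < h \<and> h \<le> h0 \<longrightarrow> (\<exists>\<psi>. continuous_on ({0..h} \<times> cball p r) (\<lambda>(s, x). \<psi> s x) \<and>
      (\<forall>s\<in>{0..h}. \<forall>x\<in>cball p r. (joined_in U \<omega>)\<^sup>*\<^sup>* x (\<psi> s x) \<and>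
        norm (\<psi> s x - (x + s *\<^sub>R velocity g \<omega> a x)) \<le> \<epsilon> * h))"
    proof (rule exI[of _ h0], intro conjI allI impI)
      fix h assume h: "0 < h \<and> h \<le> h0"
      have "joined_in U \<omega> x (\<psi> s x)" if "s \<in> {0..h}" "x \<in> cball p r" for s x
        unfolding joined_in_def using that h h0 \<psi>(1-3) R(2)
        by (intro exI[of _ a] exI[of _ s] exI[of _ "\<lambda>s. \<psi> s x"] conjI solves_ode_subset[OF \<psi>(2)[OF that(2)]]) auto
      moreover have "norm (\<psi> s x - (x + s *\<^sub>R velocity g \<omega> a x)) \<le> \<epsilon> * h" if s: "s \<in> {0..h}" and x: "x \<in> cball p r" for s x
      proof -
        have "norm (\<psi> s x - (x + s *\<^sub>R velocity g \<omega> a x)) \<le> C * s\<^sup>2"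
          using \<psi>(5)[OF x, of s] s h h0 by auto
        also have "\<dots> \<le> (\<bar>C\<bar> + 1) * h\<^sup>2"
          using s by (intro mult_mono power_mono) auto
        also have "\<dots> \<le> (\<bar>C\<bar> + 1) * (\<epsilon> / (\<bar>C\<bar> + 1) * h)"
          unfolding power2_eq_square using h h0 by (intro mult_left_mono mult_right_mono) auto
        also have "\<dots> = \<epsilon> * h" by simp
        finally show ?thesis .
      qed
      moreover have "continuous_on ({0..h} \<times> cball p r) (\<lambda>(s, x). \<psi> s x)"
        by (rule continuous_on_subset[OF \<psi>(4)]) (use h h0 in auto)
      ultimately show "\<exists>\<psi>. continuous_on ({0..h} \<times> cball p r) (\<lambda>(s, x). \<psi> s x) \<and>
        (\<forall>s\<in>{0..h}. \<forall>x\<in>cball p r. (joined_in U \<omega>)\<^sup>*\<^sup>* x (\<psi> s x) \<and>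
          norm (\<psi> s x - (x + s *\<^sub>R velocity g \<omega> a x)) \<le> \<epsilon> * h)"
        by (intro exI[of _ \<psi>]) blast
    qed (rule h0)
  qed (rule r)
qed

text \<open>Each field \<open>g i (\<omega> i)\<close> and its negative is the velocity for a
  control that is plus or minus a unit vector. The reflexive transitive closure of
  \<open>joined_in\<close> stands for piecewise constant controls.\<close>

lemma joined_in_ball:
  assumes w: "\<omega> \<in> strings" and xy: "x \<in> ball p r" "y \<in> ball p r"
  shows "(joined_in (ball p r) \<omega>)\<^sup>*\<^sup>* x y"
proof (rule orbit_connected[of _ "ball p r" x y "range (\<lambda>i. g i (\<omega> i))"])
  have gi: "g i (\<omega> i) = velocity g \<omega> (\<lambda>j. if j = i then 1 else 0)" for i
    by (simp add: fun_eq_iff velocity_def if_distrib[of "\<lambda>c. c *\<^sub>R _"] cong: if_cong)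
  have gi': "(\<lambda>x. - g i (\<omega> i) x) = velocity g \<omega> (\<lambda>j. if j = i then -1 else 0)" for i
    by (simp add: fun_eq_iff velocity_def if_distrib[of "\<lambda>c. c *\<^sub>R _"] cong: if_cong)
  show "euler_approximable (joined_in (ball p r) \<omega>)\<^sup>*\<^sup>* f q"
    and "euler_approximable (joined_in (ball p r) \<omega>)\<^sup>*\<^sup>* (\<lambda>x. - f x) q"
    if "f \<in> range (\<lambda>i. g i (\<omega> i))" "q \<in> ball p r" for f q
    using that euler_approximable_velocity[OF w open_ball] gi gi' by auto
  show "smooth f" if "f \<in> range (\<lambda>i. g i (\<omega> i))" for f
    using that smooth_g w by (auto simp: strings_def)
qed (use xy chow[OF w] symp_rtranclp[OF symp_joined_in] in auto)

text \<open>Two nested inductions: on the number of relays that can still switch, and along a chain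
  of controls leading to \<open>q\<close> in the current mode. The inner one carries the alternative
  \<open>?less\<close>, since a switch at any link invalidates the remaining links, which were made
  for the old mode.\<close>

lemma reaches_in_ball:
  assumes "\<omega> \<in> strings" "x \<in> ball p \<eta>" "x \<in> sector \<eta> \<xi> \<omega>" "q \<in> ball p \<eta>"
  shows "\<exists>\<omega>'. reaches x \<omega> q \<omega>'"
  using assms
proof (induction "card (switchable (ball p \<eta>) \<omega>)" arbitrary: x \<omega> rule: less_induct)
  case less
  let ?less = "\<exists>x' \<omega>'. reaches x \<omega> x' \<omega>' \<and> x' \<in> ball p \<eta> \<and>
    switchable (ball p \<eta>) \<omega>' \<subset> switchable (ball p \<eta>) \<omega>"
  have "(joined_in (ball p \<eta>) \<omega>)\<^sup>*\<^sup>* x q" using less.prems by (intro joined_in_ball)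
  then have "reaches x \<omega> q \<omega> \<or> ?less"
  proof induction
    case base
    then show ?case using reaches_refl less.prems by blast
  next
    case (step y z)
    show ?case
    proof (cases ?less)
      case False
      then have xy: "reaches x \<omega> y \<omega>" using step.IH by blast
      then have y: "y \<in> sector \<eta> \<xi> \<omega>" by (simp add: reaches_def)
      obtain a T c where c: "0 \<le> T" "solves_ode (velocity g \<omega> a) T c" "c 0 = y" "c T = z" "\<forall>s\<in>{0..T}. c s \<in> ball p \<eta>"
        using step.hyps(2) unfolding joined_in_def by blast
      show ?thesis
        using reaches_along[OF less.prems(1) c(2,1), of p] c(3-5) y reaches_trans[OF xy] by blast
    qed simp
  qed
  then show ?case
  proof
    assume ?less
    then obtain x' \<omega>' where *: "reaches x \<omega> x' \<omega>'" "x' \<in> ball p \<eta>" "switchable (ball p \<eta>) \<omega>' \<subset> switchable (ball p \<eta>) \<omega>"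
      by blast
    have "card (switchable (ball p \<eta>) \<omega>') < card (switchable (ball p \<eta>) \<omega>)"
      using *(3) by (intro psubset_card_mono) auto
    then have "\<exists>\<omega>''. reaches x' \<omega>' q \<omega>''"
      by (rule less.hyps) (use *(1,2) less.prems in \<open>auto simp: reaches_def\<close>)
    then show ?thesis using *(1) reaches_trans by blast
  qed blast
qed

lemma reaches_everywhere:
  assumes A: "A \<in> sector \<eta> \<xi> w0" "w0 \<in> strings"
  shows "\<exists>\<omega>. reaches A w0 B \<omega>"
proof -
  \<comment> \<open>The successor makes \<open>N\<close> positive and the spacing
    \<open>norm (B - A) / N\<close> strictly less than \<open>\<eta>\<close>, so each point of the
    chain lies in the open ball around its predecessor.\<close>
  define N where "N = Suc (nat \<lceil>norm (B - A) / \<eta>\<rceil>)"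
  have N: "norm (B - A) < real N * \<eta>"
  proof -
    have "norm (B - A) / \<eta> < real N"
      unfolding N_def using real_nat_ceiling_ge[of "norm (B - A) / \<eta>"] by simp
    then show ?thesis using eta_pos by (simp add: pos_divide_less_eq)
  qed
  have Npos: "0 < real N" by (simp add: N_def)
  define p where "p j = A + (real j / real N) *\<^sub>R (B - A)" for j
  have "\<exists>\<omega>. reaches A w0 (p j) \<omega>" for j
  proof (induction j)
    case 0
    then show ?case using reaches_refl[OF A] by (auto simp: p_def)
  next
    case (Suc j)
    then obtain \<omega> where w: "reaches A w0 (p j) \<omega>" by blast
    have "p j - p (Suc j) = - (1 / real N) *\<^sub>R (B - A)"
      by (simp add: p_def algebra_simps add_divide_distrib scaleR_add_left)
    then have "dist (p j) (p (Suc j)) = norm (B - A) / real N"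
      using Npos by (simp add: dist_norm)
    also have "\<dots> < \<eta>" using N Npos by (simp add: pos_divide_less_eq mult.commute)
    finally have "p (Suc j) \<in> ball (p j) \<eta>" by simp
    then have "\<exists>\<omega>'. reaches (p j) \<omega> (p (Suc j)) \<omega>'"
      using w eta_pos by (intro reaches_in_ball[of _ _ "p j"]) (auto simp: reaches_def)
    then show ?case using w reaches_trans by blast
  qed
  moreover have "p N = B" using Npos by (simp add: p_def)
  ultimately show ?thesis by metis
qed

lemma controllable:
  assumes A: "A \<in> sector \<eta> \<xi> w0" "w0 \<in> strings"
  shows "\<exists>T>0. \<exists>u. (\<forall>i. piecewise_constant_on 0 T (u i)) \<and>
      (\<exists>z w. relay_solution \<eta> \<xi> g T u A w0 z w \<and> z T = B)"
proof -
  obtain \<omega> where "reaches A w0 B \<omega>" using reaches_everywhere[OF A] by blast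
  then obtain S u z w where s: "steers \<eta> \<xi> g S u A w0 z w B \<omega>"
    and B: "B \<in> sector \<eta> \<xi> \<omega>" "\<omega> \<in> strings" unfolding reaches_def by blast
  \<comment> \<open>The trajectory found may have length 0, for instance when \<open>A = B\<close>;
    resting at \<open>B\<close> for one unit of time under zero control makes the total time
    positive.\<close>
  have "solves_ode (velocity g \<omega> (\<lambda>i. 0)) 1 (\<lambda>t. B)"
    by (auto simp: solves_ode_def velocity_def)
  from steers_segment[OF B(2,2), where k = 0, OF _ this] B
  have "steers \<eta> \<xi> g 1 (\<lambda>i t. 0) B \<omega> (\<lambda>t. B) (\<lambda>i t. if t \<le> 0 then \<omega> i else \<omega> i) B \<omega>" by simp
  from steers_concat[OF s this] obtain u' z' w' where "steers \<eta> \<xi> g (S + 1) u' A w0 z' w' B \<omega>" by blast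
  then have "relay_solution \<eta> \<xi> g (S + 1) u' A w0 z' w'" "\<forall>i. piecewise_constant_on 0 (S + 1) (u' i)" "z' (S + 1) = B"
    by (simp_all add: relay_solution_if_steers) (simp_all add: steers_def)
  moreover have "0 < S + 1" using s by (simp add: steers_def)
  ultimately show ?thesis by blast
qed

end

theorem theorem3p4:
  fixes \<eta> :: real
    and \<xi> :: "'m::finite \<Rightarrow> real^'n"
    and g :: "'m \<Rightarrow> int \<Rightarrow> real^'n \<Rightarrow> real^'n"
  assumes "\<eta> > 0"
    and "\<And>i. norm (\<xi> i) = 1"
    and "\<And>i \<sigma>. \<sigma> \<in> {-1, 1} \<Longrightarrow> smooth (g i \<sigma>)"
    and "\<And>\<omega>. \<omega> \<in> strings \<Longrightarrow> chow_hypothesis (range (\<lambda>i. g i (\<omega> i)))"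
  shows "\<forall>A B. \<forall>w0\<in>strings. A \<in> sector \<eta> \<xi> w0 \<longrightarrow>
    (\<exists>T>0. \<exists>u. (\<forall>i. piecewise_constant_on 0 T (u i)) \<and>
      (\<exists>z w. relay_solution \<eta> \<xi> g T u A w0 z w \<and> z T = B))"
proof -
  interpret relay_system \<eta> \<xi> g
    using assms by unfold_locales
  show ?thesis using controllable by blast
qed

end
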